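(* If $\mathcal T\in\mathbb R^{n\times n\times n\times n}$ is a $4$-tensor generated (as a tensor train of length 2) by carriages $\mathcal A=\sum_{i=1}^{r_{\mathcal A}}\lambda_i\mathbf u_i^{\otimes 3}$ and $\mathcal B=\sum_{j=1}^{r_{\mathcal B}}\mu_j\mathbf v_j^{\otimes 3}$, i.e. $$\mathcal T=\sum_{i=1}^{r_{\mathcal A}}\sum_{j=1}^{r_{\mathcal B}}\lambda_i\mu_j\,\langle\mathbf u_i,\mathbf v_j\rangle\;\mathbf u_i\otimes\mathbf u_i\otimes\mathbf v_j\otimes\mathbf v_j ,$$ where $\lambda_i,\mu_j\in\mathbb R$ are generic coefficients and $\{\mathbf u_i\}_{i=1}^{r_{\mathcal A}},\{\mathbf v_j\}_{j=1}^{r_{\mathcal B}}\subset\mathbb R^n$ are generic vectors, then the Slice Algorithm described in the context recovers $r_{\mathcal A}$ and $r_{\mathcal B}$, and recovers $\lambda_i$, $\mu_j$, $\{\mathbf u_i\}_{i=1}^{r_{\mathcal A}}$ and $\{\mathbf v_j\}_{j=1}^{r_{\mathcal B}}$ up to permutation and sign.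
   Context: Generic: an object that lies in a Zariski-closed subset of some $\mathbb R^N$ (such as a scalar or an orthonormal set of vectors) is generic if it lies in some Zariski-open subset of this closed set; so an object drawn at random from the closed set is generic with probability 1. Two cases are considered: the orthogonal case, in which $\{\mathbf u_i\}$ and $\{\mathbf v_j\}$ are orthonormal sets, and the non-orthogonal case, in which they are linearly independent but not orthonormal sets. The algorithm receives an indicator telling which case holds; "whitening" is switched on exactly in the non-orthogonal case. For a 4-tensor $\mathcal S$ and matrices or vectors $M_1,\dots,M_4$, $\mathcal S(M_1,M_2,M_3,M_4)$ denotes the contraction of $M_k$ along mode $k$ for each $k$: $(\mathbf a\otimes\mathbf b\otimes\mathbf c\otimes\mathbf d)(W_1,W_2,W_3,W_4)=W_1\mathbf a\otimes W_2\mathbf b\otimes W_3\mathbf c\otimes W_4\mathbf d$ for matrices, and $(\mathbf a\otimes\mathbf b\otimes\mathbf c\otimes\mathbf d)(\mathbf p,\mathbf q,\mathbf r,\mathbf s)=\langle\mathbf a,\mathbf p\rangle\langle\mathbf b,\mathbf q\rangle\langle\mathbf c,\mathbf r\rangle\langle\mathbf d,\mathbf s\rangle$ for vectors. $\mathcal S(:,:,i_3,i_4)$ and $\mathcal S(i_1,i_2,:,:)$ denote matrix slices. $\dagger$ denotes the Moore–Penrose pseudoinverse. Slice Algorithm, input $\mathcal T$ and the whitening indicator: 1. If whitening: repeat the following until $\mathbf C_{\mathcal A},\mathbf C_{\mathcal B}$ are positive semidefinite, or exit with failure: choose generic real $n\times n$ matrices $\rho,\tau$ and set $\mathbf C_{\mathcal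 A}=\sum_{i_3,i_4}\rho_{i_3i_4}\mathcal T(:,:,i_3,i_4)$, $\mathbf C_{\mathcal B}=\sum_{i_1,i_2}\tau_{i_1i_2}\mathcal T(i_1,i_2,:,:)$. Take "skinny" eigendecompositions (nonzero eigenvalues only) $\mathbf C_{\mathcal A}=\mathbf X_{\mathcal A}\mathbf D_{\mathcal A}\mathbf X_{\mathcal A}^\top$, $\mathbf C_{\mathcal B}=\mathbf X_{\mathcal B}\mathbf D_{\mathcal B}\mathbf X_{\mathcal B}^\top$, and put $\mathbf W_{\mathcal A}=\mathbf D_{\mathcal A}^{-1/2}\mathbf X_{\mathcal A}^\top$, $\mathbf W_{\mathcal B}=\mathbf D_{\mathcal B}^{-1/2}\mathbf X_{\mathcal B}^\top$, $\overline{\mathcal T}=\mathcal T(\mathbf W_{\mathcal A},\mathbf W_{\mathcal A},\mathbf W_{\mathcal B},\mathbf W_{\mathcal B})$. If not whitening: put $\overline{\mathcal T}=\mathcal T$. 2. Choose generic real matrices $\alpha,\beta$ (of sizes matching the modes of $\overline{\mathcal T}$) and set $\mathbf S_{\mathcal A}=\sum_{i_3,i_4}\alpha_{i_3i_4}\overline{\mathcal T}(:,:,i_3,i_4)$, $\mathbf S_{\mathcal B}=\sum_{i_1,i_2}\beta_{i_1i_2}\overline{\mathcal T}(i_1,i_2,:,:)$. Let $\{\overline{\mathbf u}_i\}_{i=1}^{r_{\mathcal A}}$ and $\{\overline{\mathbf v}_j\}_{j=1}^{r_{\mathcal B}}$ be the (unit) eigenvectors of $\mathbf S_{\mathcal A}$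 and of $\mathbf S_{\mathcal B}$ with nonzero eigenvalue; their numbers are the output ranks. 3. If whitening, output $\mathbf u_i=\mathbf W_{\mathcal A}^\dagger\overline{\mathbf u}_i/\|\mathbf W_{\mathcal A}^\dagger\overline{\mathbf u}_i\|$ and $\mathbf v_j=\mathbf W_{\mathcal B}^\dagger\overline{\mathbf v}_j/\|\mathbf W_{\mathcal B}^\dagger\overline{\mathbf v}_j\|$; otherwise output $\mathbf u_i=\overline{\mathbf u}_i$ and $\mathbf v_j=\overline{\mathbf v}_j$. 4. Form the $r_{\mathcal A}\times r_{\mathcal B}$ matrix $\mathbf R_{ij}=\overline{\mathcal T}(\overline{\mathbf u}_i,\overline{\mathbf u}_i,\overline{\mathbf v}_j,\overline{\mathbf v}_j)/\langle\mathbf u_i,\mathbf v_j\rangle$. From the singular value decomposition of $\mathbf R$, output $\boldsymbol\lambda$ = the largest singular value multiplied by the corresponding left singular vector, and $\boldsymbol\mu$ = the corresponding right singular vector.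
   Formalization: λ, μ are recovered also up to a common scalar (cλ, μ/c); non-unit vectors up to norm, with λ_i scaled by ‖u_i‖³; with whitening, coefficients after multiplying by the squared step-3 norm, excluding exactly one rank equal to 1; runs exiting with failure are unconstrained. *)

theory Defs
  imports
    "HOL-Analysis.Abstract_Topology"
    "HOL-Combinatorics.Permutations"
    "Jordan_Normal_Form.Char_Poly"
begin

section \<open>Genericity\<close>

text \<open>A set of objects is given coordinates by a set \<open>C\<close> of real-valued functions; polynomials
  are the functions generated by these coordinates.\<close>

inductive_set poly_funs :: "('x \<Rightarrow> real) set \<Rightarrow> ('x \<Rightarrow> real) set" for C where
  const: "(\<lambda>_. a) \<in> poly_funs C"
| coord: "f \<in> C \<Longrightarrow> f \<in> poly_funs C"
| add: "\<lbrakk>p \<in> poly_funs C; q \<in> poly_funs C\<rbrakk> \<Longrightarrow> (\<lambda>x. p x + q x) \<in> poly_funs C"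
| mult: "\<lbrakk>p \<in> poly_funs C; q \<in> poly_funs C\<rbrakk> \<Longrightarrow> (\<lambda>x. p x * q x) \<in> poly_funs C"

text \<open>The Zariski topology that \<open>X\<close> inherits from the ambient coordinate space.\<close>

definition zariski :: "('x \<Rightarrow> real) set \<Rightarrow> 'x set \<Rightarrow> 'x topology" where
  "zariski C X = topology_generated_by {{x \<in> X. p x \<noteq> 0} | p. p \<in> poly_funs C}"

text \<open>Density of the open set is part of genericity: \<open>X\<close> may be reducible (the orthogonal
  matrices have two components), and a nonempty open set could then miss a whole component.\<close>

definition generically :: "('x \<Rightarrow> real) set \<Rightarrow> 'x set \<Rightarrow> ('x \<Rightarrow> bool) \<Rightarrow> bool" where
  "generically C X P \<longleftrightarrow>
    (\<exists>G. openin (zariski C X) G \<and> zariski C X closure_of G = X \<and> (\<forall>x\<in>G. P x))"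

definition mat_pairs :: "nat \<Rightarrow> nat \<Rightarrow> (real mat \<times> real mat) set" where
  "mat_pairs p q = carrier_mat p p \<times> carrier_mat q q"

definition mat_pair_coords :: "nat \<Rightarrow> nat \<Rightarrow> (real mat \<times> real mat \<Rightarrow> real) set" where
  "mat_pair_coords p q =
     {\<lambda>(M, N). M $$ (i, j) | i j. i < p \<and> j < p} \<union> {\<lambda>(M, N). N $$ (i, j) | i j. i < q \<and> j < q}"


section \<open>Tensor trains of length two\<close>

definition vnorm :: "real vec \<Rightarrow> real" where
  "vnorm x = sqrt (x \<bullet> x)"

text \<open>Tensors are functions of four indices; their dimensions are supplied where they are used.
  The vectors \<open>u\<^sub>i\<close>, \<open>v\<^sub>j\<close> are the columns of \<open>U\<close>, \<open>V\<close>, so the ranks are the numbers of columns.\<close>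

type_synonym tensor4 = "nat \<Rightarrow> nat \<Rightarrow> nat \<Rightarrow> nat \<Rightarrow> real"

type_synonym train = "real vec \<times> real vec \<times> real mat \<times> real mat"

definition train_tensor :: "real vec \<Rightarrow> real vec \<Rightarrow> real mat \<Rightarrow> real mat \<Rightarrow> tensor4" where
  "train_tensor l m U V = (\<lambda>i1 i2 i3 i4.
     \<Sum>i<dim_col U. \<Sum>j<dim_col V. l $ i * m $ j * (col U i \<bullet> col V j) *
       (U $$ (i1, i) * U $$ (i2, i) * V $$ (i3, j) * V $$ (i4, j)))"

definition orthonormal_cols :: "real mat \<Rightarrow> bool" where
  "orthonormal_cols U \<longleftrightarrow> U\<^sup>T * U = 1\<^sub>m (dim_col U)"

definition unit_cols :: "real mat \<Rightarrow> bool" where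
  "unit_cols U \<longleftrightarrow> (\<forall>i<dim_col U. vnorm (col U i) = 1)"

text \<open>\<open>F\<close> cuts out the closed set in which each of the two vector families is generic.\<close>

definition trains :: "nat \<Rightarrow> nat \<Rightarrow> nat \<Rightarrow> (real mat \<Rightarrow> bool) \<Rightarrow> train set" where
  "trains n rA rB F = {(l, m, U, V). l \<in> carrier_vec rA \<and> m \<in> carrier_vec rB \<and>
     U \<in> carrier_mat n rA \<and> V \<in> carrier_mat n rB \<and> F U \<and> F V}"

definition train_coords :: "nat \<Rightarrow> nat \<Rightarrow> nat \<Rightarrow> (train \<Rightarrow> real) set" where
  "train_coords n rA rB =
     {\<lambda>(l, m, U, V). l $ i | i. i < rA} \<union> {\<lambda>(l, m, U, V). m $ j | j. j < rB} \<union>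
     {\<lambda>(l, m, U, V). U $$ (k, i) | k i. k < n \<and> i < rA} \<union>
     {\<lambda>(l, m, U, V). V $$ (k, j) | k j. k < n \<and> j < rB}"


section \<open>Linear algebra\<close>

definition psd :: "real mat \<Rightarrow> bool" where
  "psd C \<longleftrightarrow> square_mat C \<and> C\<^sup>T = C \<and> (\<forall>x\<in>carrier_vec (dim_row C). 0 \<le> x \<bullet> (C *\<^sub>v x))"

definition skinny_eigendecomposition :: "real mat \<Rightarrow> real mat \<Rightarrow> real mat \<Rightarrow> bool" where
  "skinny_eigendecomposition C X D \<longleftrightarrow>
     X \<in> carrier_mat (dim_row C) (dim_col X) \<and> D \<in> carrier_mat (dim_col X) (dim_col X) \<and>
     orthonormal_cols X \<and> diagonal_mat D \<and> (\<forall>i<dim_col X. D $$ (i, i) \<noteq> 0) \<and> C = X * D * X\<^sup>T"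

definition whitens :: "real mat \<Rightarrow> real mat \<Rightarrow> bool" where
  "whitens W C \<longleftrightarrow> (\<exists>X D. skinny_eigendecomposition C X D \<and>
     W = mat_diag (dim_row D) (\<lambda>i. 1 / sqrt (D $$ (i, i))) * X\<^sup>T)"

definition is_pinv :: "real mat \<Rightarrow> real mat \<Rightarrow> bool" where
  "is_pinv A B \<longleftrightarrow> B \<in> carrier_mat (dim_col A) (dim_row A) \<and>
     A * B * A = A \<and> B * A * B = B \<and> (A * B)\<^sup>T = A * B \<and> (B * A)\<^sup>T = B * A"

definition pinv :: "real mat \<Rightarrow> real mat" where
  "pinv A = (THE B. is_pinv A B)"

text \<open>The unit eigenvectors with nonzero eigenvalue: a unit eigenvector is only determined up to
  sign, so the list contains exactly one of \<open>x\<close>, \<open>- x\<close>. Such a list exists only if the nonzero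
  eigenvalues are simple.\<close>

definition nonzero_eigenvectors :: "real mat \<Rightarrow> real vec list \<Rightarrow> bool" where
  "nonzero_eigenvectors S xs \<longleftrightarrow>
     (\<forall>x\<in>set xs. vnorm x = 1 \<and> (\<exists>k. k \<noteq> 0 \<and> eigenvector S x k)) \<and>
     (\<forall>x k. vnorm x = 1 \<and> k \<noteq> 0 \<and> eigenvector S x k \<longrightarrow> x \<in> set xs \<or> - x \<in> set xs) \<and>
     (\<forall>i j. i < j \<and> j < length xs \<longrightarrow> xs ! i \<noteq> xs ! j \<and> xs ! i \<noteq> - (xs ! j))"

definition is_svd :: "real mat \<Rightarrow> real mat \<Rightarrow> real mat \<Rightarrow> real mat \<Rightarrow> bool" where
  "is_svd R P S Q \<longleftrightarrow>
     P \<in> carrier_mat (dim_row R) (dim_row R) \<and> orthonormal_cols P \<and>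
     Q \<in> carrier_mat (dim_col R) (dim_col R) \<and> orthonormal_cols Q \<and>
     S \<in> carrier_mat (dim_row R) (dim_col R) \<and> diagonal_mat S \<and>
     (\<forall>k<min (dim_row R) (dim_col R). 0 \<le> S $$ (k, k)) \<and> R = P * S * Q\<^sup>T"

definition top_singular_triple :: "real mat \<Rightarrow> real \<Rightarrow> real vec \<Rightarrow> real vec \<Rightarrow> bool" where
  "top_singular_triple R s x y \<longleftrightarrow> (\<exists>P S Q k. is_svd R P S Q \<and>
     k < min (dim_row R) (dim_col R) \<and>
     (\<forall>i<min (dim_row R) (dim_col R). S $$ (i, i) \<le> S $$ (k, k)) \<and>
     s = S $$ (k, k) \<and> x = col P k \<and> y = col Q k)"


section \<open>The Slice Algorithm\<close>

definition slice_A :: "nat \<Rightarrow> nat \<Rightarrow> real mat \<Rightarrow> tensor4 \<Rightarrow> real mat" where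
  "slice_A p q a S = mat p p (\<lambda>(i1, i2). \<Sum>i3<q. \<Sum>i4<q. a $$ (i3, i4) * S i1 i2 i3 i4)"

definition slice_B :: "nat \<Rightarrow> nat \<Rightarrow> real mat \<Rightarrow> tensor4 \<Rightarrow> real mat" where
  "slice_B p q b S = mat q q (\<lambda>(i3, i4). \<Sum>i1<p. \<Sum>i2<p. b $$ (i1, i2) * S i1 i2 i3 i4)"

definition contract_mats ::
  "tensor4 \<Rightarrow> real mat \<Rightarrow> real mat \<Rightarrow> real mat \<Rightarrow> real mat \<Rightarrow> tensor4" where
  "contract_mats S M1 M2 M3 M4 = (\<lambda>i1 i2 i3 i4.
     \<Sum>k1<dim_col M1. \<Sum>k2<dim_col M2. \<Sum>k3<dim_col M3. \<Sum>k4<dim_col M4.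
       M1 $$ (i1, k1) * M2 $$ (i2, k2) * M3 $$ (i3, k3) * M4 $$ (i4, k4) * S k1 k2 k3 k4)"

definition contract_vecs ::
  "tensor4 \<Rightarrow> real vec \<Rightarrow> real vec \<Rightarrow> real vec \<Rightarrow> real vec \<Rightarrow> real" where
  "contract_vecs S x1 x2 x3 x4 =
     (\<Sum>k1<dim_vec x1. \<Sum>k2<dim_vec x2. \<Sum>k3<dim_vec x3. \<Sum>k4<dim_vec x4.
       x1 $ k1 * x2 $ k2 * x3 $ k3 * x4 $ k4 * S k1 k2 k3 k4)"

definition normalize_vec :: "real vec \<Rightarrow> real vec" where
  "normalize_vec x = (1 / vnorm x) \<cdot>\<^sub>v x"

text \<open>One run of steps 2 to 4 on a tensor \<open>S\<close> of size \<open>p \<times> p \<times> q \<times> q\<close> with the random matrices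
  \<open>a\<close>, \<open>b\<close>. The maps \<open>LA\<close>, \<open>LB\<close> send the computed eigenvectors \<open>ubs\<close>, \<open>vbs\<close> to the output vectors
  \<open>us\<close>, \<open>vs\<close>; \<open>lh\<close>, \<open>mh\<close> are the output coefficients.\<close>

definition slice_core ::
  "nat \<Rightarrow> nat \<Rightarrow> tensor4 \<Rightarrow> (real vec \<Rightarrow> real vec) \<Rightarrow> (real vec \<Rightarrow> real vec) \<Rightarrow> real mat \<Rightarrow> real mat \<Rightarrow>
   real vec list \<Rightarrow> real vec list \<Rightarrow> real vec list \<Rightarrow> real vec list \<Rightarrow> real vec \<Rightarrow> real vec \<Rightarrow> bool"
  where
  "slice_core p q S LA LB a b ubs vbs us vs lh mh \<longleftrightarrow>
     nonzero_eigenvectors (slice_A p q a S) ubs \<and>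
     nonzero_eigenvectors (slice_B p q b S) vbs \<and>
     us = map LA ubs \<and> vs = map LB vbs \<and>
     (let R = mat (length us) (length vs) (\<lambda>(i, j).
            contract_vecs S (ubs ! i) (ubs ! i) (vbs ! j) (vbs ! j) / (us ! i \<bullet> vs ! j))
      in \<exists>s x y. top_singular_triple R s x y \<and> lh = s \<cdot>\<^sub>v x \<and> mh = y)"

text \<open>The postconditions below are applied to the output vectors and coefficients and, last, to the
  norms by which step 3 divides (all 1 without whitening).\<close>

type_synonym postcondition =
  "real vec list \<Rightarrow> real vec list \<Rightarrow> real vec \<Rightarrow> real vec \<Rightarrow> (nat \<Rightarrow> real) \<Rightarrow> (nat \<Rightarrow> real) \<Rightarrow> bool"

text \<open>Total correctness for generic choices of the random matrices: there is an output, and the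
  postcondition holds for every output, however the eigenvectors, eigendecompositions and singular
  vectors are chosen. Runs that exit with failure (no positive semidefinite combinations found) are
  not constrained; only the last \<open>\<rho>\<close>, \<open>\<tau>\<close> drawn in the loop matter.\<close>

definition slice_plain :: "nat \<Rightarrow> tensor4 \<Rightarrow> postcondition \<Rightarrow> bool" where
  "slice_plain n T Post \<longleftrightarrow>
     generically (mat_pair_coords n n) (mat_pairs n n) (\<lambda>(\<alpha>, \<beta>).
       (\<exists>ubs vbs us vs lh mh. slice_core n n T id id \<alpha> \<beta> ubs vbs us vs lh mh) \<and>
       (\<forall>ubs vbs us vs lh mh. slice_core n n T id id \<alpha> \<beta> ubs vbs us vs lh mh \<longrightarrow>
          Post us vs lh mh (\<lambda>_. 1) (\<lambda>_. 1)))"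

definition slice_whitened :: "nat \<Rightarrow> tensor4 \<Rightarrow> postcondition \<Rightarrow> bool" where
  "slice_whitened n T Post \<longleftrightarrow>
     generically (mat_pair_coords n n) (mat_pairs n n) (\<lambda>(\<rho>, \<tau>).
       let CA = slice_A n n \<rho> T; CB = slice_B n n \<tau> T in
       psd CA \<and> psd CB \<longrightarrow>
       (\<exists>WA. whitens WA CA) \<and> (\<exists>WB. whitens WB CB) \<and>
       (\<forall>WA WB. whitens WA CA \<and> whitens WB CB \<longrightarrow>
         (let p = dim_row WA; q = dim_row WB; T' = contract_mats T WA WA WB WB;
              LA = (\<lambda>x. normalize_vec (pinv WA *\<^sub>v x));
              LB = (\<lambda>x. normalize_vec (pinv WB *\<^sub>v x))
          in generically (mat_pair_coords q p) (mat_pairs q p) (\<lambda>(\<alpha>, \<beta>).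
            (\<exists>ubs vbs us vs lh mh. slice_core p q T' LA LB \<alpha> \<beta> ubs vbs us vs lh mh) \<and>
            (\<forall>ubs vbs us vs lh mh. slice_core p q T' LA LB \<alpha> \<beta> ubs vbs us vs lh mh \<longrightarrow>
               Post us vs lh mh (\<lambda>i. vnorm (pinv WA *\<^sub>v (ubs ! i)))
                                (\<lambda>j. vnorm (pinv WB *\<^sub>v (vbs ! j))))))))"


section \<open>Recovery\<close>

text \<open>The output vectors have norm one, and \<open>l u \<otimes> u \<otimes> u\<close> does not change if \<open>u\<close> is normalized and
  \<open>l\<close> is multiplied by the cube of the norm of \<open>u\<close>; for unit vectors both norms disappear. Step 4
  divides by \<open>\<langle>u\<^sub>i, v\<^sub>j\<rangle>\<close> but evaluates the whitened tensor, in which each coefficient carries an extra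
  factor \<open>1 / w\<^sup>2\<close>, where \<open>w\<close> is the norm by which step 3 divides; \<open>w\<close> is 1 without whitening.\<close>

definition recovers_carriage ::
  "real vec \<Rightarrow> real mat \<Rightarrow> real \<Rightarrow> real vec list \<Rightarrow> real vec \<Rightarrow> (nat \<Rightarrow> real) \<Rightarrow> bool" where
  "recovers_carriage l U c us lh w \<longleftrightarrow>
     length us = dim_col U \<and> dim_vec lh = dim_col U \<and>
     (\<exists>\<pi> s. \<pi> permutes {..<dim_col U} \<and> (\<forall>i<dim_col U.
        s i \<in> {1, -1} \<and>
        us ! \<pi> i = s i \<cdot>\<^sub>v normalize_vec (col U i) \<and>
        (w (\<pi> i))\<^sup>2 * lh $ \<pi> i = c * s i * (vnorm (col U i) ^ 3 * l $ i)))"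

text \<open>The tensor is unchanged if \<open>l\<close> is multiplied by \<open>c\<close> and \<open>m\<close> is divided by \<open>c\<close>. The algorithm
  resolves this by returning a unit vector \<open>mh\<close>, which fixes \<open>c\<close> up to sign.\<close>

definition recovers :: "real vec \<Rightarrow> real vec \<Rightarrow> real mat \<Rightarrow> real mat \<Rightarrow> postcondition" where
  "recovers l m U V us vs lh mh wA wB \<longleftrightarrow> vnorm mh = 1 \<and>
     (\<exists>c. c \<noteq> 0 \<and> recovers_carriage l U c us lh wA \<and> recovers_carriage m V (1 / c) vs mh wB)"

end

theory Submission
  imports Defs "Jordan_Normal_Form.Schur_Decomposition"
begin

text \<open>A slice of the train tensor is \<open>\<Sum>\<^sub>i d\<^sub>i u\<^sub>i u\<^sub>i\<^sup>T\<close>, where the weights \<open>d\<^sub>i\<close> are linear in the random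
  matrix. If the \<open>u\<^sub>i\<close> are orthonormal and the weights are nonzero and distinct, then the unit
  eigenvectors with nonzero eigenvalue are the \<open>u\<^sub>i\<close> up to order and sign, and the matrix \<open>R\<close> of step 4
  is the outer product of the signed coefficient vectors, so its top singular vectors return these
  vectors up to a common factor. Whitening with a positive semidefinite slice replaces \<open>u\<^sub>i\<close> by the
  orthonormal vectors \<open>\<surd>d\<^sub>i W u\<^sub>i\<close> and divides the coefficient of the pair \<open>(i, j)\<close> by \<open>d\<^sub>i e\<^sub>j\<close>; the
  weights stay generically distinct as soon as no two rows or columns of the matrix of inner products
  \<open>\<langle>u\<^sub>i, v\<^sub>j\<rangle>\<close> are parallel.\<close>

section \<open>Genericity\<close>

text \<open>The hypothesis that couples \<open>rA = 1\<close> with \<open>rB = 1\<close> comes from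
  whitening. The weight \<open>d i\<close> is a linear function of row i of the coefficient matrix,
  so parallel rows become equal once each is divided by its own weight, and the whitened slice then
  has a repeated nonzero eigenvalue for every choice of the random matrix. If one rank is 1 and the
  other is larger, this always happens, since rows with a single nonzero entry are parallel. If both
  ranks are 1, there is nothing to separate; if both are at least 2, the 2 by 2 minors of the inner
  products are generically nonzero. Without whitening, generic coefficients separate even rows with
  a single entry, so the orthogonal case carries no such restriction. The other obstacle is density.
  The orthonormal variety may be disconnected and the vectors cannot move on it along lines, so one
  good train proves nothing about the others: every condition has to be reached from every train by
  a small motion. For this reason the conditions are treated one polynomial at a time and are
  intersected at the end.\<close>

lemma poly_funs_sum:
  "finite I \<Longrightarrow> (\<And>i. i \<in> I \<Longrightarrow> f i \<in> poly_funs C) \<Longrightarrow> (\<lambda>x. \<Sum>i\<in>I. f i x) \<in> poly_funs C"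
  by (induction I rule: finite_induct) (auto intro: poly_funs.intros)

lemma poly_funs_prod:
  "finite I \<Longrightarrow> (\<And>i. i \<in> I \<Longrightarrow> f i \<in> poly_funs C) \<Longrightarrow> (\<lambda>x. \<Prod>i\<in>I. f i x) \<in> poly_funs C"
  by (induction I rule: finite_induct) (auto intro: poly_funs.intros)

lemma poly_funs_diff:
  assumes "p \<in> poly_funs C" "q \<in> poly_funs C"
  shows "(\<lambda>x. p x - q x) \<in> poly_funs C"
  using poly_funs.add[OF assms(1) poly_funs.mult[OF poly_funs.const[of "-1"] assms(2)]] by simp

lemma topspace_zariski: "topspace (zariski C X) = X"
proof -
  have "{x \<in> X. (1::real) \<noteq> 0} \<in> {{x \<in> X. p x \<noteq> 0} | p. p \<in> poly_funs C}"
    using poly_funs.const[of 1 C] by (auto intro!: exI[of _ "\<lambda>_. 1"])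
  then show ?thesis
    unfolding zariski_def topology_generated_by_topspace by auto
qed

lemma openin_zariski_basic: "p \<in> poly_funs C \<Longrightarrow> openin (zariski C X) {x \<in> X. p x \<noteq> 0}"
  unfolding zariski_def by (rule topology_generated_by_Basis) auto

text \<open>The generating sets are a basis and not merely a subbasis, because the intersection of
  two of them is cut out by the product of the two polynomials.\<close>

lemma openin_zariski_basis:
  assumes "openin (zariski C X) T" "x \<in> T"
  obtains q where "q \<in> poly_funs C" "q x \<noteq> 0" "{y \<in> X. q y \<noteq> 0} \<subseteq> T"
proof -
  have "generate_topology_on {{x \<in> X. p x \<noteq> 0} | p. p \<in> poly_funs C} T"
    using assms(1) unfolding zariski_def by (simp add: openin_topology_generated_by_iff)
  then have "\<forall>x\<in>T. \<exists>q\<in>poly_funs C. q x \<noteq> 0 \<and> {y \<in> X. q y \<noteq> 0} \<subseteq> T"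
  proof induction
    case (Int a b)
    show ?case
    proof
      fix x assume "x \<in> a \<inter> b"
      then have "x \<in> a" "x \<in> b" by auto
      then obtain q r where "q \<in> poly_funs C" "q x \<noteq> 0" "{y \<in> X. q y \<noteq> 0} \<subseteq> a"
        "r \<in> poly_funs C" "r x \<noteq> 0" "{y \<in> X. r y \<noteq> 0} \<subseteq> b"
        using Int.IH by meson
      then show "\<exists>q\<in>poly_funs C. q x \<noteq> 0 \<and> {y \<in> X. q y \<noteq> 0} \<subseteq> a \<inter> b"
        by (intro bexI[of _ "\<lambda>x. q x * r x"]) (auto intro: poly_funs.intros)
    qed
  next
    case (UN K)
    show ?case
    proof
      fix x assume "x \<in> \<Union>K"
      then obtain k where "k \<in> K" "x \<in> k" by blast
      then obtain q where "q \<in> poly_funs C" "q x \<noteq> 0" "{y \<in> X. q y \<noteq> 0} \<subseteq> k"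
        using UN.IH by blast
      then show "\<exists>q\<in>poly_funs C. q x \<noteq> 0 \<and> {y \<in> X. q y \<noteq> 0} \<subseteq> \<Union>K"
        using \<open>k \<in> K\<close> by blast
    qed
  qed auto
  then show thesis using assms(2) that by blast
qed

lemma closure_of_meets_open:
  assumes "T closure_of G = X" "x \<in> X" "openin T U" "x \<in> U"
  obtains y where "y \<in> G" "y \<in> U"
  using assms(2-4) unfolding assms(1)[symmetric] in_closure_of by blast

lemma generically_mono:
  assumes "generically C X P" "\<And>x. x \<in> X \<Longrightarrow> P x \<Longrightarrow> Q x"
  shows "generically C X Q"
proof -
  obtain G where "openin (zariski C X) G" "zariski C X closure_of G = X" "\<forall>x\<in>G. P x"
    using assms(1) unfolding generically_def by blast
  moreover have "G \<subseteq> X"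
    using openin_subset[OF \<open>openin (zariski C X) G\<close>] by (simp add: topspace_zariski)
  ultimately show ?thesis using assms(2) unfolding generically_def by (intro exI[of _ G]) auto
qed

lemma generically_True: "generically C X (\<lambda>_. True)"
  unfolding generically_def using openin_topspace[of "zariski C X"] closure_of_topspace[of "zariski C X"]
  by (intro exI[of _ X]) (simp add: topspace_zariski)

text \<open>Dense sets can be disjoint; openness is what helps here. An open set \<open>T\<close>
  around a point meets the dense set \<open>G\<close>, and \<open>T \<inter> G\<close> is again open
  and nonempty, so it meets \<open>H\<close>.\<close>

lemma generically_conj:
  assumes "generically C X P" "generically C X Q"
  shows "generically C X (\<lambda>x. P x \<and> Q x)"
proof -
  obtain G where G: "openin (zariski C X) G" "zariski C X closure_of G = X" "\<forall>x\<in>G. P x"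
    using assms(1) unfolding generically_def by blast
  obtain H where H: "openin (zariski C X) H" "zariski C X closure_of H = X" "\<forall>x\<in>H. Q x"
    using assms(2) unfolding generically_def by blast
  have "x \<in> zariski C X closure_of (G \<inter> H)" if "x \<in> X" for x
    unfolding in_closure_of topspace_zariski
  proof (intro conjI allI impI that)
    fix T assume T: "x \<in> T \<and> openin (zariski C X) T"
    then obtain y where y: "y \<in> G" "y \<in> T"
      using closure_of_meets_open[OF G(2) \<open>x \<in> X\<close>] by blast
    then have "y \<in> X" using T openin_subset[of "zariski C X" T] by (auto simp: topspace_zariski)
    then obtain z where "z \<in> H" "z \<in> T \<inter> G"
      using closure_of_meets_open[OF H(2) \<open>y \<in> X\<close>, of "T \<inter> G"] y T openin_Int[OF _ G(1)] by blast
    then show "\<exists>y. y \<in> G \<inter> H \<and> y \<in> T" by blast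
  qed
  then have "zariski C X closure_of (G \<inter> H) = X"
    using closure_of_subset_topspace[of "zariski C X" "G \<inter> H"] by (auto simp: topspace_zariski)
  then show ?thesis
    unfolding generically_def using G H openin_Int by (intro exI[of _ "G \<inter> H"]) auto
qed

lemma generically_ball:
  assumes "finite I" "\<And>i. i \<in> I \<Longrightarrow> generically C X (P i)"
  shows "generically C X (\<lambda>x. \<forall>i\<in>I. P i x)"
  using assms
proof (induction I rule: finite_induct)
  case empty
  then show ?case by (simp add: generically_True)
next
  case (insert i I)
  then show ?case
    using generically_conj[of C X "P i" "\<lambda>x. \<forall>i\<in>I. P i x"] by auto
qed

section \<open>Nonvanishing of polynomials along curves and lines\<close>

lemma poly_funs_tendsto:
  assumes "p \<in> poly_funs C" "\<And>c. c \<in> C \<Longrightarrow> ((\<lambda>t. c (\<gamma> t)) \<longlongrightarrow> c x) F"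
  shows "((\<lambda>t. p (\<gamma> t)) \<longlongrightarrow> p x) F"
  using assms by (induction rule: poly_funs.induct) (auto intro: tendsto_intros)

text \<open>Density in the Zariski topology is tested with curves that need not be algebraic: the
  polynomials that define the open sets are continuous along them.\<close>

lemma generically_nonzero_if_curves:
  assumes p: "p \<in> poly_funs C" and D: "generically C X D"
    and curve: "\<And>x. x \<in> X \<Longrightarrow> D x \<Longrightarrow> \<exists>\<gamma>. (\<forall>\<^sub>F t in at_right (0::real). \<gamma> t \<in> X \<and> p (\<gamma> t) \<noteq> 0) \<and>
      (\<forall>c\<in>C. ((\<lambda>t. c (\<gamma> t)) \<longlongrightarrow> c x) (at_right 0))"
  shows "generically C X (\<lambda>x. p x \<noteq> 0)"
proof -
  obtain G where G: "openin (zariski C X) G" "zariski C X closure_of G = X" "\<forall>x\<in>G. D x"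
    using D unfolding generically_def by blast
  have "x \<in> zariski C X closure_of {x \<in> X. p x \<noteq> 0}" if "x \<in> X" for x
    unfolding in_closure_of topspace_zariski
  proof (intro conjI allI impI that)
    fix T assume T: "x \<in> T \<and> openin (zariski C X) T"
    \<comment> \<open>The curve starts at a point \<open>y\<close> of \<open>T\<close> where
      \<open>D\<close> holds and not at \<open>x\<close>, about which only membership in
      \<open>X\<close> is known.\<close>
    then obtain y where y: "y \<in> G" "y \<in> T"
      using closure_of_meets_open[OF G(2) \<open>x \<in> X\<close>] by blast
    then have "y \<in> X" "D y"
      using T G(3) openin_subset[of "zariski C X" T] by (auto simp: topspace_zariski)
    obtain q where q: "q \<in> poly_funs C" "q y \<noteq> 0" "{z \<in> X. q z \<noteq> 0} \<subseteq> T"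
      using openin_zariski_basis[of C X T y] T y by blast
    obtain \<gamma> where \<gamma>: "\<forall>\<^sub>F t in at_right (0::real). \<gamma> t \<in> X \<and> p (\<gamma> t) \<noteq> 0"
      "\<forall>c\<in>C. ((\<lambda>t. c (\<gamma> t)) \<longlongrightarrow> c y) (at_right 0)"
      using curve[OF \<open>y \<in> X\<close> \<open>D y\<close>] by blast
    have "((\<lambda>t. q (\<gamma> t)) \<longlongrightarrow> q y) (at_right 0)"
      using q(1) \<gamma>(2) by (intro poly_funs_tendsto[OF q(1)]) auto
    then have "\<forall>\<^sub>F t in at_right 0. q (\<gamma> t) \<noteq> 0"
      using q(2) tendsto_imp_eventually_ne by blast
    then have "\<forall>\<^sub>F t in at_right (0::real). q (\<gamma> t) \<noteq> 0 \<and> \<gamma> t \<in> X \<and> p (\<gamma> t) \<noteq> 0"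
      using \<gamma>(1) eventually_conj by blast
    then obtain t where "q (\<gamma> t) \<noteq> 0 \<and> \<gamma> t \<in> X \<and> p (\<gamma> t) \<noteq> 0"
      using eventually_happens'[OF trivial_limit_at_right_real] by blast
    then show "\<exists>y. y \<in> {x \<in> X. p x \<noteq> 0} \<and> y \<in> T" using q(3) by blast
  qed
  then have "zariski C X closure_of {x \<in> X. p x \<noteq> 0} = X"
    using closure_of_subset_topspace[of "zariski C X" "{x \<in> X. p x \<noteq> 0}"]
    by (auto simp: topspace_zariski)
  then show ?thesis
    unfolding generically_def using openin_zariski_basic[OF p] by (intro exI[of _ "{x \<in> X. p x \<noteq> 0}"]) auto
qed

text \<open>Along a path with affine coordinates every polynomial function becomes a polynomial in
  the single variable t. Its value at t = 1 is nonzero, so it has finitely many roots and none of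
  them in some interval to the right of 0.\<close>

lemma eventually_nonzero_on_line:
  assumes p: "p \<in> poly_funs C" and "p x1 \<noteq> 0"
    and line: "\<And>c t. c \<in> C \<Longrightarrow> c (\<gamma> t) = (1 - t) * c x0 + t * c x1"
  shows "\<forall>\<^sub>F t in at_right (0::real). p (\<gamma> t) \<noteq> 0"
proof -
  \<comment> \<open>\<open>\<gamma> 1\<close> and \<open>x1\<close> share their coordinates but may
    be different objects, so the equality of polynomial values at them goes through the same
    induction.\<close>
  have "(\<exists>P. \<forall>t. q (\<gamma> t) = poly P t) \<and> q (\<gamma> 1) = q x1" if "q \<in> poly_funs C" for q
    using that
  proof induction
    case (const a)
    show ?case by (auto intro!: exI[of _ "[:a:]"])
  next
    case (coord f)
    have "f (\<gamma> t) = poly [:f x0, f x1 - f x0:] t" for t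
      by (simp add: line[OF coord] algebra_simps)
    moreover have "f (\<gamma> 1) = f x1" by (simp add: line[OF coord])
    ultimately show ?case by blast
  next
    case (add p q)
    then obtain P Q where "\<forall>t. p (\<gamma> t) = poly P t" "\<forall>t. q (\<gamma> t) = poly Q t" by blast
    then show ?case using add by (auto intro!: exI[of _ "P + Q"])
  next
    case (mult p q)
    then obtain P Q where "\<forall>t. p (\<gamma> t) = poly P t" "\<forall>t. q (\<gamma> t) = poly Q t" by blast
    then show ?case using mult by (auto intro!: exI[of _ "P * Q"])
  qed
  from this[OF p] obtain P where P: "\<And>t. p (\<gamma> t) = poly P t" and "p (\<gamma> 1) = p x1"
    by blast
  then have "poly P 1 \<noteq> 0" using \<open>p x1 \<noteq> 0\<close> by simp
  then have fin: "finite {t. poly P t = 0}" by (intro poly_roots_finite) auto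
  \<comment> \<open>The point 0 is removed from the set of roots because \<open>p\<close> may vanish
    at the starting point, which is the case of interest.\<close>
  then have "open (- ({t. poly P t = 0} - {0}))"
    by (intro open_Compl finite_imp_closed) auto
  then have "\<forall>\<^sub>F t in at 0. t \<notin> {t. poly P t = 0} - {0}"
    unfolding eventually_at_topological
    by (intro exI[of _ "- ({t. poly P t = 0} - {0})"]) auto
  then have "\<forall>\<^sub>F t in at_right 0. t \<notin> {t. poly P t = 0} - {0}"
    by (rule filter_leD[OF at_le, rotated]) auto
  moreover have "\<forall>\<^sub>F t in at_right (0::real). t > 0" by (simp add: eventually_at_right_less)
  ultimately show ?thesis by eventually_elim (auto simp: P)
qed

lemma tendsto_on_line:
  assumes "\<And>t. c (\<gamma> t) = (1 - t) * c x0 + t * c x1"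
  shows "((\<lambda>t. c (\<gamma> t)) \<longlongrightarrow> c x0) (at_right (0::real))"
proof -
  have "((\<lambda>t. (1 - t) * c x0 + t * c x1) \<longlongrightarrow> (1 - 0) * c x0 + 0 * c x1) (at_right 0)"
    by (intro tendsto_intros)
  then show ?thesis by (simp add: assms)
qed

text \<open>Only the path has to stay in \<open>X\<close>; the end point \<open>x1\<close> enters
  through its coordinates alone and may depend on \<open>x0\<close>. Conditions already known to be
  generic are passed in as \<open>D\<close> and can be used to choose it.\<close>

lemma generically_nonzero_if_lines:
  assumes p: "p \<in> poly_funs C" and D: "generically C X D"
    and line: "\<And>x0. x0 \<in> X \<Longrightarrow> D x0 \<Longrightarrow> \<exists>x1 \<gamma>. p x1 \<noteq> 0 \<and> (\<forall>t. \<gamma> t \<in> X) \<and>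
      (\<forall>c\<in>C. \<forall>t::real. c (\<gamma> t) = (1 - t) * c x0 + t * c x1)"
  shows "generically C X (\<lambda>x. p x \<noteq> 0)"
proof (rule generically_nonzero_if_curves[OF p D])
  fix x assume "x \<in> X" "D x"
  then obtain x1 \<gamma> where "p x1 \<noteq> 0" "\<forall>t. \<gamma> t \<in> X"
      and *: "\<forall>c\<in>C. \<forall>t. c (\<gamma> t) = (1 - t) * c x + t * c x1"
    using line by blast
  moreover have "\<forall>\<^sub>F t in at_right 0. p (\<gamma> t) \<noteq> 0"
    using * \<open>p x1 \<noteq> 0\<close> by (intro eventually_nonzero_on_line[OF p, where ?x0.0 = x and ?x1.0 = x1]) auto
  moreover have "\<forall>c\<in>C. ((\<lambda>t. c (\<gamma> t)) \<longlongrightarrow> c x) (at_right 0)"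
    using * by (intro ballI tendsto_on_line[where ?x1.0 = x1]) auto
  ultimately show "\<exists>\<gamma>. (\<forall>\<^sub>F t in at_right (0::real). \<gamma> t \<in> X \<and> p (\<gamma> t) \<noteq> 0) \<and>
      (\<forall>c\<in>C. ((\<lambda>t. c (\<gamma> t)) \<longlongrightarrow> c x) (at_right 0))"
    by (intro exI[of _ \<gamma>]) auto
qed

section \<open>Generic choices of the random matrices\<close>

lemma poly_funs_mat_pair:
  assumes "i < p" "j < p"
  shows "(\<lambda>(M, N). M $$ (i, j)) \<in> poly_funs (mat_pair_coords p q)"
    and "(\<lambda>(M, N). N $$ (i, j)) \<in> poly_funs (mat_pair_coords q p)"
  unfolding mat_pair_coords_def using assms
  by (intro poly_funs.coord UnI1 UnI2 CollectI exI[of _ i] exI[of _ j]; simp)+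

text \<open>Pairs of matrices form a linear space, so a single point with a nonzero value is joined
  to every other point by a line.\<close>

lemma generically_mat_pairs:
  assumes f: "f \<in> poly_funs (mat_pair_coords p q)"
    and x1: "x1 \<in> mat_pairs p q" "f x1 \<noteq> 0"
  shows "generically (mat_pair_coords p q) (mat_pairs p q) (\<lambda>x. f x \<noteq> 0)"
proof (rule generically_nonzero_if_lines[OF f generically_True])
  fix x0 :: "real mat \<times> real mat"
  define \<gamma> where "\<gamma> = (\<lambda>t. (mat p p (\<lambda>ij. (1 - t) * fst x0 $$ ij + t * fst x1 $$ ij),
                 mat q q (\<lambda>ij. (1 - t) * snd x0 $$ ij + t * snd x1 $$ ij)))"
  have "\<gamma> t \<in> mat_pairs p q" for t
    unfolding mat_pairs_def \<gamma>_def by simp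
  moreover have "c (\<gamma> t) = (1 - t) * c x0 + t * c x1" if "c \<in> mat_pair_coords p q" for c t
    using that unfolding mat_pair_coords_def \<gamma>_def by (auto simp: split_beta)
  ultimately show "\<exists>x1 \<gamma>. f x1 \<noteq> 0 \<and> (\<forall>t. \<gamma> t \<in> mat_pairs p q) \<and>
      (\<forall>c\<in>mat_pair_coords p q. \<forall>t. c (\<gamma> t) = (1 - t) * c x0 + t * c x1)"
    using x1(2) by (intro exI[of _ x1] exI[of _ \<gamma>]) simp
qed

section \<open>Spectral decomposition of real symmetric matrices\<close>

text \<open>Evaluating the form conj(v) C v through the rows and through the columns of
  \<open>C\<close> gives k times the squared norm of \<open>v\<close> and the complex conjugate of
  this number.\<close>

lemma eigenvector_of_symmetric_of_real_mat_real:
  fixes C :: "real mat"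
  assumes C: "C \<in> carrier_mat n n" and sym: "C\<^sup>T = C"
    and ev: "eigenvector (map_mat complex_of_real C) v k"
  shows "k \<in> \<real>"
proof -
  let ?C = "map_mat complex_of_real C"
  have v: "v \<in> carrier_vec n" "v \<noteq> 0\<^sub>v n" and k: "?C *\<^sub>v v = k \<cdot>\<^sub>v v"
    using ev C unfolding eigenvector_def by auto
  have C': "?C \<in> carrier_mat n n" using C by simp
  have symC: "C $$ (i, j) = C $$ (j, i)" if "i < n" "j < n" for i j
    using arg_cong[OF sym, of "\<lambda>M. M $$ (i, j)"] that C by simp
  have Cv: "(?C *\<^sub>v v) $ i = (\<Sum>j<n. of_real (C $$ (i, j)) * v $ j)" if "i < n" for i
    using that C v by (auto simp: scalar_prod_def lessThan_atLeast0 intro!: sum.cong)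
  have kv: "(\<Sum>j<n. of_real (C $$ (i, j)) * v $ j) = k * v $ i" if "i < n" for i
    using Cv[OF that] k that v by simp
  let ?N = "\<Sum>i<n. cnj (v $ i) * v $ i"
  have "k * ?N = (\<Sum>i<n. cnj (v $ i) * (k * v $ i))"
    by (simp add: sum_distrib_left ac_simps)
  also have "\<dots> = (\<Sum>i<n. cnj (v $ i) * (\<Sum>j<n. of_real (C $$ (i, j)) * v $ j))"
    by (simp add: kv)
  also have "\<dots> = (\<Sum>i<n. \<Sum>j<n. cnj (v $ i) * of_real (C $$ (i, j)) * v $ j)"
    by (simp add: sum_distrib_left ac_simps)
  also have "\<dots> = (\<Sum>j<n. \<Sum>i<n. cnj (v $ i) * of_real (C $$ (i, j)) * v $ j)"
    by (rule sum.swap)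
  also have "\<dots> = (\<Sum>j<n. v $ j * cnj (\<Sum>i<n. of_real (C $$ (j, i)) * v $ i))"
    unfolding cnj_sum sum_distrib_left by (intro sum.cong refl) (auto simp: symC)
  also have "\<dots> = (\<Sum>j<n. v $ j * cnj (k * v $ j))"
    by (simp add: kv)
  also have "\<dots> = cnj k * ?N"
    by (simp add: sum_distrib_left ac_simps)
  finally have *: "k * ?N = cnj k * ?N" .
  have "?N \<noteq> 0"
  proof
    assume "?N = 0"
    moreover have "?N = of_real (\<Sum>i<n. (cmod (v $ i))\<^sup>2)"
      by (simp add: complex_norm_square ac_simps del: of_real_power)
    ultimately have "complex_of_real (\<Sum>i<n. (cmod (v $ i))\<^sup>2) = 0" by argo
    then have "(\<Sum>i<n. (cmod (v $ i))\<^sup>2) = 0" by (rule of_real_eq_0_iff[THEN iffD1])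
    then have "\<forall>i<n. v $ i = 0" by (subst (asm) sum_nonneg_eq_0_iff) auto
    then show False using v by (auto intro: eq_vecI)
  qed
  then have "cnj k = k" using * by simp
  then show ?thesis by (simp add: Reals_cnj_iff)
qed

lemma trace_mult_commute:
  fixes A B :: "'a :: comm_semiring_0 mat"
  assumes "A \<in> carrier_mat n m" "B \<in> carrier_mat m n"
  shows "(\<Sum>i<n. (A * B) $$ (i, i)) = (\<Sum>j<m. (B * A) $$ (j, j))"
proof -
  have "(\<Sum>i<n. (A * B) $$ (i, i)) = (\<Sum>i<n. \<Sum>j<m. A $$ (i, j) * B $$ (j, i))"
    using assms by (auto simp: scalar_prod_def lessThan_atLeast0 intro!: sum.cong)
  also have "\<dots> = (\<Sum>j<m. \<Sum>i<n. A $$ (i, j) * B $$ (j, i))" by (rule sum.swap)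
  also have "\<dots> = (\<Sum>j<m. (B * A) $$ (j, j))"
    using assms by (auto simp: scalar_prod_def lessThan_atLeast0 mult.commute intro!: sum.cong)
  finally show ?thesis .
qed

text \<open>If all eigenvalues vanish, then \<open>C\<close> is similar to a strictly triangular matrix, so the trace
  of \<open>C\<^sup>2\<close>, which is the sum of the squares of the entries of \<open>C\<close>, is zero.\<close>

lemma symmetric_mat_nonzero_eigenvalue:
  fixes C :: "real mat"
  assumes C: "C \<in> carrier_mat n n" and sym: "C\<^sup>T = C" and nz: "C \<noteq> 0\<^sub>m n n"
  obtains k x where "k \<noteq> 0" "eigenvector C x k"
proof -
  let ?C = "map_mat complex_of_real C"
  have C': "?C \<in> carrier_mat n n" using C by simp
  obtain as where as: "char_poly ?C = (\<Prod>a\<leftarrow>as. [:- a, 1:])"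
    using char_poly_factorized[OF C'] by auto
  obtain B P Q where schur: "schur_decomposition ?C as = (B, P, Q)" by (cases "schur_decomposition ?C as") auto
  from schur_decomposition[OF C' as schur]
  have wit: "similar_mat_wit ?C B P Q" and ut: "upper_triangular B" and diag: "diag_mat B = as" by auto
  have car: "B \<in> carrier_mat n n" "P \<in> carrier_mat n n" "Q \<in> carrier_mat n n"
    and QP: "Q * P = 1\<^sub>m n" and CPBQ: "?C = P * B * Q"
    using similar_mat_witD2[OF C' wit] by auto
  have symC: "C $$ (i, j) = C $$ (j, i)" if "i < n" "j < n" for i j
    using arg_cong[OF sym, of "\<lambda>M. M $$ (i, j)"] that C by simp
  have "\<exists>a\<in>set as. a \<noteq> 0"
  proof (rule ccontr)
    assume "\<not> ?thesis"
    then have "\<forall>i<n. B $$ (i, i) = 0"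
      using diag car unfolding diag_mat_def by auto
    then have B0: "B $$ (i, j) = 0" if "i < n" "j < n" "j \<le> i" for i j
      using ut that car unfolding upper_triangular_def by (cases "i = j") auto
    have "(\<Sum>i<n. (?C * ?C) $$ (i, i)) = (\<Sum>i<n. (B * B) $$ (i, i))"
    proof -
      have "?C * ?C = P * (B * (Q * P) * B * Q)"
        unfolding CPBQ using car by (simp add: assoc_mult_mat[of _ n n _ n _ n])
      also have "\<dots> = P * (B * B * Q)" using QP car by simp
      finally have "(\<Sum>i<n. (?C * ?C) $$ (i, i)) = (\<Sum>i<n. (P * (B * B * Q)) $$ (i, i))" by simp
      also have "\<dots> = (\<Sum>i<n. (B * B * Q * P) $$ (i, i))"
        using car by (intro trace_mult_commute) auto
      also have "B * B * Q * P = B * B * (Q * P)" using car by (intro assoc_mult_mat) auto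
      finally show ?thesis using QP car by simp
    qed
    also have "\<dots> = (\<Sum>i<n. \<Sum>j<n. B $$ (i, j) * B $$ (j, i))"
      using car by (auto simp: scalar_prod_def lessThan_atLeast0 intro!: sum.cong)
    also have "\<dots> = 0"
    proof (intro sum.neutral ballI)
      fix i j assume "i \<in> {..<n}" "j \<in> {..<n}"
      then show "B $$ (i, j) * B $$ (j, i) = 0" using B0[of i j] B0[of j i] by (cases "j \<le> i") auto
    qed
    finally have "(\<Sum>i<n. (?C * ?C) $$ (i, i)) = 0" .
    moreover have "(\<Sum>i<n. (?C * ?C) $$ (i, i)) = of_real (\<Sum>i<n. \<Sum>j<n. (C $$ (i, j))\<^sup>2)"
      using C by (auto simp: scalar_prod_def lessThan_atLeast0 power2_eq_square symC intro!: sum.cong)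
    ultimately have "complex_of_real (\<Sum>i<n. \<Sum>j<n. (C $$ (i, j))\<^sup>2) = 0" by argo
    then have "(\<Sum>i<n. \<Sum>j<n. (C $$ (i, j))\<^sup>2) = 0" by (rule of_real_eq_0_iff[THEN iffD1])
    then have "\<forall>i<n. (\<Sum>j<n. (C $$ (i, j))\<^sup>2) = 0"
      by (subst (asm) sum_nonneg_eq_0_iff) (auto intro: sum_nonneg)
    then have "\<forall>i<n. \<forall>j<n. C $$ (i, j) = 0" by (simp add: sum_nonneg_eq_0_iff)
    then show False using nz C by (auto intro: eq_matI)
  qed
  then obtain a where a: "a \<in> set as" "a \<noteq> 0" by blast
  then have root: "poly (char_poly ?C) a = 0" unfolding as poly_prod_list by (auto simp: prod_list_zero_iff image_iff)
  then obtain v where "eigenvector ?C v a"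
    using eigenvalue_root_char_poly[OF C'] unfolding eigenvalue_def by blast
  then have "a \<in> \<real>" by (rule eigenvector_of_symmetric_of_real_mat_real[OF C sym])
  then obtain k where k: "a = of_real k" by (rule Reals_cases)
  \<comment> \<open>The eigenvector found so far is complex. A real one is obtained by returning to
    the characteristic polynomial, which has real coefficients and the real root
    \<open>k\<close>.\<close>
  have "poly (map_poly of_real (char_poly C)) (of_real k :: complex) = 0"
    using root of_real_hom.char_poly_hom[OF C, where ?'a = complex] unfolding k by simp
  then have "poly (char_poly C) k = 0" by simp
  then have "eigenvalue C k" using eigenvalue_root_char_poly[OF C] by blast
  then show thesis using that a(2) k unfolding eigenvalue_def by auto
qed

section \<open>Sums of weighted outer products\<close>

lemma scalar_prod_lessThan: "x \<bullet> y = (\<Sum>i<dim_vec y. x $ i * y $ i)"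
  by (simp add: scalar_prod_def lessThan_atLeast0)

lemma vnorm_eq_1_iff: "vnorm x = 1 \<longleftrightarrow> x \<bullet> x = 1"
  by (simp add: vnorm_def)

lemma scalar_prod_self_nonneg: "0 \<le> x \<bullet> (x :: real vec)"
  by (simp add: scalar_prod_lessThan sum_nonneg)

lemma scalar_prod_self_eq_0_iff:
  "x \<in> carrier_vec n \<Longrightarrow> x \<bullet> x = 0 \<longleftrightarrow> x = 0\<^sub>v n" for x :: "real vec"
  by (auto simp: scalar_prod_lessThan sum_nonneg_eq_0_iff intro!: eq_vecI)

lemma vnorm_pos: "x \<in> carrier_vec n \<Longrightarrow> x \<noteq> 0\<^sub>v n \<Longrightarrow> 0 < vnorm x"
  using scalar_prod_self_eq_0_iff[of x n] scalar_prod_self_nonneg[of x] by (simp add: vnorm_def)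

lemma vnorm_smult: "vnorm (k \<cdot>\<^sub>v x) = \<bar>k\<bar> * vnorm x"
  by (simp add: vnorm_def real_sqrt_mult flip: mult.assoc)

lemma orthonormal_cols_iff:
  assumes "U \<in> carrier_mat n r"
  shows "orthonormal_cols U \<longleftrightarrow> (\<forall>i<r. \<forall>j<r. col U i \<bullet> col U j = (if i = j then 1 else 0))"
  using assms unfolding orthonormal_cols_def mat_eq_iff by auto

text \<open>This is \<open>U * mat_diag r c * U\<^sup>T\<close>, written by entries because slices
  of a tensor are compared with it entry by entry; the product form serves where eigendecompositions
  occur.\<close>

definition weighted_outer :: "real mat \<Rightarrow> (nat \<Rightarrow> real) \<Rightarrow> real mat" where
  "weighted_outer U c =
     mat (dim_row U) (dim_row U) (\<lambda>(a, b). \<Sum>i<dim_col U. c i * (U $$ (a, i) * U $$ (b, i)))"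

lemma weighted_outer_carrier [simp]: "U \<in> carrier_mat n r \<Longrightarrow> weighted_outer U c \<in> carrier_mat n n"
  by (simp add: weighted_outer_def)

lemma dim_weighted_outer [simp]:
  "dim_row (weighted_outer U c) = dim_row U" "dim_col (weighted_outer U c) = dim_row U"
  by (simp_all add: weighted_outer_def)

lemma transpose_weighted_outer: "(weighted_outer U c)\<^sup>T = weighted_outer U c"
  by (auto simp: weighted_outer_def mult.commute intro!: eq_matI)

lemma weighted_outer_eq_mult:
  assumes "U \<in> carrier_mat n r"
  shows "weighted_outer U c = U * mat_diag r c * U\<^sup>T"
proof (rule eq_matI)
  fix a b assume "a < dim_row (U * mat_diag r c * U\<^sup>T)" "b < dim_col (U * mat_diag r c * U\<^sup>T)"
  then show "weighted_outer U c $$ (a, b) = (U * mat_diag r c * U\<^sup>T) $$ (a, b)"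
    using assms
    by (auto simp: weighted_outer_def scalar_prod_lessThan mat_diag_mult_right intro!: sum.cong)
qed (use assms in auto)

lemma weighted_outer_mult_vec_nth:
  assumes U: "U \<in> carrier_mat n r" and x: "x \<in> carrier_vec n" and a: "a < n"
  shows "(weighted_outer U c *\<^sub>v x) $ a = (\<Sum>i<r. c i * (col U i \<bullet> x) * U $$ (a, i))"
proof -
  have "(weighted_outer U c *\<^sub>v x) $ a = (\<Sum>b<n. \<Sum>i<r. c i * (U $$ (a, i) * U $$ (b, i)) * x $ b)"
    using assms by (auto simp: weighted_outer_def scalar_prod_lessThan sum_distrib_right intro!: sum.cong)
  also have "\<dots> = (\<Sum>i<r. \<Sum>b<n. c i * (U $$ (a, i) * U $$ (b, i)) * x $ b)" by (rule sum.swap)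
  also have "\<dots> = (\<Sum>i<r. c i * (col U i \<bullet> x) * U $$ (a, i))"
    using assms by (auto simp: scalar_prod_lessThan sum_distrib_left sum_distrib_right ac_simps intro!: sum.cong)
  finally show ?thesis .
qed

lemma scalar_prod_weighted_outer:
  assumes U: "U \<in> carrier_mat n r" and x: "x \<in> carrier_vec n" and y: "y \<in> carrier_vec n"
  shows "y \<bullet> (weighted_outer U c *\<^sub>v x) = (\<Sum>i<r. c i * (col U i \<bullet> x) * (col U i \<bullet> y))"
proof -
  have "y \<bullet> (weighted_outer U c *\<^sub>v x) = (\<Sum>a<n. y $ a * (weighted_outer U c *\<^sub>v x) $ a)"
    using U by (simp add: scalar_prod_lessThan)
  also have "\<dots> = (\<Sum>a<n. \<Sum>i<r. y $ a * (c i * (col U i \<bullet> x) * U $$ (a, i)))"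
    by (simp add: weighted_outer_mult_vec_nth[OF U x] sum_distrib_left)
  also have "\<dots> = (\<Sum>i<r. \<Sum>a<n. y $ a * (c i * (col U i \<bullet> x) * U $$ (a, i)))" by (rule sum.swap)
  also have "\<dots> = (\<Sum>i<r. c i * (col U i \<bullet> x) * (col U i \<bullet> y))"
    using U y by (auto simp: scalar_prod_lessThan[of _ y] sum_distrib_left ac_simps intro!: sum.cong)
  finally show ?thesis .
qed

lemma weighted_outer_mult_col:
  assumes U: "U \<in> carrier_mat n r" and on: "orthonormal_cols U" and i: "i < r"
  shows "weighted_outer U c *\<^sub>v col U i = c i \<cdot>\<^sub>v col U i"
proof (rule eq_vecI)
  fix a assume "a < dim_vec (c i \<cdot>\<^sub>v col U i)"
  then have a: "a < n" using U by simp
  have "(weighted_outer U c *\<^sub>v col U i) $ a = (\<Sum>k<r. c k * (col U k \<bullet> col U i) * U $$ (a, k))"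
    using U i a by (intro weighted_outer_mult_vec_nth) auto
  also have "\<dots> = (\<Sum>k<r. if k = i then c i * U $$ (a, i) else 0)"
    using on i unfolding orthonormal_cols_iff[OF U] by (intro sum.cong) auto
  also have "\<dots> = c i * U $$ (a, i)" using i by simp
  finally show "(weighted_outer U c *\<^sub>v col U i) $ a = (c i \<cdot>\<^sub>v col U i) $ a"
    using U i a by simp
qed (use U in auto)

text \<open>The diagonal entries of the projection \<open>X X\<^sup>T\<close> are at most 1 and sum up to the rank.\<close>

lemma orthonormal_cols_le:
  assumes X: "X \<in> carrier_mat n m" and on: "orthonormal_cols X"
  shows "m \<le> n"
proof -
  have XX: "X\<^sup>T * X = 1\<^sub>m m" using on X unfolding orthonormal_cols_def by simp
  define P where "P = X * X\<^sup>T"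
  have P: "P \<in> carrier_mat n n" using X unfolding P_def by simp
  have "P * P = X * (X\<^sup>T * X) * X\<^sup>T" unfolding P_def
    using X by (simp add: assoc_mult_mat[of _ n m _ n _ m] assoc_mult_mat[of _ n m _ n _ n]
      assoc_mult_mat[of _ m n _ m _ n] assoc_mult_mat[of _ n m _ m _ n])
  then have PP: "P * P = P" unfolding XX using X by (simp add: P_def)
  have sym: "P $$ (i, j) = P $$ (j, i)" if "i < n" "j < n" for i j
    using X that unfolding P_def by (auto intro!: comm_scalar_prod[of _ m])
  \<comment> \<open>A diagonal entry of a symmetric idempotent matrix is a sum of squares, one of
    which is its own square.\<close>
  have le: "P $$ (i, i) \<le> 1" if "i < n" for i
  proof -
    have "P $$ (i, i) = (\<Sum>j<n. P $$ (i, j) * P $$ (j, i))"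
      using that P arg_cong[OF PP, of "\<lambda>M. M $$ (i, i)"] by (simp add: scalar_prod_lessThan)
    also have "\<dots> = (\<Sum>j<n. (P $$ (i, j))\<^sup>2)"
      using sym that by (auto simp: power2_eq_square intro!: sum.cong)
    also have "\<dots> \<ge> (P $$ (i, i))\<^sup>2"
      using that by (intro member_le_sum) auto
    finally have "P $$ (i, i) * P $$ (i, i) \<le> P $$ (i, i) * 1" by (simp add: power2_eq_square)
    then show ?thesis by (cases "P $$ (i, i) \<le> 0") (auto simp: mult_le_cancel_left)
  qed
  have "real m = (\<Sum>j<m. (X\<^sup>T * X) $$ (j, j))" unfolding XX by simp
  also have "\<dots> = (\<Sum>i<n. P $$ (i, i))" unfolding P_def using X by (intro trace_mult_commute) auto
  also have "\<dots> \<le> (\<Sum>i<n. 1)" using le by (intro sum_mono) auto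
  finally show ?thesis by simp
qed

text \<open>Deflation: a maximal orthonormal family of eigenvectors with nonzero eigenvalues exhausts \<open>C\<close>,
  since an eigenvector of the remainder would extend it.\<close>

lemma ex_skinny_eigendecomposition:
  fixes C :: "real mat"
  assumes C: "C \<in> carrier_mat n n" and sym: "C\<^sup>T = C"
  shows "\<exists>X D. skinny_eigendecomposition C X D"
proof -
  define E where "E = (\<lambda>m. \<exists>X d. X \<in> carrier_mat n m \<and> orthonormal_cols X \<and>
      (\<forall>i<m. d i \<noteq> 0 \<and> C *\<^sub>v col X i = d i \<cdot>\<^sub>v col X i))"
  have "E 0"
    unfolding E_def by (intro exI[of _ "0\<^sub>m n 0"]) (auto simp: orthonormal_cols_def intro!: eq_matI)
  moreover have bound: "m \<le> n" if "E m" for m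
    using that orthonormal_cols_le unfolding E_def by blast
  ultimately obtain m where "E m" and max: "\<And>k. E k \<Longrightarrow> k \<le> m"
    using GreatestI_nat[of E 0 n] Greatest_le_nat[of E _ n] by blast
  then obtain X d where X: "X \<in> carrier_mat n m" and on: "orthonormal_cols X"
    and d: "\<And>i. i < m \<Longrightarrow> d i \<noteq> 0" and CX: "\<And>i. i < m \<Longrightarrow> C *\<^sub>v col X i = d i \<cdot>\<^sub>v col X i"
    unfolding E_def by blast
  define W where "W = weighted_outer X d"
  define R where "R = C - W"
  have W: "W \<in> carrier_mat n n" and WT: "W\<^sup>T = W" using X by (auto simp: W_def transpose_weighted_outer)
  have R: "R \<in> carrier_mat n n" using W unfolding R_def by (rule minus_carrier_mat)
  have RT: "R\<^sup>T = R" unfolding R_def using C W sym WT by (simp add: transpose_minus[of C n n W])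
  have "R = 0\<^sub>m n n"
  proof (rule ccontr)
    assume "R \<noteq> 0\<^sub>m n n"
    then obtain k x where k: "k \<noteq> 0" and ev: "eigenvector R x k"
      using symmetric_mat_nonzero_eigenvalue[OF R RT] by blast
    then have x: "x \<in> carrier_vec n" "x \<noteq> 0\<^sub>v n" and Rx: "R *\<^sub>v x = k \<cdot>\<^sub>v x"
      using R unfolding eigenvector_def by auto
    \<comment> \<open>\<open>R\<close> annihilates the columns of \<open>X\<close>. By symmetry, an
      eigenvector of \<open>R\<close> with nonzero eigenvalue is orthogonal to all of them.\<close>
    have ux: "col X i \<bullet> x = 0" if i: "i < m" for i
    proof -
      have u: "col X i \<in> carrier_vec n" using X i by simp
      have "R *\<^sub>v col X i = C *\<^sub>v col X i - W *\<^sub>v col X i"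
        unfolding R_def using C W u by (rule minus_mult_distrib_mat_vec)
      also have "\<dots> = 0\<^sub>v n"
        using CX[OF i] weighted_outer_mult_col[OF X on i, of d] u by (simp add: W_def)
      finally have "(R *\<^sub>v col X i) \<bullet> x = 0" using x by simp
      moreover have "(R *\<^sub>v col X i) \<bullet> x = col X i \<bullet> (R *\<^sub>v x)"
        using transpose_vec_mult_scalar[OF R x(1) u] RT by simp
      ultimately show ?thesis using Rx u x k by simp
    qed
    define y where "y = (1 / vnorm x) \<cdot>\<^sub>v x"
    have y: "y \<in> carrier_vec n" using x by (simp add: y_def)
    have yy: "y \<bullet> y = 1"
      using vnorm_pos[OF x] x(1) unfolding y_def vnorm_eq_1_iff[symmetric] vnorm_smult by simp
    have uy: "col X i \<bullet> y = 0" if "i < m" for i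
      using ux[OF that] that x X by (simp add: y_def)
    \<comment> \<open>Orthogonality to the columns makes \<open>W\<close> vanish on
      \<open>x\<close>, so \<open>x\<close> is an eigenvector of \<open>C\<close> itself, with the
      same eigenvalue.\<close>
    have "W *\<^sub>v x = 0\<^sub>v n"
    proof (rule eq_vecI)
      fix a assume "a < dim_vec (0\<^sub>v n :: real vec)"
      then show "(W *\<^sub>v x) $ a = 0\<^sub>v n $ a"
        unfolding W_def using weighted_outer_mult_vec_nth[OF X x(1), of a d] ux by simp
    qed (use W in simp)
    moreover have "R *\<^sub>v x = C *\<^sub>v x - W *\<^sub>v x"
      unfolding R_def using C W x(1) by (rule minus_mult_distrib_mat_vec)
    ultimately have "C *\<^sub>v x = k \<cdot>\<^sub>v x" using Rx C x by simp
    then have Cy: "C *\<^sub>v y = k \<cdot>\<^sub>v y"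
      unfolding y_def using C x by (simp add: mult_mat_vec smult_smult_assoc mult.commute)
    define X' where "X' = mat n (Suc m) (\<lambda>(a, i). if i < m then X $$ (a, i) else y $ a)"
    have X': "X' \<in> carrier_mat n (Suc m)" by (simp add: X'_def)
    have col: "col X' i = (if i < m then col X i else y)" if "i < Suc m" for i
      using that X y by (auto simp: X'_def intro!: eq_vecI)
    have "orthonormal_cols X'"
      unfolding orthonormal_cols_iff[OF X']
    proof (intro allI impI)
      fix i j assume "i < Suc m" "j < Suc m"
      moreover have "y \<bullet> col X i = 0" if "i < m" for i
        using uy[OF that] comm_scalar_prod[of y n "col X i"] y X that by simp
      ultimately show "col X' i \<bullet> col X' j = (if i = j then 1 else 0)"
        using on[unfolded orthonormal_cols_iff[OF X]] uy yy by (auto simp: col less_Suc_eq)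
    qed
    then have "E (Suc m)"
      unfolding E_def using X' col d CX Cy k
      by (intro exI[of _ X'] exI[of _ "\<lambda>i. if i < m then d i else k"]) auto
    then show False using max by fastforce
  qed
  then have "C = W"
    using C W unfolding R_def mat_eq_iff by auto
  then have CXD: "C = X * mat_diag m d * X\<^sup>T" unfolding W_def weighted_outer_eq_mult[OF X] .
  have dims: "dim_col X = m" "dim_row C = n" using X C by auto
  have "diagonal_mat (mat_diag m d)" by (simp add: diagonal_mat_def mat_diag_def)
  moreover have "\<forall>i<m. mat_diag m d $$ (i, i) \<noteq> 0" using d by (simp add: mat_diag_def)
  moreover have "mat_diag m d \<in> carrier_mat m m" by simp
  ultimately have "skinny_eigendecomposition C X (mat_diag m d)"
    unfolding skinny_eigendecomposition_def dims using X on CXD by (intro conjI)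
  then show ?thesis by blast
qed

section \<open>Eigenvectors with nonzero eigenvalue\<close>

text \<open>Pairing the eigenvector equation with column i shows that \<open>c i = k\<close> or that
  \<open>x\<close> is orthogonal to this column. Since \<open>k\<close> is nonzero, \<open>x\<close>
  lies in the span of the columns, and distinct weights leave room for one column only.\<close>

lemma unit_eigenvector_weighted_outer:
  assumes U: "U \<in> carrier_mat n r" and on: "orthonormal_cols U" and inj: "inj_on c {..<r}"
    and x1: "vnorm x = 1" and k: "k \<noteq> 0" and ev: "eigenvector (weighted_outer U c) x k"
  obtains i where "i < r" "x = col U i \<or> x = - col U i"
proof -
  have x: "x \<in> carrier_vec n" and Wx: "weighted_outer U c *\<^sub>v x = k \<cdot>\<^sub>v x"
    using ev U unfolding eigenvector_def by auto
  have xa: "k * x $ a = (\<Sum>i<r. c i * (col U i \<bullet> x) * U $$ (a, i))" if "a < n" for a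
    using weighted_outer_mult_vec_nth[OF U x that, of c] Wx x that by simp
  have coeff: "c i * (col U i \<bullet> x) = k * (col U i \<bullet> x)" if i: "i < r" for i
  proof -
    have u: "col U i \<in> carrier_vec n" using U i by simp
    have "k * (col U i \<bullet> x) = col U i \<bullet> (weighted_outer U c *\<^sub>v x)"
      using Wx x u by simp
    also have "\<dots> = (\<Sum>l<r. c l * (col U l \<bullet> x) * (col U l \<bullet> col U i))"
      by (rule scalar_prod_weighted_outer[OF U x u])
    also have "\<dots> = (\<Sum>l<r. if l = i then c i * (col U i \<bullet> x) else 0)"
      using on i unfolding orthonormal_cols_iff[OF U] by (intro sum.cong) auto
    finally show ?thesis using i by simp argo
  qed
  have "\<exists>i<r. col U i \<bullet> x \<noteq> 0"
  proof (rule ccontr)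
    assume "\<not> ?thesis"
    then have "x = 0\<^sub>v n" using xa k x by (intro eq_vecI) auto
    then show False using x1 by (simp add: vnorm_def)
  qed
  then obtain i where i: "i < r" and ux: "col U i \<bullet> x \<noteq> 0" by blast
  then have ci: "c i = k" using coeff[OF i] by simp
  have other: "col U l \<bullet> x = 0" if "l < r" "l \<noteq> i" for l
  proof (rule ccontr)
    assume "col U l \<bullet> x \<noteq> 0"
    then have "c l = c i" using coeff[OF that(1)] ci by simp
    then show False using inj that i by (auto dest: inj_onD)
  qed
  have "x = (col U i \<bullet> x) \<cdot>\<^sub>v col U i"
  proof (rule eq_vecI)
    fix a assume "a < dim_vec ((col U i \<bullet> x) \<cdot>\<^sub>v col U i)"
    then have a: "a < n" using U by simp
    have "k * x $ a = (\<Sum>l<r. if l = i then k * (col U i \<bullet> x) * U $$ (a, i) else 0)"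
      unfolding xa[OF a] using other ci by (intro sum.cong) auto
    also have "\<dots> = k * ((col U i \<bullet> x) * U $$ (a, i))" using i by simp
    finally show "x $ a = ((col U i \<bullet> x) \<cdot>\<^sub>v col U i) $ a" using k a U i by simp
  qed (use U x in auto)
  moreover have "vnorm (col U i) = 1"
    using on i unfolding orthonormal_cols_iff[OF U] vnorm_eq_1_iff by simp
  ultimately have "\<bar>col U i \<bullet> x\<bar> = 1"
    using x1 vnorm_smult[of "col U i \<bullet> x" "col U i"] by simp
  then have "col U i \<bullet> x = 1 \<or> col U i \<bullet> x = - 1" by linarith
  then have "x = col U i \<or> x = - col U i"
  proof
    assume "col U i \<bullet> x = 1"
    then show ?thesis using \<open>x = (col U i \<bullet> x) \<cdot>\<^sub>v col U i\<close> by simp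
  next
    assume "col U i \<bullet> x = - 1"
    then have "x = (- 1) \<cdot>\<^sub>v col U i" using \<open>x = (col U i \<bullet> x) \<cdot>\<^sub>v col U i\<close> by simp
    also have "\<dots> = - col U i" by (auto intro!: eq_vecI)
    finally show ?thesis by simp
  qed
  then show thesis by (rule that[OF i])
qed

lemma eigenvector_weighted_outer_col:
  assumes U: "U \<in> carrier_mat n r" and on: "orthonormal_cols U" and i: "i < r"
  shows "vnorm (col U i) = 1" "eigenvector (weighted_outer U c) (col U i) (c i)"
proof -
  have u1: "col U i \<bullet> col U i = 1" using on i unfolding orthonormal_cols_iff[OF U] by simp
  then show "vnorm (col U i) = 1" by (simp add: vnorm_eq_1_iff)
  have "col U i \<noteq> 0\<^sub>v n" using u1 U i by auto
  then show "eigenvector (weighted_outer U c) (col U i) (c i)"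
    unfolding eigenvector_def using weighted_outer_mult_col[OF U on i] U i by simp
qed

lemma orthonormal_cols_distinct_up_to_sign:
  assumes U: "U \<in> carrier_mat n r" and on: "orthonormal_cols U" and ij: "i < r" "j < r" "i \<noteq> j"
  shows "col U i \<noteq> col U j" "col U i \<noteq> - col U j"
proof -
  have "col U i \<bullet> col U i = 1" "col U i \<bullet> col U j = 0" "col U i \<in> carrier_vec n" "col U j \<in> carrier_vec n"
    using on ij U unfolding orthonormal_cols_iff[OF U] by auto
  then show "col U i \<noteq> col U j" "col U i \<noteq> - col U j"
    by (auto simp: scalar_prod_uminus_right)
qed

lemma nonzero_eigenvectors_weighted_outer_cols:
  assumes U: "U \<in> carrier_mat n r" and on: "orthonormal_cols U" and inj: "inj_on c {..<r}"
    and c0: "\<And>i. i < r \<Longrightarrow> c i \<noteq> 0"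
  shows "nonzero_eigenvectors (weighted_outer U c) (map (col U) [0..<r])"
  unfolding nonzero_eigenvectors_def
proof (intro conjI ballI allI impI)
  fix x assume "x \<in> set (map (col U) [0..<r])"
  then obtain i where "i < r" "x = col U i" by auto
  then show "vnorm x = 1" "\<exists>k. k \<noteq> 0 \<and> eigenvector (weighted_outer U c) x k"
    using eigenvector_weighted_outer_col[OF U on] c0 by blast+
next
  fix x k assume "vnorm x = 1 \<and> k \<noteq> 0 \<and> eigenvector (weighted_outer U c) x k"
  then obtain i where "i < r" "x = col U i \<or> x = - col U i"
    using unit_eigenvector_weighted_outer[OF U on inj] by blast
  then show "x \<in> set (map (col U) [0..<r]) \<or> - x \<in> set (map (col U) [0..<r])"
    by auto
next
  fix i j assume "i < j \<and> j < length (map (col U) [0..<r])"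
  then show "map (col U) [0..<r] ! i \<noteq> map (col U) [0..<r] ! j"
    "map (col U) [0..<r] ! i \<noteq> - (map (col U) [0..<r] ! j)"
    using orthonormal_cols_distinct_up_to_sign[OF U on, of i j] by auto
qed

text \<open>This is where the rank is recovered. Each column occurs in the list up to sign. The
  resulting map from columns to positions is injective because orthonormal vectors differ even up to
  sign, and it is surjective because the list has no repetitions up to sign.\<close>

lemma nonzero_eigenvectors_weighted_outerD:
  assumes U: "U \<in> carrier_mat n r" and on: "orthonormal_cols U" and inj: "inj_on c {..<r}"
    and c0: "\<And>i. i < r \<Longrightarrow> c i \<noteq> 0"
    and xs: "nonzero_eigenvectors (weighted_outer U c) xs"
  obtains \<pi> s where "length xs = r" "\<pi> permutes {..<r}"
    "\<And>i. i < r \<Longrightarrow> s i \<in> {1, -1} \<and> xs ! \<pi> i = s i \<cdot>\<^sub>v col U i"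
proof -
  have ev: "vnorm x = 1" "\<exists>k. k \<noteq> 0 \<and> eigenvector (weighted_outer U c) x k" if "x \<in> set xs" for x
    using xs that unfolding nonzero_eigenvectors_def by blast+
  have mem: "x \<in> set xs \<or> - x \<in> set xs"
    if "vnorm x = 1" "k \<noteq> 0" "eigenvector (weighted_outer U c) x k" for x k
    using xs that unfolding nonzero_eigenvectors_def by blast
  have dist: "xs ! i \<noteq> xs ! j \<and> xs ! i \<noteq> - (xs ! j)" if "i < j" "j < length xs" for i j
    using xs that unfolding nonzero_eigenvectors_def by blast
  have "\<exists>k<length xs. xs ! k = col U i \<or> xs ! k = - col U i" if "i < r" for i
  proof -
    have "col U i \<in> set xs \<or> - col U i \<in> set xs"
      using mem eigenvector_weighted_outer_col[OF U on that] c0[OF that] by blast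
    then show ?thesis by (auto simp: in_set_conv_nth)
  qed
  then obtain p where p: "\<And>i. i < r \<Longrightarrow> p i < length xs \<and> (xs ! p i = col U i \<or> xs ! p i = - col U i)"
    by metis
  have "bij_betw p {..<r} {..<length xs}"
  proof (rule bij_betw_imageI)
    show "inj_on p {..<r}"
    proof (rule inj_onI, rule ccontr)
      fix i j assume ij: "i \<in> {..<r}" "j \<in> {..<r}" "p i = p j" "i \<noteq> j"
      then have "col U i = col U j \<or> col U i = - col U j"
        using p[of i] p[of j] by (auto simp: uminus_eq_vec)
      then show False using orthonormal_cols_distinct_up_to_sign[OF U on, of i j] ij by auto
    qed
    show "p ` {..<r} = {..<length xs}"
    proof (intro equalityI subsetI)
      fix k assume "k \<in> {..<length xs}"
      then have k: "k < length xs" by simp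
      then obtain i where i: "i < r" "xs ! k = col U i \<or> xs ! k = - col U i"
        using unit_eigenvector_weighted_outer[OF U on inj] ev[of "xs ! k"] nth_mem[OF k] by blast
      then have "xs ! k = xs ! p i \<or> xs ! k = - (xs ! p i)" "xs ! p i = xs ! k \<or> xs ! p i = - (xs ! k)"
        using p[OF i(1)] by (auto simp: uminus_eq_vec)
      then have "p i = k"
        using dist[of k "p i"] dist[of "p i" k] k p[OF i(1)] by (meson linorder_neqE_nat)
      then show "k \<in> p ` {..<r}" using i by blast
    qed (use p in auto)
  qed
  then have len: "length xs = r" using bij_betw_same_card[of p "{..<r}" "{..<length xs}"] by simp
  \<comment> \<open>The extension by the identity beyond \<open>r\<close> is what
    \<open>permutes\<close> asks for.\<close>
  define \<pi> where "\<pi> = (\<lambda>i. if i < r then p i else i)"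
  have "bij_betw \<pi> {..<r} {..<r}"
    using \<open>bij_betw p {..<r} {..<length xs}\<close> unfolding len
    by (rule bij_betw_cong[THEN iffD1, rotated]) (simp add: \<pi>_def)
  then have perm: "\<pi> permutes {..<r}"
    by (rule bij_imp_permutes) (simp add: \<pi>_def)
  define s where "s = (\<lambda>i. if xs ! p i = col U i then 1 else - 1 :: real)"
  have "s i \<in> {1, -1} \<and> xs ! \<pi> i = s i \<cdot>\<^sub>v col U i" if "i < r" for i
  proof -
    have "(- 1) \<cdot>\<^sub>v col U i = - col U i" by (auto intro!: eq_vecI)
    then show ?thesis using p[OF that] that by (auto simp: s_def \<pi>_def)
  qed
  then show thesis using that len perm by blast
qed

section \<open>Singular vectors of a matrix of rank one\<close>

text \<open>The Householder reflection that exchanges \<open>x\<close> with the first unit vector; if \<open>x\<close> is that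
  vector, then the division by zero makes it the identity.\<close>

lemma ex_orthonormal_with_first_col:
  fixes x :: "real vec"
  assumes x: "x \<in> carrier_vec n" and x1: "x \<bullet> x = 1" and n: "0 < n"
  obtains P where "P \<in> carrier_mat n n" "orthonormal_cols P" "col P 0 = x"
proof -
  define e where "e = (\<lambda>i j :: nat. if i = j then 1 else 0 :: real)"
  define w where "w = (\<lambda>i. x $ i - e i 0)"
  define N where "N = (\<Sum>k<n. w k * w k)"
  define P where "P = mat n n (\<lambda>(i, j). e i j - 2 * w i * w j / N)"
  have P: "P \<in> carrier_mat n n" by (simp add: P_def)
  have xx: "(\<Sum>k<n. x $ k * x $ k) = 1" using x1 x by (simp add: scalar_prod_lessThan)
  have esum: "(\<Sum>k<n. e k i * f k) = f i" "(\<Sum>k<n. e i k * f k) = f i" if "i < n" for f :: "nat \<Rightarrow> real" and i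
  proof -
    have "(\<Sum>k<n. e k i * f k) = (\<Sum>k<n. if k = i then f i else 0)"
      "(\<Sum>k<n. e i k * f k) = (\<Sum>k<n. if k = i then f i else 0)"
      unfolding e_def by (intro sum.cong; auto)+
    then show "(\<Sum>k<n. e k i * f k) = f i" "(\<Sum>k<n. e i k * f k) = f i" using that by simp_all
  qed
  have "N = (\<Sum>k<n. x $ k * x $ k) - 2 * (\<Sum>k<n. e k 0 * x $ k) + (\<Sum>k<n. e k 0 * e k 0)"
    unfolding N_def w_def by (simp add: algebra_simps sum.distrib sum_subtractf sum_distrib_left)
  \<comment> \<open>Both \<open>x\<close> and the first unit vector have length 1, so the squared
    norm \<open>N\<close> of their difference \<open>w\<close> is \<open>- 2 * w 0\<close>. This
    identity makes the reflection send one to the other.\<close>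
  then have N: "N = 2 - 2 * x $ 0" using esum(1)[OF n] xx by (simp add: e_def)
  have "col P i \<bullet> col P j = e i j" if ij: "i < n" "j < n" for i j
  proof -
    have "col P i \<bullet> col P j = (\<Sum>k<n. (e k i - 2 * w k * w i / N) * (e k j - 2 * w k * w j / N))"
      using ij P by (auto simp: scalar_prod_lessThan P_def intro!: sum.cong)
    also have "\<dots> = (\<Sum>k<n. e k i * e k j - 2 * w j / N * (e k i * w k) - 2 * w i / N * (e k j * w k)
        + 4 * w i * w j / (N * N) * (w k * w k))"
      by (intro sum.cong) (auto simp: algebra_simps)
    also have "\<dots> = e i j - 2 * w j / N * w i - 2 * w i / N * w j + 4 * w i * w j / (N * N) * N"
      unfolding sum.distrib sum_subtractf sum_distrib_left[symmetric] esum(1)[OF ij(1)] esum(1)[OF ij(2)]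
      by (simp add: N_def)
    also have "\<dots> = e i j" by (cases "N = 0") (auto simp: field_simps)
    finally show ?thesis .
  qed
  then have "orthonormal_cols P" unfolding orthonormal_cols_iff[OF P] e_def by blast
  moreover have "col P 0 = x"
  proof (rule eq_vecI)
    fix i assume "i < dim_vec x"
    then have i: "i < n" using x by simp
    have "e i 0 - 2 * w i * w 0 / N = x $ i"
    proof (cases "N = 0")
      case True
      then have "\<forall>k<n. w k * w k = 0"
        unfolding N_def by (subst (asm) sum_nonneg_eq_0_iff) auto
      then show ?thesis using i True by (simp add: w_def)
    next
      case False
      have "w 0 = - N / 2" unfolding N w_def e_def by simp
      then have "2 * w i * w 0 / N = - w i" using False by simp
      then show ?thesis by (simp add: w_def)
    qed
    then show "col P 0 $ i = x $ i" using i n by (simp add: P_def)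
  qed (use x P in auto)
  ultimately show thesis by (rule that[OF P])
qed

lemma is_svdD:
  assumes svd: "is_svd R P S Q" and R: "R \<in> carrier_mat m n" and k: "k < min m n"
  shows "R *\<^sub>v col Q k = S $$ (k, k) \<cdot>\<^sub>v col P k" "R\<^sup>T *\<^sub>v col P k = S $$ (k, k) \<cdot>\<^sub>v col Q k"
    "vnorm (col Q k) = 1"
proof -
  have P: "P \<in> carrier_mat m m" and onP: "orthonormal_cols P"
    and Q: "Q \<in> carrier_mat n n" and onQ: "orthonormal_cols Q"
    and S: "S \<in> carrier_mat m n" and dS: "diagonal_mat S" and RPSQ: "R = P * S * Q\<^sup>T"
    using svd R unfolding is_svd_def by auto
  have PP: "P\<^sup>T * P = 1\<^sub>m m" and QQ: "Q\<^sup>T * Q = 1\<^sub>m n"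
    using onP onQ P Q unfolding orthonormal_cols_def by auto
  have k': "k < m" "k < n" using k by auto
  have S0: "S $$ (i, j) = 0" if "i < m" "j < n" "i \<noteq> j" for i j
    using dS S that unfolding diagonal_mat_def by auto
  have "R * Q = P * S * (Q\<^sup>T * Q)"
    unfolding RPSQ using P S Q by (intro assoc_mult_mat) auto
  then have RQ: "R * Q = P * S" using QQ P S by simp
  have "R *\<^sub>v col Q k = col (R * Q) k"
    using R Q k' by (intro eq_vecI) auto
  also have "\<dots> = S $$ (k, k) \<cdot>\<^sub>v col P k"
  proof (rule eq_vecI)
    fix i assume "i < dim_vec (S $$ (k, k) \<cdot>\<^sub>v col P k)"
    then have i: "i < m" using P by simp
    have "col (R * Q) k $ i = (\<Sum>l<m. P $$ (i, l) * S $$ (l, k))"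
      unfolding RQ using P S k' i by (simp add: scalar_prod_lessThan)
    also have "\<dots> = (\<Sum>l<m. if l = k then S $$ (k, k) * P $$ (i, k) else 0)"
      using S0 k' by (intro sum.cong) auto
    finally show "col (R * Q) k $ i = (S $$ (k, k) \<cdot>\<^sub>v col P k) $ i" using k' i P by simp
  qed (use R P in auto)
  finally show "R *\<^sub>v col Q k = S $$ (k, k) \<cdot>\<^sub>v col P k" .
  have "R\<^sup>T = Q * (P * S)\<^sup>T"
    unfolding RPSQ using P S Q by (subst transpose_mult[of _ m n _ n]) auto
  also have "\<dots> = Q * S\<^sup>T * P\<^sup>T"
    using P S Q by (subst transpose_mult[of _ m m _ n]) (auto simp: assoc_mult_mat[of _ n n _ m _ m])
  finally have RT: "R\<^sup>T = Q * S\<^sup>T * P\<^sup>T" .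
  have "R\<^sup>T * P = Q * S\<^sup>T * (P\<^sup>T * P)"
    unfolding RT using P S Q by (intro assoc_mult_mat[of _ n m _ m _ m]) auto
  then have RP: "R\<^sup>T * P = Q * S\<^sup>T" using PP S Q by simp
  have "R\<^sup>T *\<^sub>v col P k = col (R\<^sup>T * P) k"
    using R P k' by (intro eq_vecI) auto
  also have "\<dots> = S $$ (k, k) \<cdot>\<^sub>v col Q k"
  proof (rule eq_vecI)
    fix i assume "i < dim_vec (S $$ (k, k) \<cdot>\<^sub>v col Q k)"
    then have i: "i < n" using Q by simp
    have "col (R\<^sup>T * P) k $ i = (\<Sum>l<n. Q $$ (i, l) * S $$ (k, l))"
      unfolding RP using Q S k' i by (simp add: scalar_prod_lessThan)
    also have "\<dots> = (\<Sum>l<n. if l = k then S $$ (k, k) * Q $$ (i, k) else 0)"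
      using S0 k' by (intro sum.cong) auto
    finally show "col (R\<^sup>T * P) k $ i = (S $$ (k, k) \<cdot>\<^sub>v col Q k) $ i" using k' i Q by simp
  qed (use R Q in auto)
  finally show "R\<^sup>T *\<^sub>v col P k = S $$ (k, k) \<cdot>\<^sub>v col Q k" .
  show "vnorm (col Q k) = 1"
    using onQ k' unfolding orthonormal_cols_iff[OF Q] vnorm_eq_1_iff by simp
qed

text \<open>\<open>R\<close> maps into the line of \<open>a\<close> and its transpose into the line
  of \<open>b\<close>, so singular vectors for a nonzero singular value lie on these lines. The two
  scalars are reciprocal because \<open>y\<close> is a unit vector: if \<open>y\<close> is \<kappa>
  times \<open>b\<close>, then pairing with \<open>y\<close> gives 1 = \<kappa> times
  \<open>b \<bullet> y\<close>, and \<open>b \<bullet> y\<close> is the factor of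
  \<open>a\<close>.\<close>

lemma top_singular_triple_rank_one:
  fixes a b :: "real vec"
  assumes a: "a \<in> carrier_vec m" and b: "b \<in> carrier_vec n" and a0: "a \<noteq> 0\<^sub>v m" and b0: "b \<noteq> 0\<^sub>v n"
    and R: "R = mat m n (\<lambda>(i, j). a $ i * b $ j)" and tri: "top_singular_triple R s x y"
  obtains c where "c \<noteq> 0" "s \<cdot>\<^sub>v x = c \<cdot>\<^sub>v a" "y = (1 / c) \<cdot>\<^sub>v b" "vnorm y = 1"
proof -
  have Rc: "R \<in> carrier_mat m n" by (simp add: R)
  obtain P S Q k where svd: "is_svd R P S Q" and k: "k < min m n"
    and max: "\<And>i. i < min m n \<Longrightarrow> S $$ (i, i) \<le> S $$ (k, k)"
    and s: "s = S $$ (k, k)" and x: "x = col P k" and y: "y = col Q k"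
    using tri Rc unfolding top_singular_triple_def by auto
  note D = is_svdD[OF svd Rc k, folded s x y]
  have xc: "x \<in> carrier_vec m" and yc: "y \<in> carrier_vec n"
    using svd k Rc unfolding is_svd_def x y by auto
  have Ry: "R *\<^sub>v y = (b \<bullet> y) \<cdot>\<^sub>v a"
    using a b yc by (intro eq_vecI) (auto simp: R scalar_prod_lessThan sum_distrib_left ac_simps intro!: sum.cong)
  have Rx: "R\<^sup>T *\<^sub>v x = (a \<bullet> x) \<cdot>\<^sub>v b"
    using a b xc by (intro eq_vecI) (auto simp: R scalar_prod_lessThan sum_distrib_left ac_simps intro!: sum.cong)
  \<comment> \<open>If the largest singular value were zero, then all of them would be, and
    \<open>R\<close> would vanish.\<close>
  have "s \<noteq> 0"
  proof
    assume "s = 0"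
    have S: "S \<in> carrier_mat m n" and dS: "diagonal_mat S" and nn: "\<And>i. i < min m n \<Longrightarrow> 0 \<le> S $$ (i, i)"
      and RPSQ: "R = P * S * Q\<^sup>T" and PQ: "P \<in> carrier_mat m m" "Q \<in> carrier_mat n n"
      using svd Rc unfolding is_svd_def by auto
    have "S $$ (i, j) = 0" if "i < m" "j < n" for i j
      using dS S that nn[of i] max[of i] \<open>s = 0\<close> s unfolding diagonal_mat_def
      by (cases "i = j") auto
    then have "S = 0\<^sub>m m n" using S by (intro eq_matI) auto
    then have R0: "R = 0\<^sub>m m n" using RPSQ PQ by simp
    obtain i where i: "i < m" "a $ i \<noteq> 0" using a a0 by (auto simp: vec_eq_iff)
    obtain j where j: "j < n" "b $ j \<noteq> 0" using b b0 by (auto simp: vec_eq_iff)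
    have "R $$ (i, j) = a $ i * b $ j" using i j by (simp add: R)
    then show False using R0 i j by simp
  qed
  have sx: "s \<cdot>\<^sub>v x = (b \<bullet> y) \<cdot>\<^sub>v a" using D(1) Ry by simp
  define \<kappa> where "\<kappa> = (a \<bullet> x) / s"
  have y\<kappa>: "y = \<kappa> \<cdot>\<^sub>v b"
  proof (rule eq_vecI)
    fix i assume "i < dim_vec (\<kappa> \<cdot>\<^sub>v b)"
    then have i: "i < n" using b by simp
    have "s \<cdot>\<^sub>v y = (a \<bullet> x) \<cdot>\<^sub>v b" using D(2) Rx by simp
    then have "(s \<cdot>\<^sub>v y) $ i = ((a \<bullet> x) \<cdot>\<^sub>v b) $ i" by simp
    then have "s * y $ i = (a \<bullet> x) * b $ i" using i b yc by simp
    then show "y $ i = (\<kappa> \<cdot>\<^sub>v b) $ i"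
      using i b \<open>s \<noteq> 0\<close> by (simp add: \<kappa>_def field_simps)
  qed (use b yc in auto)
  have "y \<bullet> y = 1" using D(3) by (simp add: vnorm_eq_1_iff)
  then have \<kappa>b: "\<kappa> * (b \<bullet> y) = 1" using b yc by (subst (asm) (1) y\<kappa>) simp
  then have "\<kappa> \<noteq> 0" by auto
  then have "b \<bullet> y = 1 / \<kappa>" using \<kappa>b by (simp add: nonzero_eq_divide_eq mult.commute)
  with \<open>\<kappa> \<noteq> 0\<close> show thesis using that[of "1 / \<kappa>"] sx y\<kappa> D(3) by simp
qed

text \<open>Completing the normalized \<open>a\<close> and \<open>b\<close> to orthonormal bases
  gives a decomposition with a single nonzero singular value, the product of the two norms.\<close>

lemma ex_top_singular_triple_rank_one:
  fixes a b :: "real vec"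
  assumes a: "a \<in> carrier_vec m" and b: "b \<in> carrier_vec n" and a0: "a \<noteq> 0\<^sub>v m" and b0: "b \<noteq> 0\<^sub>v n"
  shows "\<exists>s x y. top_singular_triple (mat m n (\<lambda>(i, j). a $ i * b $ j)) s x y"
proof -
  let ?R = "mat m n (\<lambda>(i, j). a $ i * b $ j)"
  have m: "0 < m" using a a0 by (auto simp: vec_eq_iff)
  have n: "0 < n" using b b0 by (auto simp: vec_eq_iff)
  have na: "vnorm a > 0" and nb: "vnorm b > 0" using vnorm_pos a b a0 b0 by blast+
  have unit: "normalize_vec a \<bullet> normalize_vec a = 1" "normalize_vec b \<bullet> normalize_vec b = 1"
    using na nb unfolding vnorm_eq_1_iff[symmetric] normalize_vec_def vnorm_smult by simp_all
  obtain P where P: "P \<in> carrier_mat m m" "orthonormal_cols P" "col P 0 = normalize_vec a"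
    using ex_orthonormal_with_first_col[OF _ unit(1) m] a by (auto simp: normalize_vec_def)
  obtain Q where Q: "Q \<in> carrier_mat n n" "orthonormal_cols Q" "col Q 0 = normalize_vec b"
    using ex_orthonormal_with_first_col[OF _ unit(2) n] b by (auto simp: normalize_vec_def)
  define S where "S = mat m n (\<lambda>(i, j). if i = 0 \<and> j = 0 then vnorm a * vnorm b else 0)"
  have S: "S \<in> carrier_mat m n" by (simp add: S_def)
  have "?R = P * S * Q\<^sup>T"
  proof (rule eq_matI)
    fix i j assume "i < dim_row (P * S * Q\<^sup>T)" "j < dim_col (P * S * Q\<^sup>T)"
    then have ij: "i < m" "j < n" using P Q by auto
    have Pi: "P $$ (i, 0) = a $ i / vnorm a"
      using arg_cong[OF P(3), of "\<lambda>v. v $ i"] ij m a P(1) by (simp add: normalize_vec_def)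
    have Qj: "Q $$ (j, 0) = b $ j / vnorm b"
      using arg_cong[OF Q(3), of "\<lambda>v. v $ j"] ij n b Q(1) by (simp add: normalize_vec_def)
    have PS: "(P * S) $$ (i, l) = (if l = 0 then P $$ (i, 0) * (vnorm a * vnorm b) else 0)" if "l < n" for l
    proof -
      have "(P * S) $$ (i, l) = (\<Sum>k<m. P $$ (i, k) * S $$ (k, l))"
        using P S ij that by (simp add: scalar_prod_lessThan)
      also have "\<dots> = (\<Sum>k<m. if k = 0 then (if l = 0 then P $$ (i, 0) * (vnorm a * vnorm b) else 0) else 0)"
        using that by (intro sum.cong) (auto simp: S_def)
      finally show ?thesis using m by simp
    qed
    have "(M * Q\<^sup>T) $$ (i, j) = (\<Sum>l<n. M $$ (i, l) * Q $$ (j, l))" if "M \<in> carrier_mat m n" for M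
      using that Q ij by (simp add: scalar_prod_lessThan)
    then have "(P * S * Q\<^sup>T) $$ (i, j) = (\<Sum>l<n. (P * S) $$ (i, l) * Q $$ (j, l))"
      using mult_carrier_mat[OF P(1) S] by blast
    also have "\<dots> = (\<Sum>l<n. if l = 0 then P $$ (i, 0) * (vnorm a * vnorm b) * Q $$ (j, 0) else 0)"
      by (intro sum.cong) (auto simp: PS)
    also have "\<dots> = a $ i * b $ j" using n na nb by (simp add: Pi Qj)
    finally show "?R $$ (i, j) = (P * S * Q\<^sup>T) $$ (i, j)" using ij by simp
  qed (use P Q in auto)
  then have "is_svd ?R P S Q"
    unfolding is_svd_def using P Q S na nb by (auto simp: diagonal_mat_def S_def)
  moreover have "\<forall>i<min m n. S $$ (i, i) \<le> S $$ (0, 0)"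
    using m n na nb by (auto simp: S_def)
  ultimately show ?thesis
    unfolding top_singular_triple_def using m n
    by (intro exI[of _ "S $$ (0, 0)"] exI[of _ "col P 0"] exI[of _ "col Q 0"] exI[of _ P] exI[of _ S]
      exI[of _ Q] exI[of _ 0]) auto
qed

section \<open>Steps 2 to 4 for orthonormal factors\<close>

text \<open>The train tensor and its whitened version share this shape and differ in the
  coefficients and factors; an arbitrary coefficient function \<open>g\<close> covers both.\<close>

definition cp_tensor :: "(nat \<Rightarrow> nat \<Rightarrow> real) \<Rightarrow> real mat \<Rightarrow> real mat \<Rightarrow> tensor4" where
  "cp_tensor g U V = (\<lambda>i1 i2 i3 i4. \<Sum>i<dim_col U. \<Sum>j<dim_col V.
     g i j * (U $$ (i1, i) * U $$ (i2, i) * V $$ (i3, j) * V $$ (i4, j)))"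

lemma train_tensor_eq_cp_tensor:
  "train_tensor l m U V = cp_tensor (\<lambda>i j. l $ i * m $ j * (col U i \<bullet> col V j)) U V"
  by (simp add: train_tensor_def cp_tensor_def)

text \<open>The symmetry between the two carriages, by which the formula for the second slice
  follows from the one for the first.\<close>

lemma cp_tensor_swap: "cp_tensor g U V i1 i2 i3 i4 = cp_tensor (\<lambda>j i. g i j) V U i3 i4 i1 i2"
  unfolding cp_tensor_def by (subst sum.swap) (simp add: ac_simps)

text \<open>The quadratic form of \<open>a\<close> at \<open>v\<close>. The weights of a slice are
  linear combinations of its values at the columns of the other factor, hence linear in the random
  matrix.\<close>

definition quad :: "real mat \<Rightarrow> real vec \<Rightarrow> real" where
  "quad a v = (\<Sum>k<dim_vec v. \<Sum>l<dim_vec v. a $$ (k, l) * (v $ k * v $ l))"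

lemma sum_rotate:
  "(\<Sum>k\<in>A. \<Sum>i\<in>I. \<Sum>j\<in>J. F k i j) = (\<Sum>i\<in>I. \<Sum>j\<in>J. \<Sum>k\<in>A. F k i j)"
  by (subst sum.swap, intro sum.cong refl, rule sum.swap)

lemma slice_A_cp_tensor:
  assumes U: "U \<in> carrier_mat p r" and V: "V \<in> carrier_mat q s"
    and S: "\<And>i1 i2 i3 i4. i1 < p \<Longrightarrow> i2 < p \<Longrightarrow> i3 < q \<Longrightarrow> i4 < q \<Longrightarrow>
      S i1 i2 i3 i4 = cp_tensor g U V i1 i2 i3 i4"
  shows "slice_A p q a S = weighted_outer U (\<lambda>i. \<Sum>j<s. g i j * quad a (col V j))"
proof (rule eq_matI)
  fix i1 i2 assume "i1 < dim_row (weighted_outer U (\<lambda>i. \<Sum>j<s. g i j * quad a (col V j)))"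
    "i2 < dim_col (weighted_outer U (\<lambda>i. \<Sum>j<s. g i j * quad a (col V j)))"
  then have i: "i1 < p" "i2 < p" using U by auto
  let ?F = "\<lambda>i3 i4 i j. a $$ (i3, i4) * (g i j * (U $$ (i1, i) * U $$ (i2, i) * V $$ (i3, j) * V $$ (i4, j)))"
  have "slice_A p q a S $$ (i1, i2) = (\<Sum>i3<q. \<Sum>i4<q. \<Sum>i<r. \<Sum>j<s. ?F i3 i4 i j)"
    using i U V by (simp add: slice_A_def S cp_tensor_def sum_distrib_left)
  also have "\<dots> = (\<Sum>i<r. \<Sum>j<s. \<Sum>i3<q. \<Sum>i4<q. ?F i3 i4 i j)"
    by (simp only: sum_rotate[where A = "{..<q}" and I = "{..<r}" and J = "{..<s}"])
  also have "\<dots> = (\<Sum>i<r. (\<Sum>j<s. g i j * quad a (col V j)) * (U $$ (i1, i) * U $$ (i2, i)))"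
    using V by (auto simp: quad_def sum_distrib_left sum_distrib_right ac_simps intro!: sum.cong)
  also have "\<dots> = weighted_outer U (\<lambda>i. \<Sum>j<s. g i j * quad a (col V j)) $$ (i1, i2)"
    using i U by (simp add: weighted_outer_def)
  finally show "slice_A p q a S $$ (i1, i2) = weighted_outer U (\<lambda>i. \<Sum>j<s. g i j * quad a (col V j)) $$ (i1, i2)" .
qed (use U in \<open>auto simp: slice_A_def\<close>)

lemma slice_B_eq_slice_A: "slice_B p q b S = slice_A q p b (\<lambda>i3 i4 i1 i2. S i1 i2 i3 i4)"
  by (simp add: slice_A_def slice_B_def)

lemma slice_B_cp_tensor:
  assumes U: "U \<in> carrier_mat p r" and V: "V \<in> carrier_mat q s"
    and S: "\<And>i1 i2 i3 i4. i1 < p \<Longrightarrow> i2 < p \<Longrightarrow> i3 < q \<Longrightarrow> i4 < q \<Longrightarrow>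
      S i1 i2 i3 i4 = cp_tensor g U V i1 i2 i3 i4"
  shows "slice_B p q b S = weighted_outer V (\<lambda>j. \<Sum>i<r. g i j * quad b (col U i))"
  unfolding slice_B_eq_slice_A
  by (rule slice_A_cp_tensor[OF V U]) (simp add: S cp_tensor_swap[of g])

text \<open>Four independent vectors are allowed because an entry of the whitened tensor is the
  contraction with four rows of the whitening matrices.\<close>

lemma contract_vecs_cp_tensor:
  assumes U: "U \<in> carrier_mat p r" and V: "V \<in> carrier_mat q s"
    and S: "\<And>i1 i2 i3 i4. i1 < p \<Longrightarrow> i2 < p \<Longrightarrow> i3 < q \<Longrightarrow> i4 < q \<Longrightarrow>
      S i1 i2 i3 i4 = cp_tensor g U V i1 i2 i3 i4"
    and x: "x1 \<in> carrier_vec p" "x2 \<in> carrier_vec p" "x3 \<in> carrier_vec q" "x4 \<in> carrier_vec q"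
  shows "contract_vecs S x1 x2 x3 x4 = (\<Sum>i<r. \<Sum>j<s.
    g i j * ((x1 \<bullet> col U i) * (x2 \<bullet> col U i) * (x3 \<bullet> col V j) * (x4 \<bullet> col V j)))"
proof -
  let ?F = "\<lambda>k1 k2 k3 k4 i j. g i j * ((x1 $ k1 * U $$ (k1, i)) * ((x2 $ k2 * U $$ (k2, i)) *
    ((x3 $ k3 * V $$ (k3, j)) * (x4 $ k4 * V $$ (k4, j)))))"
  have "contract_vecs S x1 x2 x3 x4 =
      (\<Sum>k1<p. \<Sum>k2<p. \<Sum>k3<q. \<Sum>k4<q. \<Sum>i<r. \<Sum>j<s. ?F k1 k2 k3 k4 i j)"
    using x U V by (auto simp: contract_vecs_def S cp_tensor_def sum_distrib_left ac_simps intro!: sum.cong)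
  also have "\<dots> = (\<Sum>i<r. \<Sum>j<s. \<Sum>k1<p. \<Sum>k2<p. \<Sum>k3<q. \<Sum>k4<q. ?F k1 k2 k3 k4 i j)"
    by (simp only: sum_rotate[where A = "{..<q}" and I = "{..<r}" and J = "{..<s}"]
        sum_rotate[where A = "{..<p}" and I = "{..<r}" and J = "{..<s}"])
  also have "\<dots> = (\<Sum>i<r. \<Sum>j<s. g i j * ((\<Sum>k<p. x1 $ k * U $$ (k, i)) *
      ((\<Sum>k<p. x2 $ k * U $$ (k, i)) * ((\<Sum>k<q. x3 $ k * V $$ (k, j)) * (\<Sum>k<q. x4 $ k * V $$ (k, j))))))"
    by (simp only: sum_distrib_left[symmetric] sum_distrib_right[symmetric])
  also have "\<dots> = (\<Sum>i<r. \<Sum>j<s.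
      g i j * ((x1 \<bullet> col U i) * (x2 \<bullet> col U i) * (x3 \<bullet> col V j) * (x4 \<bullet> col V j)))"
    using U V by (intro sum.cong refl) (simp add: scalar_prod_lessThan mult.assoc)
  finally show ?thesis .
qed

text \<open>Orthonormality leaves a single term of the double sum, in which each sign occurs
  squared.\<close>

lemma contract_vecs_cp_tensor_cols:
  assumes U: "U \<in> carrier_mat p r" "orthonormal_cols U" and V: "V \<in> carrier_mat q s" "orthonormal_cols V"
    and S: "\<And>i1 i2 i3 i4. i1 < p \<Longrightarrow> i2 < p \<Longrightarrow> i3 < q \<Longrightarrow> i4 < q \<Longrightarrow>
      S i1 i2 i3 i4 = cp_tensor g U V i1 i2 i3 i4"
    and ij: "i < r" "j < s" and e: "e \<in> {1, -1}" "f \<in> {1, -1}"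
  shows "contract_vecs S (e \<cdot>\<^sub>v col U i) (e \<cdot>\<^sub>v col U i) (f \<cdot>\<^sub>v col V j) (f \<cdot>\<^sub>v col V j) = g i j"
proof -
  have u: "col U k \<in> carrier_vec p" "(e \<cdot>\<^sub>v col U i) \<bullet> col U k = (if k = i then e else 0)" if "k < r" for k
    using U that ij unfolding orthonormal_cols_iff[OF U(1)] by auto
  have v: "col V k \<in> carrier_vec q" "(f \<cdot>\<^sub>v col V j) \<bullet> col V k = (if k = j then f else 0)" if "k < s" for k
    using V that ij unfolding orthonormal_cols_iff[OF V(1)] by auto
  have ef: "e * e = 1" "f * f = 1" using e by auto
  let ?u = "e \<cdot>\<^sub>v col U i" and ?v = "f \<cdot>\<^sub>v col V j"
  have "contract_vecs S ?u ?u ?v ?v = (\<Sum>k<r. \<Sum>l<s.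
      g k l * ((?u \<bullet> col U k) * (?u \<bullet> col U k) * (?v \<bullet> col V l) * (?v \<bullet> col V l)))"
    using u(1)[OF ij(1)] v(1)[OF ij(2)] by (intro contract_vecs_cp_tensor[OF U(1) V(1)]) (auto simp: S)
  also have "\<dots> = (\<Sum>k<r. \<Sum>l<s. if l = j then (if k = i then g i j else 0) else 0)"
  proof (intro sum.cong refl)
    fix k l assume "k \<in> {..<r}" "l \<in> {..<s}"
    then have kl: "?u \<bullet> col U k = (if k = i then e else 0)" "?v \<bullet> col V l = (if l = j then f else 0)"
      by (simp_all only: u(2) v(2) lessThan_iff)
    show "g k l * ((?u \<bullet> col U k) * (?u \<bullet> col U k) * (?v \<bullet> col V l) * (?v \<bullet> col V l)) =
        (if l = j then (if k = i then g i j else 0) else 0)"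
      unfolding kl using ef by (simp add: mult.assoc)
  qed
  also have "\<dots> = g i j" using ij by simp
  finally show ?thesis .
qed

text \<open>The outcome common to plain and whitened runs: \<open>uh\<close> and \<open>x\<close>
  are the predicted vectors and coefficients. The eigenvectors \<open>ubs\<close> are tied to the
  same permutation and signs as the output \<open>us\<close>, because the norms by which step 3
  divides are those of images of \<open>ubs\<close>.\<close>

definition matches ::
  "nat \<Rightarrow> real mat \<Rightarrow> (nat \<Rightarrow> real vec) \<Rightarrow> (nat \<Rightarrow> real) \<Rightarrow> real \<Rightarrow>
   real vec list \<Rightarrow> real vec list \<Rightarrow> real vec \<Rightarrow> bool" where
  "matches r U uh x c ubs us lh \<longleftrightarrow> length us = r \<and> dim_vec lh = r \<and>
     (\<exists>\<pi> e. \<pi> permutes {..<r} \<and> (\<forall>i<r. e i \<in> {1, -1} \<and> ubs ! \<pi> i = e i \<cdot>\<^sub>v col U i \<and>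
        us ! \<pi> i = e i \<cdot>\<^sub>v uh i \<and> lh $ \<pi> i = c * (e i * x i)))"

text \<open>The vectors whose outer product is \<open>R\<close> are indexed by positions in the
  output list, whereas \<open>matches\<close> is indexed by columns; hence the inverse
  permutation.\<close>

lemma matchesI:
  assumes "length us = r" "\<pi> permutes {..<r}"
    "\<And>i. i < r \<Longrightarrow> e i \<in> {1, -1} \<and> ubs ! \<pi> i = e i \<cdot>\<^sub>v col U i \<and> us ! \<pi> i = e i \<cdot>\<^sub>v uh i"
    and lh: "lh = c \<cdot>\<^sub>v vec r (\<lambda>k. e (inv_into UNIV \<pi> k) * x (inv_into UNIV \<pi> k))"
  shows "matches r U uh x c ubs us lh"
proof -
  have "lh $ \<pi> i = c * (e i * x i)" if "i < r" for i
    using permutes_in_image[OF assms(2), of i] that permutes_inverses(2)[OF assms(2)] by (simp add: lh)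
  then show ?thesis unfolding matches_def using assms(1-3) by (auto simp: lh)
qed

text \<open>The factorization of \<open>g i j\<close> into \<open>x i * y j\<close> and an inner
  product is what makes the division in step 4 leave a matrix of rank one. Agreement of
  \<open>S\<close> with the tensor is required inside the dimensions only, since a contracted tensor
  is unspecified outside them.\<close>

lemma slice_core_correct:
  assumes U: "U \<in> carrier_mat p r" "orthonormal_cols U" and V: "V \<in> carrier_mat q s" "orthonormal_cols V"
    and pos: "0 < r" "0 < s"
    and S: "\<And>i1 i2 i3 i4. i1 < p \<Longrightarrow> i2 < p \<Longrightarrow> i3 < q \<Longrightarrow> i4 < q \<Longrightarrow>
      S i1 i2 i3 i4 = cp_tensor g U V i1 i2 i3 i4"
    and g: "\<And>i j. i < r \<Longrightarrow> j < s \<Longrightarrow> g i j = x i * y j * (uh i \<bullet> vh j)"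
    and nz: "\<And>i. i < r \<Longrightarrow> x i \<noteq> 0" "\<And>j. j < s \<Longrightarrow> y j \<noteq> 0"
      "\<And>i j. i < r \<Longrightarrow> j < s \<Longrightarrow> uh i \<bullet> vh j \<noteq> 0"
    and car: "\<And>i. i < r \<Longrightarrow> uh i \<in> carrier_vec n" "\<And>j. j < s \<Longrightarrow> vh j \<in> carrier_vec n"
    and LA: "\<And>i e. i < r \<Longrightarrow> e \<in> {1, -1} \<Longrightarrow> LA (e \<cdot>\<^sub>v col U i) = e \<cdot>\<^sub>v uh i"
    and LB: "\<And>j e. j < s \<Longrightarrow> e \<in> {1, -1} \<Longrightarrow> LB (e \<cdot>\<^sub>v col V j) = e \<cdot>\<^sub>v vh j"
    and a: "\<And>i. i < r \<Longrightarrow> (\<Sum>j<s. g i j * quad a (col V j)) \<noteq> 0"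
      "inj_on (\<lambda>i. \<Sum>j<s. g i j * quad a (col V j)) {..<r}"
    and b: "\<And>j. j < s \<Longrightarrow> (\<Sum>i<r. g i j * quad b (col U i)) \<noteq> 0"
      "inj_on (\<lambda>j. \<Sum>i<r. g i j * quad b (col U i)) {..<s}"
  shows "\<exists>ubs vbs us vs lh mh. slice_core p q S LA LB a b ubs vbs us vs lh mh"
    and "slice_core p q S LA LB a b ubs vbs us vs lh mh \<Longrightarrow> vnorm mh = 1 \<and>
      (\<exists>c. c \<noteq> 0 \<and> matches r U uh x c ubs us lh \<and> matches s V vh y (1 / c) vbs vs mh)"
proof -
  have SA: "slice_A p q a S = weighted_outer U (\<lambda>i. \<Sum>j<s. g i j * quad a (col V j))"
    by (rule slice_A_cp_tensor[OF U(1) V(1)]) (rule S)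
  have SB: "slice_B p q b S = weighted_outer V (\<lambda>j. \<Sum>i<r. g i j * quad b (col U i))"
    by (rule slice_B_cp_tensor[OF U(1) V(1)]) (rule S)
  let ?R = "\<lambda>ubs vbs us vs. mat (length us) (length vs) (\<lambda>(i, j).
            contract_vecs S (ubs ! i) (ubs ! i) (vbs ! j) (vbs ! j) / (us ! i \<bullet> vs ! j))"
  \<comment> \<open>This is proved for arbitrary eigenvector lists, because it is applied to the
    columns themselves, to show that an output exists, and to the lists of a given run.\<close>
  have R: "\<exists>\<pi> e \<sigma> f. length ubs = r \<and> length vbs = s \<and> \<pi> permutes {..<r} \<and> \<sigma> permutes {..<s} \<and>
      (\<forall>i<r. e i \<in> {1, -1} \<and> ubs ! \<pi> i = e i \<cdot>\<^sub>v col U i \<and> map LA ubs ! \<pi> i = e i \<cdot>\<^sub>v uh i) \<and>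
      (\<forall>j<s. f j \<in> {1, -1} \<and> vbs ! \<sigma> j = f j \<cdot>\<^sub>v col V j \<and> map LB vbs ! \<sigma> j = f j \<cdot>\<^sub>v vh j) \<and>
      vec r (\<lambda>k. e (inv_into UNIV \<pi> k) * x (inv_into UNIV \<pi> k)) \<noteq> 0\<^sub>v r \<and> vec s (\<lambda>k. f (inv_into UNIV \<sigma> k) * y (inv_into UNIV \<sigma> k)) \<noteq> 0\<^sub>v s \<and>
      ?R ubs vbs (map LA ubs) (map LB vbs) = mat r s (\<lambda>(k, l).
        vec r (\<lambda>k. e (inv_into UNIV \<pi> k) * x (inv_into UNIV \<pi> k)) $ k * vec s (\<lambda>k. f (inv_into UNIV \<sigma> k) * y (inv_into UNIV \<sigma> k)) $ l)"
    if evA: "nonzero_eigenvectors (slice_A p q a S) ubs" and evB: "nonzero_eigenvectors (slice_B p q b S) vbs"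
    for ubs vbs
  proof -
    obtain \<pi> e where lenA: "length ubs = r" and \<pi>: "\<pi> permutes {..<r}"
      and e: "\<And>i. i < r \<Longrightarrow> e i \<in> {1, -1} \<and> ubs ! \<pi> i = e i \<cdot>\<^sub>v col U i"
      using nonzero_eigenvectors_weighted_outerD[OF U a(2,1) evA[unfolded SA]] by blast
    obtain \<sigma> f where lenB: "length vbs = s" and \<sigma>: "\<sigma> permutes {..<s}"
      and f: "\<And>j. j < s \<Longrightarrow> f j \<in> {1, -1} \<and> vbs ! \<sigma> j = f j \<cdot>\<^sub>v col V j"
      using nonzero_eigenvectors_weighted_outerD[OF V b(2,1) evB[unfolded SB]] by blast
    have mapA: "map LA ubs ! \<pi> i = e i \<cdot>\<^sub>v uh i" if "i < r" for i
      using e[OF that] LA[OF that] permutes_in_image[OF \<pi>, of i] that lenA by simp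
    have mapB: "map LB vbs ! \<sigma> j = f j \<cdot>\<^sub>v vh j" if "j < s" for j
      using f[OF that] LB[OF that] permutes_in_image[OF \<sigma>, of j] that lenB by simp
    have nzA: "e (inv_into UNIV \<pi> k) * x (inv_into UNIV \<pi> k) \<noteq> 0" if "k < r" for k
      using permutes_in_image[OF permutes_inv[OF \<pi>], of k] that e[of "inv_into UNIV \<pi> k"] nz(1)[of "inv_into UNIV \<pi> k"] by auto
    have nzB: "f (inv_into UNIV \<sigma> k) * y (inv_into UNIV \<sigma> k) \<noteq> 0" if "k < s" for k
      using permutes_in_image[OF permutes_inv[OF \<sigma>], of k] that f[of "inv_into UNIV \<sigma> k"] nz(2)[of "inv_into UNIV \<sigma> k"] by auto
    \<comment> \<open>The numerator does not see the signs, while the denominator carries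
      \<open>e i * f j\<close>. Signs are their own inverses, so they reappear in the quotient as
      factors of the two coefficients.\<close>
    have entry: "contract_vecs S (ubs ! k) (ubs ! k) (vbs ! l) (vbs ! l) / (map LA ubs ! k \<bullet> map LB vbs ! l) =
        (e (inv_into UNIV \<pi> k) * x (inv_into UNIV \<pi> k)) * (f (inv_into UNIV \<sigma> l) * y (inv_into UNIV \<sigma> l))" if kl: "k < r" "l < s" for k l
    proof -
      define i j where "i = inv_into UNIV \<pi> k" and "j = inv_into UNIV \<sigma> l"
      have k: "k = \<pi> i" "i < r" and l: "l = \<sigma> j" "j < s"
        using permutes_inverses(1)[OF \<pi>] permutes_inverses(1)[OF \<sigma>] kl
          permutes_in_image[OF permutes_inv[OF \<pi>], of k] permutes_in_image[OF permutes_inv[OF \<sigma>], of l]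
        by (auto simp: i_def j_def)
      have ei: "e i \<in> {1, -1}" "ubs ! k = e i \<cdot>\<^sub>v col U i" and fj: "f j \<in> {1, -1}" "vbs ! l = f j \<cdot>\<^sub>v col V j"
        using e[OF k(2)] f[OF l(2)] k l by auto
      have "contract_vecs S (ubs ! k) (ubs ! k) (vbs ! l) (vbs ! l) = x i * y j * (uh i \<bullet> vh j)"
        unfolding ei(2) fj(2) g[OF k(2) l(2), symmetric]
        by (rule contract_vecs_cp_tensor_cols[OF U V _ k(2) l(2) ei(1) fj(1)]) (rule S)
      moreover have "map LA ubs ! k \<bullet> map LB vbs ! l = e i * f j * (uh i \<bullet> vh j)"
        using mapA[OF k(2)] mapB[OF l(2)] k l car(1)[OF k(2)] car(2)[OF l(2)] by simp
      ultimately show ?thesis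
        unfolding i_def[symmetric] j_def[symmetric] using ei(1) fj(1) nz(3)[OF k(2) l(2)] by auto
    qed
    show ?thesis
      using lenA lenB \<pi> \<sigma> e f mapA mapB nzA[OF pos(1)] nzB[OF pos(2)] pos entry
      by (intro exI[of _ \<pi>] exI[of _ e] exI[of _ \<sigma>] exI[of _ f]) (auto simp: vec_eq_iff intro!: eq_matI)
  qed
  show "\<exists>ubs vbs us vs lh mh. slice_core p q S LA LB a b ubs vbs us vs lh mh"
  proof -
    have evA: "nonzero_eigenvectors (slice_A p q a S) (map (col U) [0..<r])"
      unfolding SA by (rule nonzero_eigenvectors_weighted_outer_cols[OF U a(2,1)])
    have evB: "nonzero_eigenvectors (slice_B p q b S) (map (col V) [0..<s])"
      unfolding SB by (rule nonzero_eigenvectors_weighted_outer_cols[OF V b(2,1)])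
    obtain \<pi> e \<sigma> f where
        nz: "vec r (\<lambda>k. e (inv_into UNIV \<pi> k) * x (inv_into UNIV \<pi> k)) \<noteq> 0\<^sub>v r"
          "vec s (\<lambda>k. f (inv_into UNIV \<sigma> k) * y (inv_into UNIV \<sigma> k)) \<noteq> 0\<^sub>v s"
      and Rvw: "?R (map (col U) [0..<r]) (map (col V) [0..<s]) (map LA (map (col U) [0..<r])) (map LB (map (col V) [0..<s]))
        = mat r s (\<lambda>(k, l). vec r (\<lambda>k. e (inv_into UNIV \<pi> k) * x (inv_into UNIV \<pi> k)) $ k *
            vec s (\<lambda>k. f (inv_into UNIV \<sigma> k) * y (inv_into UNIV \<sigma> k)) $ l)"
      using R[OF evA evB] by blast
    obtain t z z' where "top_singular_triple (?R (map (col U) [0..<r]) (map (col V) [0..<s])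
        (map LA (map (col U) [0..<r])) (map LB (map (col V) [0..<s]))) t z z'"
      using ex_top_singular_triple_rank_one[OF vec_carrier vec_carrier nz] unfolding Rvw by blast
    then have "slice_core p q S LA LB a b (map (col U) [0..<r]) (map (col V) [0..<s])
        (map LA (map (col U) [0..<r])) (map LB (map (col V) [0..<s])) (t \<cdot>\<^sub>v z) z'"
      unfolding slice_core_def Let_def using evA evB by blast
    then show ?thesis by blast
  qed
  assume core: "slice_core p q S LA LB a b ubs vbs us vs lh mh"
  then have ev: "nonzero_eigenvectors (slice_A p q a S) ubs" "nonzero_eigenvectors (slice_B p q b S) vbs"
    and us: "us = map LA ubs" and vs: "vs = map LB vbs"
    unfolding slice_core_def by blast+
  obtain t z z' where tri: "top_singular_triple (?R ubs vbs us vs) t z z'" and lh: "lh = t \<cdot>\<^sub>v z" and mh: "mh = z'"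
    using core unfolding slice_core_def Let_def by blast
  obtain \<pi> e \<sigma> f where *: "length ubs = r" "length vbs = s" "\<pi> permutes {..<r}" "\<sigma> permutes {..<s}"
      "\<forall>i<r. e i \<in> {1, -1} \<and> ubs ! \<pi> i = e i \<cdot>\<^sub>v col U i \<and> us ! \<pi> i = e i \<cdot>\<^sub>v uh i"
      "\<forall>j<s. f j \<in> {1, -1} \<and> vbs ! \<sigma> j = f j \<cdot>\<^sub>v col V j \<and> vs ! \<sigma> j = f j \<cdot>\<^sub>v vh j"
      "vec r (\<lambda>k. e (inv_into UNIV \<pi> k) * x (inv_into UNIV \<pi> k)) \<noteq> 0\<^sub>v r" "vec s (\<lambda>k. f (inv_into UNIV \<sigma> k) * y (inv_into UNIV \<sigma> k)) \<noteq> 0\<^sub>v s"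
      "?R ubs vbs us vs = mat r s (\<lambda>(k, l).
        vec r (\<lambda>k. e (inv_into UNIV \<pi> k) * x (inv_into UNIV \<pi> k)) $ k * vec s (\<lambda>k. f (inv_into UNIV \<sigma> k) * y (inv_into UNIV \<sigma> k)) $ l)"
    using R[OF ev, folded us vs] by blast
  obtain c where c: "c \<noteq> 0" "lh = c \<cdot>\<^sub>v vec r (\<lambda>k. e (inv_into UNIV \<pi> k) * x (inv_into UNIV \<pi> k))"
      "mh = (1 / c) \<cdot>\<^sub>v vec s (\<lambda>k. f (inv_into UNIV \<sigma> k) * y (inv_into UNIV \<sigma> k))" "vnorm mh = 1"
    using top_singular_triple_rank_one[OF _ _ *(7,8,9) tri] unfolding lh mh by auto
  have "matches r U uh x c ubs us lh"
    using *(5) by (intro matchesI[OF _ *(3) _ c(2)]) (auto simp: us *(1))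
  moreover have "matches s V vh y (1 / c) vbs vs mh"
    using *(6) by (intro matchesI[OF _ *(4) _ c(3)]) (auto simp: vs *(2))
  ultimately show "vnorm mh = 1 \<and>
      (\<exists>c. c \<noteq> 0 \<and> matches r U uh x c ubs us lh \<and> matches s V vh y (1 / c) vbs vs mh)"
    using c(1,4) by blast
qed

section \<open>Generic slices\<close>

text \<open>The rows of a left inverse are dual to the columns of \<open>V\<close>, and the outer
  square of row j is dual to the evaluations of \<open>quad\<close> at the columns. Hence these
  values can be prescribed independently of each other.\<close>

lemma quad_dual:
  assumes V: "V \<in> carrier_mat q s" and L: "L \<in> carrier_mat s q" and LV: "L * V = 1\<^sub>m s"
    and j: "j < s" "j' < s"
  shows "quad (mat q q (\<lambda>(k, l). L $$ (j, k) * L $$ (j, l))) (col V j') = (if j = j' then 1 else 0)"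
proof -
  have "(\<Sum>k<q. L $$ (j, k) * V $$ (k, j')) = (L * V) $$ (j, j')"
    using V L j by (simp add: scalar_prod_lessThan)
  then have *: "(\<Sum>k<q. L $$ (j, k) * V $$ (k, j')) = (if j = j' then 1 else 0)"
    using LV j by simp
  have "quad (mat q q (\<lambda>(k, l). L $$ (j, k) * L $$ (j, l))) (col V j') =
      (\<Sum>k<q. \<Sum>l<q. (L $$ (j, k) * V $$ (k, j')) * (L $$ (j, l) * V $$ (l, j')))"
    using V L j by (simp add: quad_def ac_simps)
  also have "\<dots> = (\<Sum>k<q. L $$ (j, k) * V $$ (k, j')) * (\<Sum>l<q. L $$ (j, l) * V $$ (l, j'))"
    by (simp add: sum_product)
  finally show ?thesis unfolding * by simp
qed

lemma poly_funs_quad: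
  assumes v: "v \<in> carrier_vec q"
  shows "(\<lambda>x. quad (fst x) v) \<in> poly_funs (mat_pair_coords q p)"
    and "(\<lambda>x. quad (snd x) v) \<in> poly_funs (mat_pair_coords p q)"
  unfolding quad_def using v poly_funs_mat_pair[unfolded case_prod_beta']
  by (auto intro!: poly_funs_sum poly_funs.mult poly_funs.const)

lemma quad_zero: "v \<in> carrier_vec q \<Longrightarrow> quad (0\<^sub>m q q) v = 0"
  by (simp add: quad_def)

text \<open>A dual matrix isolates one nonzero coefficient, so the polynomial does not vanish
  identically. Taking \<open>h\<close> or \<open>k\<close> to be zero gives the conditions on a
  single random matrix. The matrix that is contracted with modes 3 and 4 meets the columns of
  \<open>V\<close>, which is why its size \<open>q\<close> comes first.\<close>

lemma generically_quad_sum_nonzero: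
  assumes U: "U \<in> carrier_mat p r" "LU \<in> carrier_mat r p" "LU * U = 1\<^sub>m r"
    and V: "V \<in> carrier_mat q s" "LV \<in> carrier_mat s q" "LV * V = 1\<^sub>m s"
    and nz: "(\<exists>j<s. h j \<noteq> 0) \<or> (\<exists>i<r. k i \<noteq> 0)"
  shows "generically (mat_pair_coords q p) (mat_pairs q p)
    (\<lambda>x. (\<Sum>j<s. h j * quad (fst x) (col V j)) + (\<Sum>i<r. k i * quad (snd x) (col U i)) \<noteq> 0)"
proof -
  let ?f = "\<lambda>x. (\<Sum>j<s. h j * quad (fst x) (col V j)) + (\<Sum>i<r. k i * quad (snd x) (col U i))"
  have vc: "col V j \<in> carrier_vec q" if "j < s" for j using V that by simp
  have uc: "col U i \<in> carrier_vec p" if "i < r" for i using U that by simp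
  have "?f \<in> poly_funs (mat_pair_coords q p)"
    using vc uc by (intro poly_funs.add poly_funs_sum poly_funs.mult poly_funs.const poly_funs_quad) auto
  moreover have "\<exists>x\<in>mat_pairs q p. ?f x \<noteq> 0"
  proof (cases "\<exists>j<s. h j \<noteq> 0")
    case True
    then obtain j where j: "j < s" "h j \<noteq> 0" by blast
    let ?x = "(mat q q (\<lambda>(k, l). LV $$ (j, k) * LV $$ (j, l)), 0\<^sub>m p p)"
    have "(\<Sum>j'<s. h j' * quad (fst ?x) (col V j')) = (\<Sum>j'<s. if j' = j then h j else 0)"
      by (intro sum.cong) (auto simp: quad_dual[OF V j(1)])
    moreover have "(\<Sum>i<r. k i * quad (snd ?x) (col U i)) = 0"
      using quad_zero[OF uc] by (intro sum.neutral) auto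
    ultimately show ?thesis using j by (intro bexI[of _ ?x]) (auto simp: mat_pairs_def)
  next
    case False
    then obtain i where i: "i < r" "k i \<noteq> 0" using nz by blast
    let ?x = "(0\<^sub>m q q, mat p p (\<lambda>(k, l). LU $$ (i, k) * LU $$ (i, l)))"
    have "(\<Sum>i'<r. k i' * quad (snd ?x) (col U i')) = (\<Sum>i'<r. if i' = i then k i else 0)"
      by (intro sum.cong) (auto simp: quad_dual[OF U i(1)])
    moreover have "(\<Sum>j<s. h j * quad (fst ?x) (col V j)) = 0"
      using quad_zero[OF vc] by (intro sum.neutral) auto
    ultimately show ?thesis using i by (intro bexI[of _ ?x]) (auto simp: mat_pairs_def)
  qed
  ultimately show ?thesis using generically_mat_pairs by blast
qed

lemma generically_slice_weights_nonzero:
  assumes U: "U \<in> carrier_mat p r" "LU \<in> carrier_mat r p" "LU * U = 1\<^sub>m r"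
    and V: "V \<in> carrier_mat q s" "LV \<in> carrier_mat s q" "LV * V = 1\<^sub>m s"
    and rows: "\<And>i. i < r \<Longrightarrow> \<exists>j<s. g i j \<noteq> 0" and cols: "\<And>j. j < s \<Longrightarrow> \<exists>i<r. g i j \<noteq> 0"
  shows "generically (mat_pair_coords q p) (mat_pairs q p) (\<lambda>x.
    (\<forall>i\<in>{..<r}. (\<Sum>j<s. g i j * quad (fst x) (col V j)) \<noteq> 0) \<and>
    (\<forall>j\<in>{..<s}. (\<Sum>i<r. g i j * quad (snd x) (col U i)) \<noteq> 0))"
proof (intro generically_conj generically_ball)
  fix i assume "i \<in> {..<r}"
  then show "generically (mat_pair_coords q p) (mat_pairs q p)
      (\<lambda>x. (\<Sum>j<s. g i j * quad (fst x) (col V j)) \<noteq> 0)"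
    using generically_quad_sum_nonzero[OF U V, of "g i" "\<lambda>_. 0"] rows by simp
next
  fix j assume "j \<in> {..<s}"
  then show "generically (mat_pair_coords q p) (mat_pairs q p)
      (\<lambda>x. (\<Sum>i<r. g i j * quad (snd x) (col U i)) \<noteq> 0)"
    using generically_quad_sum_nonzero[OF U V, of "\<lambda>_. 0" "\<lambda>i. g i j"] cols by simp
qed simp_all

text \<open>The difference of two weights is again a combination of values of \<open>quad\<close>,
  with the difference of two rows or columns of \<open>g\<close> as coefficients.\<close>

lemma generically_slice_weights_inj:
  assumes U: "U \<in> carrier_mat p r" "LU \<in> carrier_mat r p" "LU * U = 1\<^sub>m r"
    and V: "V \<in> carrier_mat q s" "LV \<in> carrier_mat s q" "LV * V = 1\<^sub>m s"
    and rows: "\<And>i i'. i < r \<Longrightarrow> i' < r \<Longrightarrow> i \<noteq> i' \<Longrightarrow> \<exists>j<s. g i j \<noteq> g i' j"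
    and cols: "\<And>j j'. j < s \<Longrightarrow> j' < s \<Longrightarrow> j \<noteq> j' \<Longrightarrow> \<exists>i<r. g i j \<noteq> g i j'"
  shows "generically (mat_pair_coords q p) (mat_pairs q p) (\<lambda>x.
    inj_on (\<lambda>i. \<Sum>j<s. g i j * quad (fst x) (col V j)) {..<r} \<and>
    inj_on (\<lambda>j. \<Sum>i<r. g i j * quad (snd x) (col U i)) {..<s})"
proof -
  have A: "generically (mat_pair_coords q p) (mat_pairs q p)
      (\<lambda>x. (\<Sum>j<s. g i j * quad (fst x) (col V j)) \<noteq> (\<Sum>j<s. g i' j * quad (fst x) (col V j)))"
    if "i < r" "i' < r" "i \<noteq> i'" for i i'
    using generically_quad_sum_nonzero[OF U V, of "\<lambda>j. g i j - g i' j" "\<lambda>_. 0"] rows[OF that]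
    by (simp add: left_diff_distrib sum_subtractf)
  have B: "generically (mat_pair_coords q p) (mat_pairs q p)
      (\<lambda>x. (\<Sum>i<r. g i j * quad (snd x) (col U i)) \<noteq> (\<Sum>i<r. g i j' * quad (snd x) (col U i)))"
    if "j < s" "j' < s" "j \<noteq> j'" for j j'
    using generically_quad_sum_nonzero[OF U V, of "\<lambda>_. 0" "\<lambda>i. g i j - g i j'"] cols[OF that]
    by (simp add: left_diff_distrib sum_subtractf)
  have "generically (mat_pair_coords q p) (mat_pairs q p) (\<lambda>x.
    (\<forall>(i, i')\<in>{(i, i'). i < r \<and> i' < r \<and> i \<noteq> i'}.
      (\<Sum>j<s. g i j * quad (fst x) (col V j)) \<noteq> (\<Sum>j<s. g i' j * quad (fst x) (col V j))) \<and>
    (\<forall>(j, j')\<in>{(j, j'). j < s \<and> j' < s \<and> j \<noteq> j'}.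
      (\<Sum>i<r. g i j * quad (snd x) (col U i)) \<noteq> (\<Sum>i<r. g i j' * quad (snd x) (col U i))))"
  proof (intro generically_conj generically_ball)
    show "finite {(i, i'). i < r \<and> i' < r \<and> i \<noteq> i'}"
      by (rule finite_subset[of _ "{..<r} \<times> {..<r}"]) auto
    show "finite {(j, j'). j < s \<and> j' < s \<and> j \<noteq> j'}"
      by (rule finite_subset[of _ "{..<s} \<times> {..<s}"]) auto
  qed (use A B in auto)
  then show ?thesis by (rule generically_mono) (auto simp: inj_on_def)
qed

section \<open>Whitening\<close>

lemma mat_diag_cong: "(\<And>i. i < n \<Longrightarrow> f i = g i) \<Longrightarrow> mat_diag n f = mat_diag n g"
  by (auto simp: mat_diag_def)

lemma mat_diag_eq_one: "(\<And>i. i < n \<Longrightarrow> f i = 1) \<Longrightarrow> mat_diag n f = 1\<^sub>m n"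
  by (auto simp: mat_diag_def)

text \<open>Every pseudoinverse \<open>B'\<close> of \<open>W\<close> is a right inverse too. The
  symmetric matrices \<open>B * W\<close> and \<open>B' * W\<close> then absorb each other,
  \<open>(B * W) * (B' * W) = B * W\<close> and conversely, and transposing one of these equations
  identifies them.\<close>

lemma pinv_eq_if_right_inverse:
  assumes W: "W \<in> carrier_mat p n" and B: "B \<in> carrier_mat n p" and WB: "W * B = 1\<^sub>m p"
    and sym: "(B * W)\<^sup>T = B * W"
  shows "pinv W = B"
  unfolding pinv_def
proof (rule the_equality)
  show "is_pinv W B"
    unfolding is_pinv_def using W B WB sym by (simp add: assoc_mult_mat[of B n p W n B p])
next
  fix B' assume "is_pinv W B'"
  then have B': "B' \<in> carrier_mat n p" and WBW: "W * B' * W = W" and BWB: "B' * W * B' = B'"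
    and sym': "(B' * W)\<^sup>T = B' * W"
    using W unfolding is_pinv_def by auto
  have car: "B' * W \<in> carrier_mat n n" "B * W \<in> carrier_mat n n" "W * B' \<in> carrier_mat p p"
    using W B B' by auto
  have "W * B' = W * B' * (W * B)" unfolding WB by (rule right_mult_one_mat[OF car(3), symmetric])
  also have "\<dots> = W * B' * W * B" using assoc_mult_mat[OF car(3) W B] by simp
  finally have WB': "W * B' = 1\<^sub>m p" unfolding WBW WB .
  have "(B * W) * (B' * W) = B * (W * B') * W"
    using W B B' by (simp add: assoc_mult_mat[of _ n p _ n _ n] assoc_mult_mat[of _ n p _ p _ n]
      assoc_mult_mat[of W p n B' p W n])
  then have 1: "(B * W) * (B' * W) = B * W" using WB' B by simp
  have "(B' * W) * (B * W) = B' * (W * B) * W"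
    using W B B' by (simp add: assoc_mult_mat[of _ n p _ n _ n] assoc_mult_mat[of _ n p _ p _ n]
      assoc_mult_mat[of W p n B p W n])
  then have 2: "(B' * W) * (B * W) = B' * W" using WB B' by simp
  have "B * W = ((B * W) * (B' * W))\<^sup>T" using 1 sym by simp
  also have "\<dots> = (B' * W) * (B * W)" using car sym sym' by (simp add: transpose_mult[of _ n n _ n])
  finally have "B' * W = B * W" using 2 by simp
  then have "B' = B * W * B'" using BWB by simp
  also have "\<dots> = B * (W * B')" using B W B' by (rule assoc_mult_mat)
  finally show "B' = B" using WB' B by simp
qed

text \<open>\<open>Y\<close> and \<open>B\<close> are two square roots of the same matrix, so they
  differ by an orthogonal change of basis, and that change is \<open>W * Y\<close>. Equality of
  \<open>p\<close> and \<open>r\<close> is not presupposed; it is implicit in \<open>W * Y\<close>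
  having inverses on both sides.\<close>

lemma orthonormal_cols_if_same_gram:
  assumes W: "W \<in> carrier_mat p n" and B: "B \<in> carrier_mat n p" and WB: "W * B = 1\<^sub>m p"
    and Y: "Y \<in> carrier_mat n r" and M: "M \<in> carrier_mat r n" and MY: "M * Y = 1\<^sub>m r"
    and YY: "Y * Y\<^sup>T = B * B\<^sup>T"
  shows "orthonormal_cols (W * Y)" "B * (W * Y) = Y"
proof -
  have YT: "Y\<^sup>T \<in> carrier_mat r n" and BT: "B\<^sup>T \<in> carrier_mat p n" and MT: "M\<^sup>T \<in> carrier_mat n r"
    and WT: "W\<^sup>T \<in> carrier_mat n p" using Y B M W by auto
  have WY: "W * Y \<in> carrier_mat p r" using W Y by simp
  have YM: "Y\<^sup>T * M\<^sup>T = 1\<^sub>m r"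
    using transpose_mult[OF M Y] MY by simp
  have "B * (W * Y) * Y\<^sup>T = B * (W * (Y * Y\<^sup>T))"
    using assoc_mult_mat[OF B WY YT] assoc_mult_mat[OF W Y YT] by simp
  also have "\<dots> = B * (W * B * B\<^sup>T)"
    unfolding YY using assoc_mult_mat[OF W B BT] by simp
  finally have eq: "B * (W * Y) * Y\<^sup>T = Y * Y\<^sup>T" unfolding WB YY using BT by simp
  have BWY: "B * (W * Y) \<in> carrier_mat n r" using B WY by simp
  have "B * (W * Y) = B * (W * Y) * (Y\<^sup>T * M\<^sup>T)" unfolding YM by (rule right_mult_one_mat[OF BWY, symmetric])
  also have "\<dots> = Y * Y\<^sup>T * M\<^sup>T" using assoc_mult_mat[OF BWY YT MT] eq by simp
  also have "\<dots> = Y" using assoc_mult_mat[OF Y YT MT] YM Y by simp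
  finally show BWY_Y: "B * (W * Y) = Y" .
  have "M * B * (W * Y) = 1\<^sub>m r" using assoc_mult_mat[OF M B WY] BWY_Y MY by simp
  \<comment> \<open>\<open>M * B\<close> is a left inverse of \<open>W * Y\<close>, and the
    transpose is a right inverse by the equality of the two square roots; hence they
    coincide.\<close>
  moreover have "M * B = (W * Y)\<^sup>T"
  proof -
    have OT: "(W * Y)\<^sup>T \<in> carrier_mat r p" using WY by simp
    have MB: "M * B \<in> carrier_mat r p" using M B by simp
    have "B\<^sup>T * W\<^sup>T = 1\<^sub>m p" using transpose_mult[OF W B] WB by simp
    have "(W * Y) * (W * Y)\<^sup>T = W * Y * (Y\<^sup>T * W\<^sup>T)"
      using transpose_mult[OF W Y] by simp
    also have "\<dots> = W * Y * Y\<^sup>T * W\<^sup>T" using assoc_mult_mat[OF WY YT WT] by simp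
    also have "\<dots> = W * (B * B\<^sup>T) * W\<^sup>T" using assoc_mult_mat[OF W Y YT] YY by simp
    also have "\<dots> = B\<^sup>T * W\<^sup>T" using assoc_mult_mat[OF W B BT] WB BT by simp
    finally have OO: "(W * Y) * (W * Y)\<^sup>T = 1\<^sub>m p" using \<open>B\<^sup>T * W\<^sup>T = 1\<^sub>m p\<close> by simp
    have "M * B = M * B * ((W * Y) * (W * Y)\<^sup>T)" unfolding OO by (rule right_mult_one_mat[OF MB, symmetric])
    also have "\<dots> = M * B * (W * Y) * (W * Y)\<^sup>T" using assoc_mult_mat[OF MB WY OT] by simp
    finally show ?thesis using \<open>M * B * (W * Y) = 1\<^sub>m r\<close> left_mult_one_mat[OF OT] by simp
  qed
  ultimately show "orthonormal_cols (W * Y)" unfolding orthonormal_cols_def using WY Y by simp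
qed

text \<open>The scaling by \<open>sqrt (d i)\<close> restores unit length: whitening makes the
  columns of \<open>U\<close>, weighted in this way, orthonormal, and the pseudoinverse undoes it on
  the span of these columns.\<close>

lemma whitens_weighted_outer:
  assumes U: "U \<in> carrier_mat n r" and L: "L \<in> carrier_mat r n" and LU: "L * U = 1\<^sub>m r"
    and d: "\<And>i. i < r \<Longrightarrow> 0 < d i" and W: "whitens W (weighted_outer U d)"
  defines "Ub \<equiv> mat (dim_row W) r (\<lambda>(a, i). sqrt (d i) * (W * U) $$ (a, i))"
  shows "W \<in> carrier_mat (dim_row W) n" "orthonormal_cols Ub" "pinv W \<in> carrier_mat n (dim_row W)"
    "\<And>i. i < r \<Longrightarrow> pinv W *\<^sub>v col Ub i = sqrt (d i) \<cdot>\<^sub>v col U i"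
proof -
  obtain X D where skinny: "skinny_eigendecomposition (weighted_outer U d) X D"
    and WXD: "W = mat_diag (dim_row D) (\<lambda>i. 1 / sqrt (D $$ (i, i))) * X\<^sup>T"
    using W unfolding whitens_def by blast
  define p where "p = dim_col X"
  define \<delta> where "\<delta> = (\<lambda>i. D $$ (i, i))"
  have X: "X \<in> carrier_mat n p" and D: "D \<in> carrier_mat p p" and on: "orthonormal_cols X"
    and dD: "diagonal_mat D" and D0: "\<And>i. i < p \<Longrightarrow> \<delta> i \<noteq> 0"
    and CXD: "weighted_outer U d = X * D * X\<^sup>T"
    using skinny U unfolding skinny_eigendecomposition_def p_def \<delta>_def by auto
  have XT: "X\<^sup>T \<in> carrier_mat p n" using X by simp
  have XX: "X\<^sup>T * X = 1\<^sub>m p" using on X unfolding orthonormal_cols_def by simp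
  have "D = mat_diag p \<delta>"
    using D dD by (intro eq_matI) (auto simp: mat_diag_def diagonal_mat_def \<delta>_def)
  then have C: "weighted_outer U d = weighted_outer X \<delta>"
    using CXD weighted_outer_eq_mult[OF X] by simp
  \<comment> \<open>The eigenvalues are known to be nonzero only. Their sign is read off from the
    other representation of the slice, whose weights are positive, and it makes the square roots in
    \<open>W\<close> genuine.\<close>
  have \<delta>: "0 < \<delta> i" if i: "i < p" for i
  proof -
    have x: "col X i \<in> carrier_vec n" using X i by simp
    have "\<delta> i = col X i \<bullet> (weighted_outer U d *\<^sub>v col X i)"
      unfolding C weighted_outer_mult_col[OF X on i]
      using x i on[unfolded orthonormal_cols_iff[OF X]] by simp
    also have "\<dots> = (\<Sum>k<r. d k * (col U k \<bullet> col X i) * (col U k \<bullet> col X i))"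
      by (rule scalar_prod_weighted_outer[OF U x x])
    also have "\<dots> \<ge> 0" using d by (intro sum_nonneg) (simp add: mult.assoc less_imp_le)
    finally show ?thesis using D0[OF i] by simp
  qed
  \<comment> \<open>One square root of the slice, built from its eigendecomposition; it turns out to
    be the pseudoinverse of \<open>W\<close>.\<close>
  define B where "B = X * mat_diag p (\<lambda>i. sqrt (\<delta> i))"
  have W_eq: "W = mat_diag p (\<lambda>i. 1 / sqrt (\<delta> i)) * X\<^sup>T" using WXD D by (simp add: \<delta>_def)
  have Wc: "W \<in> carrier_mat p n" unfolding W_eq by (rule mult_carrier_mat[OF mat_diag_dim XT])
  then have dimW: "dim_row W = p" by simp
  then show "W \<in> carrier_mat (dim_row W) n" using Wc by simp
  have Bc: "B \<in> carrier_mat n p" unfolding B_def by (rule mult_carrier_mat[OF X mat_diag_dim])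
  have diag_cancel: "mat_diag p (\<lambda>i. 1 / sqrt (\<delta> i)) * mat_diag p (\<lambda>i. sqrt (\<delta> i)) = 1\<^sub>m p"
    "mat_diag p (\<lambda>i. sqrt (\<delta> i)) * mat_diag p (\<lambda>i. 1 / sqrt (\<delta> i)) = 1\<^sub>m p"
    using D0 \<delta> by (auto intro!: mat_diag_eq_one simp: less_imp_le)
  let ?E = "mat_diag p (\<lambda>i. 1 / sqrt (\<delta> i))" and ?F = "mat_diag p (\<lambda>i. sqrt (\<delta> i))"
  have "W * B = ?E * (X\<^sup>T * X) * ?F"
    unfolding W_eq B_def using X XT
    by (simp add: assoc_mult_mat[of _ p p _ n _ p] assoc_mult_mat[of _ p n _ p _ p] assoc_mult_mat[of _ p p _ p _ p])
  then have WB: "W * B = 1\<^sub>m p" unfolding XX right_mult_one_mat[OF mat_diag_dim] diag_cancel .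
  have "B * W = X * (?F * (?E * X\<^sup>T))"
    unfolding W_eq B_def by (rule assoc_mult_mat[OF X mat_diag_dim mult_carrier_mat[OF mat_diag_dim XT]])
  also have "?F * (?E * X\<^sup>T) = ?F * ?E * X\<^sup>T"
    by (rule assoc_mult_mat[OF mat_diag_dim mat_diag_dim XT, symmetric])
  finally have BW: "B * W = X * X\<^sup>T" unfolding diag_cancel left_mult_one_mat[OF XT] .
  have symBW: "(B * W)\<^sup>T = B * W" unfolding BW using X by (simp add: transpose_mult[of _ n p _ n])
  have pinv: "pinv W = B" by (rule pinv_eq_if_right_inverse[OF Wc Bc WB symBW])
  then show "pinv W \<in> carrier_mat n (dim_row W)" using Bc dimW by simp
  have gram: "(Z * mat_diag k (\<lambda>i. sqrt (c i))) * (Z * mat_diag k (\<lambda>i. sqrt (c i)))\<^sup>T = weighted_outer Z c"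
    if Z: "Z \<in> carrier_mat n k" and c: "\<And>i. i < k \<Longrightarrow> 0 < c i" for Z k c
  proof -
    let ?G = "mat_diag k (\<lambda>i. sqrt (c i))"
    have ZT: "Z\<^sup>T \<in> carrier_mat k n" using Z by simp
    have GG: "?G * ?G = mat_diag k c"
      using c by (auto intro!: mat_diag_cong simp: less_imp_le)
    have GT: "?G\<^sup>T = ?G"
      by (auto simp: mat_diag_def intro!: eq_matI)
    have "(Z * ?G) * (Z * ?G)\<^sup>T = Z * ?G * (?G * Z\<^sup>T)"
      unfolding transpose_mult[OF Z mat_diag_dim] GT ..
    also have "\<dots> = Z * (?G * (?G * Z\<^sup>T))"
      by (rule assoc_mult_mat[OF Z mat_diag_dim mult_carrier_mat[OF mat_diag_dim ZT]])
    also have "?G * (?G * Z\<^sup>T) = mat_diag k c * Z\<^sup>T"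
      unfolding GG[symmetric] by (rule assoc_mult_mat[OF mat_diag_dim mat_diag_dim ZT, symmetric])
    finally show ?thesis
      unfolding weighted_outer_eq_mult[OF Z] assoc_mult_mat[OF Z mat_diag_dim ZT] .
  qed
  \<comment> \<open>The second square root of the same slice, built from \<open>U\<close>, and below
    it a left inverse \<open>M\<close> obtained from \<open>L\<close>.\<close>
  define Y where "Y = U * mat_diag r (\<lambda>i. sqrt (d i))"
  define M where "M = mat_diag r (\<lambda>i. 1 / sqrt (d i)) * L"
  have Y: "Y \<in> carrier_mat n r" unfolding Y_def by (rule mult_carrier_mat[OF U mat_diag_dim])
  have M: "M \<in> carrier_mat r n" unfolding M_def by (rule mult_carrier_mat[OF mat_diag_dim L])
  have "M * Y = mat_diag r (\<lambda>i. 1 / sqrt (d i)) * (L * U) * mat_diag r (\<lambda>i. sqrt (d i))"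
    unfolding M_def Y_def using U L
    by (simp add: assoc_mult_mat[of _ r r _ n _ r] assoc_mult_mat[of _ r n _ r _ r] assoc_mult_mat[of _ r r _ r _ r])
  also have "\<dots> = 1\<^sub>m r"
    unfolding LU right_mult_one_mat[OF mat_diag_dim] using d by (auto intro!: mat_diag_eq_one simp: less_imp_neq[THEN not_sym])
  finally have MY: "M * Y = 1\<^sub>m r" .
  have YY: "Y * Y\<^sup>T = B * B\<^sup>T"
    unfolding Y_def B_def using gram[OF U d] gram[OF X \<delta>] C by simp
  have YU: "Y $$ (a, i) = sqrt (d i) * U $$ (a, i)" if "a < n" "i < r" for a i
    unfolding Y_def using U that by (simp add: mat_diag_mult_right)
  have Ub: "Ub = W * Y"
  proof (rule eq_matI)
    fix a i assume "a < dim_row (W * Y)" "i < dim_col (W * Y)"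
    then have ai: "a < p" "i < r" using Wc Y by auto
    then show "Ub $$ (a, i) = (W * Y) $$ (a, i)"
      using Wc U Y by (auto simp: Ub_def scalar_prod_lessThan YU sum_distrib_left ac_simps intro!: sum.cong)
  qed (use Wc Y in \<open>auto simp: Ub_def\<close>)
  note on' = orthonormal_cols_if_same_gram[OF Wc Bc WB Y M MY YY]
  show "orthonormal_cols Ub" unfolding Ub by (rule on'(1))
  fix i assume i: "i < r"
  have "pinv W *\<^sub>v col Ub i = col (B * (W * Y)) i"
    unfolding pinv Ub using Bc Wc Y i by (intro eq_vecI) auto
  also have "\<dots> = sqrt (d i) \<cdot>\<^sub>v col U i"
    unfolding on'(2) using Y U i by (intro eq_vecI) (auto simp: YU)
  finally show "pinv W *\<^sub>v col Ub i = sqrt (d i) \<cdot>\<^sub>v col U i" .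
qed

section \<open>Correctness for nondegenerate tensor trains\<close>

lemma normalize_vec_smult: "normalize_vec (k \<cdot>\<^sub>v x) = sgn k \<cdot>\<^sub>v normalize_vec x"
  by (cases "k = 0") (auto simp: normalize_vec_def vnorm_smult smult_smult_assoc sgn_if field_simps intro!: eq_vecI)

lemma normalize_vec_carrier [simp]: "x \<in> carrier_vec n \<Longrightarrow> normalize_vec x \<in> carrier_vec n"
  by (simp add: normalize_vec_def)

lemma normalize_vec_unit: "vnorm x = 1 \<Longrightarrow> normalize_vec x = x"
  by (simp add: normalize_vec_def)

lemma scalar_prod_normalize_vec:
  assumes "x \<in> carrier_vec n" "y \<in> carrier_vec n"
  shows "normalize_vec x \<bullet> normalize_vec y = (x \<bullet> y) / (vnorm x * vnorm y)"
  using assms by (simp add: normalize_vec_def)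

text \<open>The norm \<open>w k\<close> is computed from an eigenvector known up to sign only, so
  its relation to the coefficients is asked for both signs.\<close>

lemma matches_imp_recovers_carriage:
  assumes m: "matches r Ub uh x c ubs us lh" and r: "dim_col U = r"
    and uh: "\<And>i. i < r \<Longrightarrow> uh i = normalize_vec (col U i)"
    and w: "\<And>i k e. i < r \<Longrightarrow> e \<in> {1, -1} \<Longrightarrow> ubs ! k = e \<cdot>\<^sub>v col Ub i \<Longrightarrow>
      (w k)\<^sup>2 * x i = vnorm (col U i) ^ 3 * l $ i"
  shows "recovers_carriage l U c us lh w"
proof -
  obtain \<pi> e where len: "length us = r" "dim_vec lh = r" and \<pi>: "\<pi> permutes {..<r}"
    and e: "\<And>i. i < r \<Longrightarrow> e i \<in> {1, -1} \<and> ubs ! \<pi> i = e i \<cdot>\<^sub>v col Ub i \<and>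
        us ! \<pi> i = e i \<cdot>\<^sub>v uh i \<and> lh $ \<pi> i = c * (e i * x i)"
    using m unfolding matches_def by blast
  have "e i \<in> {1, -1} \<and> us ! \<pi> i = e i \<cdot>\<^sub>v normalize_vec (col U i) \<and>
      (w (\<pi> i))\<^sup>2 * lh $ \<pi> i = c * e i * (vnorm (col U i) ^ 3 * l $ i)" if i: "i < r" for i
  proof -
    have "(w (\<pi> i))\<^sup>2 * lh $ \<pi> i = c * e i * ((w (\<pi> i))\<^sup>2 * x i)" using e[OF i] by simp
    also have "(w (\<pi> i))\<^sup>2 * x i = vnorm (col U i) ^ 3 * l $ i"
      using e[OF i] by (intro w[OF i, of "e i"]) auto
    finally show ?thesis using e[OF i] uh[OF i] by simp
  qed
  then show ?thesis unfolding recovers_carriage_def r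
    using len \<pi> by (intro conjI exI[of _ \<pi>] exI[of _ e] allI impI) auto
qed

text \<open>Without whitening the coefficients take part in separating rows and columns of
  \<open>g\<close>, so a difference in the single entry with index 0 is enough.\<close>

lemma slice_plain_correct:
  assumes U: "U \<in> carrier_mat n r" "orthonormal_cols U" and V: "V \<in> carrier_mat n s" "orthonormal_cols V"
    and pos: "0 < r" "0 < s"
    and l: "\<And>i. i < r \<Longrightarrow> l $ i \<noteq> 0" and m: "\<And>j. j < s \<Longrightarrow> m $ j \<noteq> 0"
    and uv: "\<And>i j. i < r \<Longrightarrow> j < s \<Longrightarrow> col U i \<bullet> col V j \<noteq> 0"
    and rows: "\<And>i i'. i < r \<Longrightarrow> i' < r \<Longrightarrow> i \<noteq> i' \<Longrightarrow> l $ i * (col U i \<bullet> col V 0) \<noteq> l $ i' * (col U i' \<bullet> col V 0)"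
    and cols: "\<And>j j'. j < s \<Longrightarrow> j' < s \<Longrightarrow> j \<noteq> j' \<Longrightarrow> m $ j * (col U 0 \<bullet> col V j) \<noteq> m $ j' * (col U 0 \<bullet> col V j')"
  shows "slice_plain n (train_tensor l m U V) (recovers l m U V)"
proof -
  define g where "g = (\<lambda>i j. l $ i * m $ j * (col U i \<bullet> col V j))"
  have T: "train_tensor l m U V = cp_tensor g U V" unfolding train_tensor_eq_cp_tensor g_def ..
  have UL: "U\<^sup>T \<in> carrier_mat r n" "U\<^sup>T * U = 1\<^sub>m r" and VL: "V\<^sup>T \<in> carrier_mat s n" "V\<^sup>T * V = 1\<^sub>m s"
    using U V unfolding orthonormal_cols_def by auto
  have unitU: "vnorm (col U i) = 1" if "i < r" for i
    using U that unfolding orthonormal_cols_iff[OF U(1)] vnorm_eq_1_iff by simp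
  have unitV: "vnorm (col V j) = 1" if "j < s" for j
    using V that unfolding orthonormal_cols_iff[OF V(1)] vnorm_eq_1_iff by simp
  have g0: "g i j \<noteq> 0" if "i < r" "j < s" for i j using that l m uv by (simp add: g_def)
  have grow: "\<exists>j<s. g i j \<noteq> g i' j" if "i < r" "i' < r" "i \<noteq> i'" for i i'
    using rows[OF that] m[of 0] pos by (intro exI[of _ 0]) (auto simp: g_def)
  have gcol: "\<exists>i<r. g i j \<noteq> g i j'" if "j < s" "j' < s" "j \<noteq> j'" for j j'
    using cols[OF that] l[of 0] pos by (intro exI[of _ 0]) (auto simp: g_def)
  have carU: "col U i \<in> carrier_vec n" if "i < r" for i using U that by simp
  have carV: "col V j \<in> carrier_vec n" if "j < s" for j using V that by simp
  have "generically (mat_pair_coords n n) (mat_pairs n n) (\<lambda>x.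
    ((\<forall>i\<in>{..<r}. (\<Sum>j<s. g i j * quad (fst x) (col V j)) \<noteq> 0) \<and>
     (\<forall>j\<in>{..<s}. (\<Sum>i<r. g i j * quad (snd x) (col U i)) \<noteq> 0)) \<and>
    inj_on (\<lambda>i. \<Sum>j<s. g i j * quad (fst x) (col V j)) {..<r} \<and>
    inj_on (\<lambda>j. \<Sum>i<r. g i j * quad (snd x) (col U i)) {..<s})"
    using g0 pos
    by (intro generically_conj[OF generically_slice_weights_nonzero[OF U(1) UL V(1) VL]
          generically_slice_weights_inj[OF U(1) UL V(1) VL]] grow gcol) blast+
  then show ?thesis
    unfolding slice_plain_def
  proof (rule generically_mono)
    fix x :: "real mat \<times> real mat"
    obtain \<alpha> \<beta> where x: "x = (\<alpha>, \<beta>)" by (cases x)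
    assume "((\<forall>i\<in>{..<r}. (\<Sum>j<s. g i j * quad (fst x) (col V j)) \<noteq> 0) \<and>
     (\<forall>j\<in>{..<s}. (\<Sum>i<r. g i j * quad (snd x) (col U i)) \<noteq> 0)) \<and>
    inj_on (\<lambda>i. \<Sum>j<s. g i j * quad (fst x) (col V j)) {..<r} \<and>
    inj_on (\<lambda>j. \<Sum>i<r. g i j * quad (snd x) (col U i)) {..<s}"
    then have gen: "\<And>i. i < r \<Longrightarrow> (\<Sum>j<s. g i j * quad \<alpha> (col V j)) \<noteq> 0"
      "inj_on (\<lambda>i. \<Sum>j<s. g i j * quad \<alpha> (col V j)) {..<r}"
      "\<And>j. j < s \<Longrightarrow> (\<Sum>i<r. g i j * quad \<beta> (col U i)) \<noteq> 0"
      "inj_on (\<lambda>j. \<Sum>i<r. g i j * quad \<beta> (col U i)) {..<s}"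
      by (auto simp: x)
    note rule = slice_core_correct[where g = g and x = "\<lambda>i. l $ i" and y = "\<lambda>j. m $ j" and
        uh = "col U" and vh = "col V" and n = n and LA = id and LB = id and S = "cp_tensor g U V"]
    have ex: "\<exists>ubs vbs us vs lh mh. slice_core n n (cp_tensor g U V) id id \<alpha> \<beta> ubs vbs us vs lh mh"
      by (rule rule(1)) (fact U V pos l m uv carU carV gen | simp add: g_def)+
    have "recovers l m U V us vs lh mh (\<lambda>_. 1) (\<lambda>_. 1)"
      if run: "slice_core n n (cp_tensor g U V) id id \<alpha> \<beta> ubs vbs us vs lh mh" for ubs vbs us vs lh mh
    proof -
      obtain c where c: "vnorm mh = 1" "c \<noteq> 0" "matches r U (col U) (\<lambda>i. l $ i) c ubs us lh"
        "matches s V (col V) (\<lambda>j. m $ j) (1 / c) vbs vs mh"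
      proof -
        have "vnorm mh = 1 \<and> (\<exists>c. c \<noteq> 0 \<and> matches r U (col U) (\<lambda>i. l $ i) c ubs us lh \<and>
            matches s V (col V) (\<lambda>j. m $ j) (1 / c) vbs vs mh)"
          by (rule rule(2)) (fact U V pos l m uv carU carV gen run | simp add: g_def)+
        then show ?thesis using that by blast
      qed
      have "recovers_carriage l U c us lh (\<lambda>_. 1)"
        using U unitU by (intro matches_imp_recovers_carriage[OF c(3)]) (auto simp: normalize_vec_unit)
      moreover have "recovers_carriage m V (1 / c) vs mh (\<lambda>_. 1)"
        using V unitV by (intro matches_imp_recovers_carriage[OF c(4)]) (auto simp: normalize_vec_unit)
      ultimately show ?thesis unfolding recovers_def using c(1,2) by (intro conjI exI[of _ c])
    qed
    then show "case x of (\<alpha>, \<beta>) \<Rightarrow>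
        (\<exists>ubs vbs us vs lh mh. slice_core n n (train_tensor l m U V) id id \<alpha> \<beta> ubs vbs us vs lh mh) \<and>
        (\<forall>ubs vbs us vs lh mh. slice_core n n (train_tensor l m U V) id id \<alpha> \<beta> ubs vbs us vs lh mh \<longrightarrow>
          recovers l m U V us vs lh mh (\<lambda>_. 1) (\<lambda>_. 1))"
      unfolding x T using ex by simp
  qed
qed

text \<open>Each scaled vector occurs twice in a term, so scaling by \<open>sqrt (d i)\<close> and
  \<open>sqrt (e j)\<close> is compensated by dividing the coefficient by
  \<open>d i * e j\<close>.\<close>

lemma contract_mats_cp_tensor:
  assumes U: "U \<in> carrier_mat n r" and V: "V \<in> carrier_mat n s"
    and A: "A \<in> carrier_mat p n" and B: "B \<in> carrier_mat q n"
    and d: "\<And>i. i < r \<Longrightarrow> 0 < d i" and e: "\<And>j. j < s \<Longrightarrow> 0 < e j"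
    and i: "i1 < p" "i2 < p" "i3 < q" "i4 < q"
  shows "contract_mats (cp_tensor g U V) A A B B i1 i2 i3 i4 =
    cp_tensor (\<lambda>i j. g i j / (d i * e j)) (mat p r (\<lambda>(a, i). sqrt (d i) * (A * U) $$ (a, i)))
      (mat q s (\<lambda>(a, j). sqrt (e j) * (B * V) $$ (a, j))) i1 i2 i3 i4"
proof -
  have "contract_mats (cp_tensor g U V) A A B B i1 i2 i3 i4 =
      contract_vecs (cp_tensor g U V) (row A i1) (row A i2) (row B i3) (row B i4)"
    using A B i by (simp add: contract_mats_def contract_vecs_def)
  also have "\<dots> = (\<Sum>i<r. \<Sum>j<s. g i j * ((row A i1 \<bullet> col U i) * (row A i2 \<bullet> col U i) *
      (row B i3 \<bullet> col V j) * (row B i4 \<bullet> col V j)))"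
    using A B i by (intro contract_vecs_cp_tensor[OF U V]) auto
  also have "\<dots> = (\<Sum>i<r. \<Sum>j<s. g i j / (d i * e j) *
      (sqrt (d i) * (row A i1 \<bullet> col U i) * (sqrt (d i) * (row A i2 \<bullet> col U i)) *
      (sqrt (e j) * (row B i3 \<bullet> col V j)) * (sqrt (e j) * (row B i4 \<bullet> col V j))))"
  proof (intro sum.cong refl)
    fix i j assume "i \<in> {..<r}" "j \<in> {..<s}"
    then have pos: "0 < d i" "0 < e j" using d e by auto
    define sd where "sd = sqrt (d i)"
    define se where "se = sqrt (e j)"
    have sq: "d i = sd * sd" "e j = se * se" "sd \<noteq> 0" "se \<noteq> 0" using pos by (auto simp: sd_def se_def)
    show "g i j * ((row A i1 \<bullet> col U i) * (row A i2 \<bullet> col U i) * (row B i3 \<bullet> col V j) * (row B i4 \<bullet> col V j)) =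
      g i j / (d i * e j) * (sqrt (d i) * (row A i1 \<bullet> col U i) * (sqrt (d i) * (row A i2 \<bullet> col U i)) *
      (sqrt (e j) * (row B i3 \<bullet> col V j)) * (sqrt (e j) * (row B i4 \<bullet> col V j)))"
      unfolding sd_def[symmetric] se_def[symmetric] sq(1,2) using sq(3,4) by (simp add: field_simps)
  qed
  also have "\<dots> = cp_tensor (\<lambda>i j. g i j / (d i * e j)) (mat p r (\<lambda>(a, i). sqrt (d i) * (A * U) $$ (a, i)))
      (mat q s (\<lambda>(a, j). sqrt (e j) * (B * V) $$ (a, j))) i1 i2 i3 i4"
    using A B U V i by (simp add: cp_tensor_def)
  finally show ?thesis .
qed

text \<open>Row i of the left inverse is orthogonal to all columns but the i-th, so the quadratic
  form at this row equals \<open>d i\<close>. Semidefiniteness makes it nonnegative; that it is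
  nonzero is the contribution of genericity.\<close>

lemma weights_pos_if_psd:
  assumes U: "U \<in> carrier_mat n r" and L: "L \<in> carrier_mat r n" and LU: "L * U = 1\<^sub>m r"
    and psd: "psd (weighted_outer U d)" and i: "i < r" and d0: "d i \<noteq> 0"
  shows "0 < d i"
proof -
  have x: "row L i \<in> carrier_vec n" using L i by simp
  have ux: "col U k \<bullet> row L i = (if k = i then 1 else 0)" if "k < r" for k
  proof -
    have "col U k \<bullet> row L i = (L * U) $$ (i, k)"
      using U L i that by (simp add: comm_scalar_prod[of "col U k" n])
    then show ?thesis using LU i that by auto
  qed
  have "0 \<le> row L i \<bullet> (weighted_outer U d *\<^sub>v row L i)"
    using psd x U unfolding psd_def by simp
  also have "\<dots> = (\<Sum>k<r. d k * (col U k \<bullet> row L i) * (col U k \<bullet> row L i))"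
    by (rule scalar_prod_weighted_outer[OF U x x])
  also have "\<dots> = (\<Sum>k<r. if k = i then d i else 0)"
    by (intro sum.cong) (auto simp: ux)
  also have "\<dots> = d i" using i by simp
  finally show ?thesis using d0 by simp
qed

text \<open>Whitening rescales the rows and columns of inner products by factors that depend on the
  slices used. The hypotheses \<open>rows\<close> and \<open>cols\<close> therefore speak of 2 by 2
  minors, whose nonvanishing survives any such rescaling.\<close>

lemma whitened_run_correct:
  assumes U: "U \<in> carrier_mat n r" "LU \<in> carrier_mat r n" "LU * U = 1\<^sub>m r"
    and V: "V \<in> carrier_mat n s" "LV \<in> carrier_mat s n" "LV * V = 1\<^sub>m s"
    and pos: "0 < r" "0 < s"
    and l: "\<And>i. i < r \<Longrightarrow> l $ i \<noteq> 0" and m: "\<And>j. j < s \<Longrightarrow> m $ j \<noteq> 0"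
    and uv: "\<And>i j. i < r \<Longrightarrow> j < s \<Longrightarrow> col U i \<bullet> col V j \<noteq> 0"
    and rows: "\<And>i i'. i < r \<Longrightarrow> i' < r \<Longrightarrow> i \<noteq> i' \<Longrightarrow> \<exists>j<s. \<exists>j'<s.
      (col U i \<bullet> col V j) * (col U i' \<bullet> col V j') \<noteq> (col U i \<bullet> col V j') * (col U i' \<bullet> col V j)"
    and cols: "\<And>j j'. j < s \<Longrightarrow> j' < s \<Longrightarrow> j \<noteq> j' \<Longrightarrow> \<exists>i<r. \<exists>i'<r.
      (col U i \<bullet> col V j) * (col U i' \<bullet> col V j') \<noteq> (col U i \<bullet> col V j') * (col U i' \<bullet> col V j)"
    and d: "\<And>i. i < r \<Longrightarrow> 0 < d i" and e: "\<And>j. j < s \<Longrightarrow> 0 < e j"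
    and WA: "whitens WA (weighted_outer U d)" and WB: "whitens WB (weighted_outer V e)"
  defines "p \<equiv> dim_row WA" and "q \<equiv> dim_row WB"
    and "T' \<equiv> contract_mats (train_tensor l m U V) WA WA WB WB"
    and "LA \<equiv> \<lambda>x. normalize_vec (pinv WA *\<^sub>v x)" and "LB \<equiv> \<lambda>x. normalize_vec (pinv WB *\<^sub>v x)"
  shows "generically (mat_pair_coords q p) (mat_pairs q p) (\<lambda>(\<alpha>, \<beta>).
            (\<exists>ubs vbs us vs lh mh. slice_core p q T' LA LB \<alpha> \<beta> ubs vbs us vs lh mh) \<and>
            (\<forall>ubs vbs us vs lh mh. slice_core p q T' LA LB \<alpha> \<beta> ubs vbs us vs lh mh \<longrightarrow>
               recovers l m U V us vs lh mh (\<lambda>i. vnorm (pinv WA *\<^sub>v (ubs ! i)))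
                                (\<lambda>j. vnorm (pinv WB *\<^sub>v (vbs ! j)))))"
proof -
  define h where "h = (\<lambda>i j. col U i \<bullet> col V j)"
  define Ub where "Ub = mat p r (\<lambda>(a, i). sqrt (d i) * (WA * U) $$ (a, i))"
  define Vb where "Vb = mat q s (\<lambda>(a, j). sqrt (e j) * (WB * V) $$ (a, j))"
  have wA: "WA \<in> carrier_mat p n" "orthonormal_cols Ub" "pinv WA \<in> carrier_mat n p"
    "\<And>i. i < r \<Longrightarrow> pinv WA *\<^sub>v col Ub i = sqrt (d i) \<cdot>\<^sub>v col U i"
    using whitens_weighted_outer[OF U d WA] unfolding p_def Ub_def by blast+
  have wB: "WB \<in> carrier_mat q n" "orthonormal_cols Vb" "pinv WB \<in> carrier_mat n q"
    "\<And>j. j < s \<Longrightarrow> pinv WB *\<^sub>v col Vb j = sqrt (e j) \<cdot>\<^sub>v col V j"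
    using whitens_weighted_outer[OF V e WB] unfolding q_def Vb_def by blast+
  have Ub: "Ub \<in> carrier_mat p r" "orthonormal_cols Ub" using wA(2) by (simp_all add: Ub_def)
  have Vb: "Vb \<in> carrier_mat q s" "orthonormal_cols Vb" using wB(2) by (simp_all add: Vb_def)
  have UL: "Ub\<^sup>T \<in> carrier_mat r p" "Ub\<^sup>T * Ub = 1\<^sub>m r" and VL: "Vb\<^sup>T \<in> carrier_mat s q" "Vb\<^sup>T * Vb = 1\<^sub>m s"
    using Ub Vb unfolding orthonormal_cols_def by auto
  have carU: "col U i \<in> carrier_vec n" if "i < r" for i using U that by simp
  have carV: "col V j \<in> carrier_vec n" if "j < s" for j using V that by simp
  have nU: "0 < vnorm (col U i)" if "i < r" for i
    using uv[OF that pos(2)] carU[OF that] carV[OF pos(2)] by (intro vnorm_pos[of _ n]) auto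
  have nV: "0 < vnorm (col V j)" if "j < s" for j
    using uv[OF pos(1) that] carV[OF that] carU[OF pos(1)] by (intro vnorm_pos[of _ n]) auto
  define g where "g = (\<lambda>i j. l $ i * m $ j * h i j / (d i * e j))"
  have S: "T' i1 i2 i3 i4 = cp_tensor g Ub Vb i1 i2 i3 i4"
    if "i1 < p" "i2 < p" "i3 < q" "i4 < q" for i1 i2 i3 i4
    unfolding T'_def train_tensor_eq_cp_tensor g_def h_def Ub_def Vb_def
    by (rule contract_mats_cp_tensor[OF U(1) V(1) wA(1) wB(1) d e that])
  have g0: "g i j \<noteq> 0" if "i < r" "j < s" for i j
    using l[OF that(1)] m[OF that(2)] uv[OF that] d[OF that(1)] e[OF that(2)] by (simp add: g_def h_def)
  \<comment> \<open>If two rows of \<open>g\<close> were equal, cancelling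
    \<open>m $ j / e j\<close> would make the corresponding rows of \<open>h\<close> parallel with
    nonzero factors \<open>t\<close> and \<open>t'\<close>, against the nonzero minor.\<close>
  have grow: "\<exists>j<s. g i j \<noteq> g i' j" if i: "i < r" "i' < r" "i \<noteq> i'" for i i'
  proof (rule ccontr)
    assume neg: "\<not> (\<exists>j<s. g i j \<noteq> g i' j)"
    have eq: "l $ i / d i * h i j = l $ i' / d i' * h i' j" if "j < s" for j
    proof -
      have "m $ j / e j * (l $ i / d i * h i j) = g i j" "m $ j / e j * (l $ i' / d i' * h i' j) = g i' j"
        by (simp_all add: g_def mult_ac)
      moreover have "g i j = g i' j" using neg that by simp
      moreover have "m $ j / e j \<noteq> 0" using m[OF that] e[OF that] by simp
      ultimately show ?thesis using mult_left_cancel[of "m $ j / e j" "l $ i / d i * h i j" "l $ i' / d i' * h i' j"] by argo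
    qed
    obtain j j' where j: "j < s" "j' < s" "h i j * h i' j' \<noteq> h i j' * h i' j"
      using rows[OF i] unfolding h_def by auto
    define t where "t = l $ i / d i"
    define t' where "t' = l $ i' / d i'"
    have t: "t \<noteq> 0" "t' \<noteq> 0" using l[OF i(1)] l[OF i(2)] d[OF i(1)] d[OF i(2)] by (auto simp: t_def t'_def)
    have eqs: "t * h i j = t' * h i' j" "t * h i j' = t' * h i' j'"
      using eq[OF j(1)] eq[OF j(2)] by (auto simp: t_def t'_def)
    have "t * t' * (h i j * h i' j') = (t * h i j) * (t' * h i' j')" by simp
    also have "\<dots> = (t' * h i' j) * (t * h i j')" using eqs by simp
    also have "\<dots> = t * t' * (h i j' * h i' j)" by simp
    finally show False using t j(3) by simp
  qed
  have gcol: "\<exists>i<r. g i j \<noteq> g i j'" if j: "j < s" "j' < s" "j \<noteq> j'" for j j'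
  proof (rule ccontr)
    assume neg: "\<not> (\<exists>i<r. g i j \<noteq> g i j')"
    have eq: "m $ j / e j * h i j = m $ j' / e j' * h i j'" if "i < r" for i
    proof -
      have "l $ i / d i * (m $ j / e j * h i j) = g i j" "l $ i / d i * (m $ j' / e j' * h i j') = g i j'"
        by (simp_all add: g_def mult_ac)
      moreover have "g i j = g i j'" using neg that by simp
      moreover have "l $ i / d i \<noteq> 0" using l[OF that] d[OF that] by simp
      ultimately show ?thesis using mult_left_cancel[of "l $ i / d i" "m $ j / e j * h i j" "m $ j' / e j' * h i j'"] by argo
    qed
    obtain i i' where i: "i < r" "i' < r" "h i j * h i' j' \<noteq> h i j' * h i' j"
      using cols[OF j] unfolding h_def by auto
    define t where "t = m $ j / e j"
    define t' where "t' = m $ j' / e j'"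
    have t: "t \<noteq> 0" "t' \<noteq> 0" using m[OF j(1)] m[OF j(2)] e[OF j(1)] e[OF j(2)] by (auto simp: t_def t'_def)
    have eqs: "t * h i j = t' * h i j'" "t * h i' j = t' * h i' j'"
      using eq[OF i(1)] eq[OF i(2)] by (auto simp: t_def t'_def)
    have "t * t' * (h i j * h i' j') = (t * h i j) * (t' * h i' j')" by simp
    also have "\<dots> = (t' * h i j') * (t * h i' j)" using eqs by simp
    also have "\<dots> = t * t' * (h i j' * h i' j)" by simp
    finally show False using t i(3) by simp
  qed
  define uh where "uh = (\<lambda>i. normalize_vec (col U i))"
  define vh where "vh = (\<lambda>j. normalize_vec (col V j))"
  \<comment> \<open>Normalizing \<open>u\<^sub>i\<close> moves its norm into the coefficient, and
    whitening divides by \<open>d i\<close>. The norm by which step 3 divides is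
    \<open>sqrt (d i)\<close> times the norm of \<open>u\<^sub>i\<close>, so its square times
    \<open>x i\<close> is \<open>l $ i\<close> times the cube of that norm.\<close>
  define x where "x = (\<lambda>i. l $ i * vnorm (col U i) / d i)"
  define y where "y = (\<lambda>j. m $ j * vnorm (col V j) / e j)"
  have uvh: "uh i \<bullet> vh j = h i j / (vnorm (col U i) * vnorm (col V j))" if "i < r" "j < s" for i j
    unfolding uh_def vh_def h_def by (rule scalar_prod_normalize_vec[OF carU[OF that(1)] carV[OF that(2)]])
  have gxy: "g i j = x i * y j * (uh i \<bullet> vh j)" if "i < r" "j < s" for i j
    using nU[OF that(1)] nV[OF that(2)] by (simp add: uvh[OF that] g_def x_def y_def field_simps)
  have x0: "x i \<noteq> 0" if "i < r" for i using l[OF that] nU[OF that] d[OF that] by (simp add: x_def)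
  have y0: "y j \<noteq> 0" if "j < s" for j using m[OF that] nV[OF that] e[OF that] by (simp add: y_def)
  have uvh0: "uh i \<bullet> vh j \<noteq> 0" if "i < r" "j < s" for i j
    using uv[OF that] nU[OF that(1)] nV[OF that(2)] by (simp add: uvh[OF that] h_def)
  have pA: "pinv WA *\<^sub>v (t \<cdot>\<^sub>v col Ub i) = (t * sqrt (d i)) \<cdot>\<^sub>v col U i" if "i < r" for i t
    using wA(3) wA(4)[OF that] Ub that by (simp add: mult_mat_vec smult_smult_assoc)
  have pB: "pinv WB *\<^sub>v (t \<cdot>\<^sub>v col Vb j) = (t * sqrt (e j)) \<cdot>\<^sub>v col V j" if "j < s" for j t
    using wB(3) wB(4)[OF that] Vb that by (simp add: mult_mat_vec smult_smult_assoc)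
  have LA: "LA (t \<cdot>\<^sub>v col Ub i) = t \<cdot>\<^sub>v uh i" if "i < r" "t \<in> {1, -1}" for i t
    unfolding LA_def pA[OF that(1)] normalize_vec_smult using d[OF that(1)] that(2)
    by (auto simp: uh_def sgn_mult)
  have LB: "LB (t \<cdot>\<^sub>v col Vb j) = t \<cdot>\<^sub>v vh j" if "j < s" "t \<in> {1, -1}" for j t
    unfolding LB_def pB[OF that(1)] normalize_vec_smult using e[OF that(1)] that(2)
    by (auto simp: vh_def sgn_mult)
  have "generically (mat_pair_coords q p) (mat_pairs q p) (\<lambda>x.
    ((\<forall>i\<in>{..<r}. (\<Sum>j<s. g i j * quad (fst x) (col Vb j)) \<noteq> 0) \<and>
     (\<forall>j\<in>{..<s}. (\<Sum>i<r. g i j * quad (snd x) (col Ub i)) \<noteq> 0)) \<and>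
    inj_on (\<lambda>i. \<Sum>j<s. g i j * quad (fst x) (col Vb j)) {..<r} \<and>
    inj_on (\<lambda>j. \<Sum>i<r. g i j * quad (snd x) (col Ub i)) {..<s})"
    using g0 pos
    by (intro generically_conj[OF generically_slice_weights_nonzero[OF Ub(1) UL Vb(1) VL]
          generically_slice_weights_inj[OF Ub(1) UL Vb(1) VL]] grow gcol) blast+
  then show ?thesis
  proof (rule generically_mono)
    fix z :: "real mat \<times> real mat"
    obtain \<alpha> \<beta> where z: "z = (\<alpha>, \<beta>)" by (cases z)
    assume "((\<forall>i\<in>{..<r}. (\<Sum>j<s. g i j * quad (fst z) (col Vb j)) \<noteq> 0) \<and>
     (\<forall>j\<in>{..<s}. (\<Sum>i<r. g i j * quad (snd z) (col Ub i)) \<noteq> 0)) \<and>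
    inj_on (\<lambda>i. \<Sum>j<s. g i j * quad (fst z) (col Vb j)) {..<r} \<and>
    inj_on (\<lambda>j. \<Sum>i<r. g i j * quad (snd z) (col Ub i)) {..<s}"
    then have gen: "\<And>i. i < r \<Longrightarrow> (\<Sum>j<s. g i j * quad \<alpha> (col Vb j)) \<noteq> 0"
      "inj_on (\<lambda>i. \<Sum>j<s. g i j * quad \<alpha> (col Vb j)) {..<r}"
      "\<And>j. j < s \<Longrightarrow> (\<Sum>i<r. g i j * quad \<beta> (col Ub i)) \<noteq> 0"
      "inj_on (\<lambda>j. \<Sum>i<r. g i j * quad \<beta> (col Ub i)) {..<s}"
      by (auto simp: z)
    have uhc: "uh i \<in> carrier_vec n" if "i < r" for i using carU[OF that] by (simp add: uh_def)
    have vhc: "vh j \<in> carrier_vec n" if "j < s" for j using carV[OF that] by (simp add: vh_def)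
    note rule = slice_core_correct[where S = T' and g = g and x = x and y = y and uh = uh and vh = vh
        and LA = LA and LB = LB and n = n]
    have ex: "\<exists>ubs vbs us vs lh mh. slice_core p q T' LA LB \<alpha> \<beta> ubs vbs us vs lh mh"
      by (rule rule(1)) (fact Ub Vb pos S gxy x0 y0 uvh0 uhc vhc LA LB gen)+
    have "recovers l m U V us vs lh mh (\<lambda>i. vnorm (pinv WA *\<^sub>v (ubs ! i))) (\<lambda>j. vnorm (pinv WB *\<^sub>v (vbs ! j)))"
      if run: "slice_core p q T' LA LB \<alpha> \<beta> ubs vbs us vs lh mh" for ubs vbs us vs lh mh
    proof -
      obtain c where c: "vnorm mh = 1" "c \<noteq> 0" "matches r Ub uh x c ubs us lh"
        "matches s Vb vh y (1 / c) vbs vs mh"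
      proof -
        have "vnorm mh = 1 \<and> (\<exists>c. c \<noteq> 0 \<and> matches r Ub uh x c ubs us lh \<and>
            matches s Vb vh y (1 / c) vbs vs mh)"
          by (rule rule(2)) (fact Ub Vb pos S gxy x0 y0 uvh0 uhc vhc LA LB gen run)+
        then show ?thesis using that by blast
      qed
      have "recovers_carriage l U c us lh (\<lambda>i. vnorm (pinv WA *\<^sub>v (ubs ! i)))"
      proof (rule matches_imp_recovers_carriage[OF c(3)])
        fix i k and t :: real assume i: "i < r" and t: "t \<in> {1, -1}" and "ubs ! k = t \<cdot>\<^sub>v col Ub i"
        then have "(vnorm (pinv WA *\<^sub>v (ubs ! k)))\<^sup>2 = d i * (vnorm (col U i))\<^sup>2"
          using d[OF i] t by (auto simp: pA vnorm_smult power_mult_distrib)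
        then show "(vnorm (pinv WA *\<^sub>v (ubs ! k)))\<^sup>2 * x i = vnorm (col U i) ^ 3 * l $ i"
          using d[OF i] by (simp add: x_def power2_eq_square power3_eq_cube)
      qed (use U in \<open>simp_all add: uh_def\<close>)
      moreover have "recovers_carriage m V (1 / c) vs mh (\<lambda>j. vnorm (pinv WB *\<^sub>v (vbs ! j)))"
      proof (rule matches_imp_recovers_carriage[OF c(4)])
        fix i k and t :: real assume i: "i < s" and t: "t \<in> {1, -1}" and "vbs ! k = t \<cdot>\<^sub>v col Vb i"
        then have "(vnorm (pinv WB *\<^sub>v (vbs ! k)))\<^sup>2 = e i * (vnorm (col V i))\<^sup>2"
          using e[OF i] t by (auto simp: pB vnorm_smult power_mult_distrib)
        then show "(vnorm (pinv WB *\<^sub>v (vbs ! k)))\<^sup>2 * y i = vnorm (col V i) ^ 3 * m $ i"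
          using e[OF i] by (simp add: y_def power2_eq_square power3_eq_cube)
      qed (use V in \<open>simp_all add: vh_def\<close>)
      ultimately show ?thesis unfolding recovers_def using c(1,2) by (intro conjI exI[of _ c])
    qed
    then show "case z of (\<alpha>, \<beta>) \<Rightarrow>
            (\<exists>ubs vbs us vs lh mh. slice_core p q T' LA LB \<alpha> \<beta> ubs vbs us vs lh mh) \<and>
            (\<forall>ubs vbs us vs lh mh. slice_core p q T' LA LB \<alpha> \<beta> ubs vbs us vs lh mh \<longrightarrow>
               recovers l m U V us vs lh mh (\<lambda>i. vnorm (pinv WA *\<^sub>v (ubs ! i)))
                                (\<lambda>j. vnorm (pinv WB *\<^sub>v (vbs ! j))))"
      unfolding z using ex by simp
  qed
qed

text \<open>The outer genericity makes the weights of the two slices nonzero and semidefiniteness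
  makes them positive; the inner genericity is that of a run on the whitened tensor.\<close>

lemma slice_whitened_correct:
  assumes U: "U \<in> carrier_mat n r" "LU \<in> carrier_mat r n" "LU * U = 1\<^sub>m r"
    and V: "V \<in> carrier_mat n s" "LV \<in> carrier_mat s n" "LV * V = 1\<^sub>m s"
    and pos: "0 < r" "0 < s"
    and l: "\<And>i. i < r \<Longrightarrow> l $ i \<noteq> 0" and m: "\<And>j. j < s \<Longrightarrow> m $ j \<noteq> 0"
    and uv: "\<And>i j. i < r \<Longrightarrow> j < s \<Longrightarrow> col U i \<bullet> col V j \<noteq> 0"
    and rows: "\<And>i i'. i < r \<Longrightarrow> i' < r \<Longrightarrow> i \<noteq> i' \<Longrightarrow> \<exists>j<s. \<exists>j'<s.
      (col U i \<bullet> col V j) * (col U i' \<bullet> col V j') \<noteq> (col U i \<bullet> col V j') * (col U i' \<bullet> col V j)"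
    and cols: "\<And>j j'. j < s \<Longrightarrow> j' < s \<Longrightarrow> j \<noteq> j' \<Longrightarrow> \<exists>i<r. \<exists>i'<r.
      (col U i \<bullet> col V j) * (col U i' \<bullet> col V j') \<noteq> (col U i \<bullet> col V j') * (col U i' \<bullet> col V j)"
  shows "slice_whitened n (train_tensor l m U V) (recovers l m U V)"
proof -
  define g where "g = (\<lambda>i j. l $ i * m $ j * (col U i \<bullet> col V j))"
  have T: "train_tensor l m U V = cp_tensor g U V" unfolding train_tensor_eq_cp_tensor g_def ..
  have g0: "g i j \<noteq> 0" if "i < r" "j < s" for i j using that l m uv by (simp add: g_def)
  have "generically (mat_pair_coords n n) (mat_pairs n n) (\<lambda>x.
    (\<forall>i\<in>{..<r}. (\<Sum>j<s. g i j * quad (fst x) (col V j)) \<noteq> 0) \<and>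
    (\<forall>j\<in>{..<s}. (\<Sum>i<r. g i j * quad (snd x) (col U i)) \<noteq> 0))"
    using g0 pos by (intro generically_slice_weights_nonzero[OF U V]) blast+
  then show ?thesis
    unfolding slice_whitened_def
  proof (rule generically_mono, unfold split_beta Let_def, intro impI)
    fix x :: "real mat \<times> real mat"
    define d where "d = (\<lambda>i. \<Sum>j<s. g i j * quad (fst x) (col V j))"
    define e where "e = (\<lambda>j. \<Sum>i<r. g i j * quad (snd x) (col U i))"
    assume "(\<forall>i\<in>{..<r}. (\<Sum>j<s. g i j * quad (fst x) (col V j)) \<noteq> 0) \<and>
      (\<forall>j\<in>{..<s}. (\<Sum>i<r. g i j * quad (snd x) (col U i)) \<noteq> 0)"
    then have nz: "\<And>i. i < r \<Longrightarrow> d i \<noteq> 0" "\<And>j. j < s \<Longrightarrow> e j \<noteq> 0" by (auto simp: d_def e_def)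
    have CA: "slice_A n n (fst x) (train_tensor l m U V) = weighted_outer U d"
      unfolding T d_def by (rule slice_A_cp_tensor[OF U(1) V(1) refl])
    have CB: "slice_B n n (snd x) (train_tensor l m U V) = weighted_outer V e"
      unfolding T e_def by (rule slice_B_cp_tensor[OF U(1) V(1) refl])
    assume "psd (slice_A n n (fst x) (train_tensor l m U V)) \<and> psd (slice_B n n (snd x) (train_tensor l m U V))"
    then have psd: "psd (weighted_outer U d)" "psd (weighted_outer V e)" unfolding CA CB by auto
    have d: "0 < d i" if "i < r" for i by (rule weights_pos_if_psd[OF U psd(1) that nz(1)[OF that]])
    have e: "0 < e j" if "j < s" for j by (rule weights_pos_if_psd[OF V psd(2) that nz(2)[OF that]])
    have ex: "\<exists>W. whitens W (weighted_outer M c)" if "M \<in> carrier_mat n k" for M k c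
      using ex_skinny_eigendecomposition[OF weighted_outer_carrier[OF that] transpose_weighted_outer]
      unfolding whitens_def by blast
    show "(\<exists>WA. whitens WA (slice_A n n (fst x) (train_tensor l m U V))) \<and>
       (\<exists>WB. whitens WB (slice_B n n (snd x) (train_tensor l m U V))) \<and>
       (\<forall>WA WB. whitens WA (slice_A n n (fst x) (train_tensor l m U V)) \<and>
           whitens WB (slice_B n n (snd x) (train_tensor l m U V)) \<longrightarrow>
         generically (mat_pair_coords (dim_row WB) (dim_row WA)) (mat_pairs (dim_row WB) (dim_row WA)) (\<lambda>z.
            (\<exists>ubs vbs us vs lh mh. slice_core (dim_row WA) (dim_row WB)
               (contract_mats (train_tensor l m U V) WA WA WB WB)
               (\<lambda>x. normalize_vec (pinv WA *\<^sub>v x)) (\<lambda>x. normalize_vec (pinv WB *\<^sub>v x)) (fst z) (snd z)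
               ubs vbs us vs lh mh) \<and>
            (\<forall>ubs vbs us vs lh mh. slice_core (dim_row WA) (dim_row WB)
               (contract_mats (train_tensor l m U V) WA WA WB WB)
               (\<lambda>x. normalize_vec (pinv WA *\<^sub>v x)) (\<lambda>x. normalize_vec (pinv WB *\<^sub>v x)) (fst z) (snd z)
               ubs vbs us vs lh mh \<longrightarrow>
               recovers l m U V us vs lh mh (\<lambda>i. vnorm (pinv WA *\<^sub>v (ubs ! i)))
                                (\<lambda>j. vnorm (pinv WB *\<^sub>v (vbs ! j))))))"
      unfolding CA CB
    proof (intro conjI allI impI ex[OF U(1)] ex[OF V(1)], elim conjE)
      fix WA WB assume WA: "whitens WA (weighted_outer U d)" and WB: "whitens WB (weighted_outer V e)"
      show "generically (mat_pair_coords (dim_row WB) (dim_row WA)) (mat_pairs (dim_row WB) (dim_row WA)) (\<lambda>z.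
            (\<exists>ubs vbs us vs lh mh. slice_core (dim_row WA) (dim_row WB)
               (contract_mats (train_tensor l m U V) WA WA WB WB)
               (\<lambda>x. normalize_vec (pinv WA *\<^sub>v x)) (\<lambda>x. normalize_vec (pinv WB *\<^sub>v x)) (fst z) (snd z)
               ubs vbs us vs lh mh) \<and>
            (\<forall>ubs vbs us vs lh mh. slice_core (dim_row WA) (dim_row WB)
               (contract_mats (train_tensor l m U V) WA WA WB WB)
               (\<lambda>x. normalize_vec (pinv WA *\<^sub>v x)) (\<lambda>x. normalize_vec (pinv WB *\<^sub>v x)) (fst z) (snd z)
               ubs vbs us vs lh mh \<longrightarrow>
               recovers l m U V us vs lh mh (\<lambda>i. vnorm (pinv WA *\<^sub>v (ubs ! i)))
                                (\<lambda>j. vnorm (pinv WB *\<^sub>v (vbs ! j)))))"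
        by (rule whitened_run_correct[OF U V pos, unfolded split_beta])
          (fact l m uv rows cols d e WA WB)+
    qed
  qed
qed

section \<open>Generic tensor trains\<close>

lemma poly_funs_det:
  assumes "\<And>i j. i < r \<Longrightarrow> j < r \<Longrightarrow> (\<lambda>x. f x i j) \<in> poly_funs C"
  shows "(\<lambda>x. det (mat r r (\<lambda>(i, j). f x i j))) \<in> poly_funs C"
proof -
  have "(\<lambda>x. \<Sum>p\<in>{p. p permutes {0..<r}}. signof p * (\<Prod>i\<in>{0..<r}. f x i (p i))) \<in> poly_funs C"
  proof (intro poly_funs_sum poly_funs.mult poly_funs.const poly_funs_prod assms)
    fix p i assume "p \<in> {p. p permutes {0..<r}}" "i \<in> {0..<r}"
    then show "i < r" "p i < r" using permutes_in_image[of p "{0..<r}" i] by auto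
  qed (auto intro: finite_permutations)
  moreover have "det (mat r r (\<lambda>(i, j). f x i j)) =
      (\<Sum>p\<in>{p. p permutes {0..<r}}. signof p * (\<Prod>i\<in>{0..<r}. f x i (p i)))" for x
  proof -
    have "(\<Prod>i = 0..<r. mat r r (\<lambda>(i, j). f x i j) $$ (i, p i)) = (\<Prod>i\<in>{0..<r}. f x i (p i))"
      if "p permutes {0..<r}" for p
      using permutes_in_image[OF that] by (intro prod.cong) auto
    then show ?thesis by (subst det_def'[of _ r]) (auto intro!: sum.cong)
  qed
  ultimately show ?thesis by simp
qed

lemma poly_funs_train:
  "i < rA \<Longrightarrow> (\<lambda>(l, m, U, V). l $ i) \<in> poly_funs (train_coords n rA rB)"
  "j < rB \<Longrightarrow> (\<lambda>(l, m, U, V). m $ j) \<in> poly_funs (train_coords n rA rB)"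
  "k < n \<Longrightarrow> i < rA \<Longrightarrow> (\<lambda>(l, m, U, V). U $$ (k, i)) \<in> poly_funs (train_coords n rA rB)"
  "k < n \<Longrightarrow> j < rB \<Longrightarrow> (\<lambda>(l, m, U, V). V $$ (k, j)) \<in> poly_funs (train_coords n rA rB)"
  unfolding train_coords_def by (intro poly_funs.coord, auto)+

text \<open>The sum runs over a fixed \<open>n\<close> and not over a dimension of the matrices, so
  that it is a polynomial in the coordinates at every point, even one with components of the wrong
  size.\<close>

definition train_ip :: "nat \<Rightarrow> nat \<Rightarrow> nat \<Rightarrow> train \<Rightarrow> real" where
  "train_ip n i j = (\<lambda>(l, m, U, V). \<Sum>k<n. U $$ (k, i) * V $$ (k, j))"

text \<open>The Gram determinant expresses linear independence of real columns by one polynomial;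
  the sizes are explicit for the same reason as in \<open>train_ip\<close>.\<close>

definition gram_det :: "nat \<Rightarrow> nat \<Rightarrow> real mat \<Rightarrow> real" where
  "gram_det n r U = det (mat r r (\<lambda>(i, j). \<Sum>k<n. U $$ (k, i) * U $$ (k, j)))"

lemma poly_funs_train_ip:
  assumes "i < rA" "j < rB"
  shows "train_ip n i j \<in> poly_funs (train_coords n rA rB)"
  unfolding train_ip_def case_prod_beta' using assms
  by (intro poly_funs_sum poly_funs.mult poly_funs_train[unfolded case_prod_beta']) auto

lemma poly_funs_gram_det:
  assumes "\<And>k i. k < n \<Longrightarrow> i < r \<Longrightarrow> (\<lambda>x. M x $$ (k, i)) \<in> poly_funs C"
  shows "(\<lambda>x. gram_det n r (M x)) \<in> poly_funs C"
  unfolding gram_det_def using assms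
  by (intro poly_funs_det poly_funs_sum poly_funs.mult) auto

lemma train_ip_eq:
  assumes "U \<in> carrier_mat n rA" "V \<in> carrier_mat n rB" "i < rA" "j < rB"
  shows "train_ip n i j (l, m, U, V) = col U i \<bullet> col V j"
  using assms by (simp add: train_ip_def scalar_prod_lessThan)

lemma gram_det_eq: "U \<in> carrier_mat n r \<Longrightarrow> gram_det n r U = det (U\<^sup>T * U)"
  unfolding gram_det_def
  by (rule arg_cong[of _ _ det]) (auto simp: scalar_prod_lessThan intro!: eq_matI)

text \<open>The witness is the inverse of \<open>U\<^sup>T * U\<close> times
  \<open>U\<^sup>T\<close>.\<close>

lemma ex_left_inverse_if_gram_det:
  assumes U: "U \<in> carrier_mat n r" and nz: "gram_det n r U \<noteq> 0"
  obtains L where "L \<in> carrier_mat r n" "L * U = 1\<^sub>m r"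
proof -
  have UT: "U\<^sup>T \<in> carrier_mat r n" using U by simp
  have G: "U\<^sup>T * U \<in> carrier_mat r r" using U by simp
  have "U\<^sup>T * U \<in> Units (ring_mat TYPE(real) r ())"
    using det_non_zero_imp_unit[OF G] nz gram_det_eq[OF U] by simp
  then obtain B where B: "B \<in> carrier_mat r r" "B * (U\<^sup>T * U) = 1\<^sub>m r"
    unfolding Units_def ring_mat_def by auto
  then have "B * U\<^sup>T * U = 1\<^sub>m r" using assoc_mult_mat[OF B(1) UT U] by simp
  then show thesis using that[of "B * U\<^sup>T"] mult_carrier_mat[OF B(1) UT] by blast
qed

section \<open>Genericity for arbitrary vectors and for unit vectors\<close>

definition unit_scaled :: "real mat \<Rightarrow> real mat" where
  "unit_scaled U = mat (dim_row U) (dim_col U) (\<lambda>(k, i). U $$ (k, i) / vnorm (col U i))"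

lemma unit_scaled_carrier [simp]: "U \<in> carrier_mat n r \<Longrightarrow> unit_scaled U \<in> carrier_mat n r"
  by (simp add: unit_scaled_def)

lemma col_unit_scaled: "i < dim_col U \<Longrightarrow> col (unit_scaled U) i = normalize_vec (col U i)"
  by (intro eq_vecI) (auto simp: unit_scaled_def normalize_vec_def)

lemma unit_cols_unit_scaled:
  assumes "\<And>i. i < dim_col U \<Longrightarrow> vnorm (col U i) \<noteq> 0"
  shows "unit_cols (unit_scaled U)"
  unfolding unit_cols_def
proof (intro allI impI)
  fix i assume "i < dim_col (unit_scaled U)"
  then have i: "i < dim_col U" by (simp add: unit_scaled_def)
  have "0 \<le> vnorm (col U i)" by (simp add: vnorm_def scalar_prod_self_nonneg)
  then show "vnorm (col (unit_scaled U) i) = 1"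
    unfolding col_unit_scaled[OF i] using assms[OF i]
    by (simp add: normalize_vec_def vnorm_smult)
qed

text \<open>Scaling the columns multiplies the Gram matrix on both sides by the diagonal matrix of
  the norms.\<close>

lemma gram_det_unit_scaled:
  assumes U: "U \<in> carrier_mat n r" and nz: "\<And>i. i < r \<Longrightarrow> vnorm (col U i) \<noteq> 0"
    and det: "gram_det n r U \<noteq> 0"
  shows "gram_det n r (unit_scaled U) \<noteq> 0"
proof -
  let ?N = "mat_diag r (\<lambda>i. vnorm (col U i))" and ?G = "(unit_scaled U)\<^sup>T * unit_scaled U"
  have G: "?G \<in> carrier_mat r r" using unit_scaled_carrier[OF U] by auto
  have S: "unit_scaled U \<in> carrier_mat n r" by (rule unit_scaled_carrier[OF U])
  have UN: "U = unit_scaled U * ?N"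
    unfolding mat_diag_mult_right[OF S] using U nz by (intro eq_matI) (auto simp: unit_scaled_def)
  have NT: "?N\<^sup>T = ?N" by (auto simp: mat_diag_def intro!: eq_matI)
  have "gram_det n r U = det ((unit_scaled U * ?N)\<^sup>T * (unit_scaled U * ?N))"
    unfolding gram_det_eq[OF U] UN[symmetric] ..
  also have "(unit_scaled U * ?N)\<^sup>T * (unit_scaled U * ?N) = ?N * (unit_scaled U)\<^sup>T * (unit_scaled U * ?N)"
    unfolding transpose_mult[OF S mat_diag_dim] NT ..
  also have "\<dots> = ?N * ((unit_scaled U)\<^sup>T * (unit_scaled U * ?N))"
    using S by (intro assoc_mult_mat[of _ r r _ n _ r] mult_carrier_mat[OF S mat_diag_dim]) auto
  also have "(unit_scaled U)\<^sup>T * (unit_scaled U * ?N) = ?G * ?N"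
    using S by (intro assoc_mult_mat[symmetric, of _ r n _ r _ r]) auto
  also have "det (?N * (?G * ?N)) = det ?N * (det ?G * det ?N)"
    using G by (simp add: det_mult[of _ r])
  finally show ?thesis using det unfolding gram_det_eq[OF S] by auto
qed

text \<open>Every component is rebuilt with the prescribed dimensions, so the line consists of
  trains whatever its end points are, and an end point may have \<open>undefined\<close>
  components.\<close>

definition train_line :: "nat \<Rightarrow> nat \<Rightarrow> nat \<Rightarrow> train \<Rightarrow> train \<Rightarrow> real \<Rightarrow> train" where
  "train_line n rA rB = (\<lambda>(l0, m0, U0, V0) (l1, m1, U1, V1) t.
     (vec rA (\<lambda>i. (1 - t) * l0 $ i + t * l1 $ i), vec rB (\<lambda>j. (1 - t) * m0 $ j + t * m1 $ j),
      mat n rA (\<lambda>ki. (1 - t) * U0 $$ ki + t * U1 $$ ki), mat n rB (\<lambda>kj. (1 - t) * V0 $$ kj + t * V1 $$ kj)))"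

lemma train_line_coords:
  "c \<in> train_coords n rA rB \<Longrightarrow> c (train_line n rA rB x0 x1 t) = (1 - t) * c x0 + t * c x1"
  unfolding train_coords_def train_line_def by (auto split: prod.splits)

lemma train_line_in_trains: "train_line n rA rB x0 x1 t \<in> trains n rA rB (\<lambda>_. True)"
  unfolding trains_def train_line_def by (auto split: prod.splits)

text \<open>Unit columns are reached by normalizing the points of a line, so that on both varieties it is
  enough to find a single point where a condition that is invariant under scaling of the columns holds.\<close>

lemma generically_trains_if_scale_invariant:
  assumes p: "p \<in> poly_funs (train_coords n rA rB)"
    and x1: "p x1 \<noteq> 0"
    and scale: "\<And>l m U V. U \<in> carrier_mat n rA \<Longrightarrow> V \<in> carrier_mat n rB \<Longrightarrow>
      (\<And>i. i < rA \<Longrightarrow> vnorm (col U i) \<noteq> 0) \<Longrightarrow> (\<And>j. j < rB \<Longrightarrow> vnorm (col V j) \<noteq> 0) \<Longrightarrow>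
      p (l, m, U, V) \<noteq> 0 \<Longrightarrow> p (l, m, unit_scaled U, unit_scaled V) \<noteq> 0"
    and F: "F \<in> {unit_cols, \<lambda>_. True}"
  shows "generically (train_coords n rA rB) (trains n rA rB F) (\<lambda>x. p x \<noteq> 0)"
proof -
  consider "F = (\<lambda>_. True)" | "F = unit_cols" using F by blast
  then show ?thesis
  proof cases
    case 1
    show ?thesis unfolding 1
      using x1 train_line_in_trains train_line_coords
      by (intro generically_nonzero_if_lines[OF p generically_True] exI[of _ x1]
          exI[of _ "train_line n rA rB x0 x1" for x0]) blast
  next
    case 2
    show ?thesis unfolding 2
    proof (rule generically_nonzero_if_curves[OF p generically_True])
      fix x0 :: train assume "x0 \<in> trains n rA rB unit_cols"
      then obtain l0 m0 U0 V0 where x0: "x0 = (l0, m0, U0, V0)" and U0: "U0 \<in> carrier_mat n rA" "unit_cols U0"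
        and V0: "V0 \<in> carrier_mat n rB" "unit_cols V0" unfolding trains_def by blast
      obtain l1 m1 U1 V1 where x1': "x1 = (l1, m1, U1, V1)" by (cases x1)
      define l where "l = (\<lambda>t. vec rA (\<lambda>i. (1 - t) * l0 $ i + t * l1 $ i))"
      define m where "m = (\<lambda>t. vec rB (\<lambda>j. (1 - t) * m0 $ j + t * m1 $ j))"
      define U where "U = (\<lambda>t. mat n rA (\<lambda>ki. (1 - t) * U0 $$ ki + t * U1 $$ ki))"
      define V where "V = (\<lambda>t. mat n rB (\<lambda>kj. (1 - t) * V0 $$ kj + t * V1 $$ kj))"
      have line: "train_line n rA rB x0 x1 t = (l t, m t, U t, V t)" for t
        by (simp add: train_line_def x0 x1' l_def m_def U_def V_def)
      define \<gamma> where "\<gamma> = (\<lambda>t. (l t, m t, unit_scaled (U t), unit_scaled (V t)))"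
      have car: "U t \<in> carrier_mat n rA" "V t \<in> carrier_mat n rB" for t by (simp_all add: U_def V_def)
      have lim: "((\<lambda>t. (1 - t) * a + t * b) \<longlongrightarrow> a) (at_right (0::real))" for a b :: real
      proof -
        have "((\<lambda>t. (1 - t) * a + t * b) \<longlongrightarrow> (1 - 0) * a + 0 * b) (at_right (0::real))"
          by (intro tendsto_intros)
        then show ?thesis by simp
      qed
      \<comment> \<open>The line starts at unit columns, so the norms tend to 1 and the
        normalization is defined near t = 0, although columns may vanish further along.\<close>
      have norm_lim: "((\<lambda>t. vnorm (col (mat n r (\<lambda>ki. (1 - t) * M0 $$ ki + t * M1 $$ ki)) i)) \<longlongrightarrow> 1) (at_right (0::real))"
        if "M0 \<in> carrier_mat n r" "unit_cols M0" "i < r" for M0 M1 r i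
      proof -
        have "((\<lambda>t. sqrt (\<Sum>k<n. ((1 - t) * M0 $$ (k, i) + t * M1 $$ (k, i)) * ((1 - t) * M0 $$ (k, i) + t * M1 $$ (k, i))))
            \<longlongrightarrow> sqrt (\<Sum>k<n. M0 $$ (k, i) * M0 $$ (k, i))) (at_right 0)"
          by (intro tendsto_real_sqrt tendsto_sum tendsto_mult lim)
        moreover have "sqrt (\<Sum>k<n. M0 $$ (k, i) * M0 $$ (k, i)) = 1"
          using that unfolding unit_cols_def vnorm_def by (simp add: scalar_prod_lessThan)
        ultimately show ?thesis using that by (simp add: vnorm_def scalar_prod_lessThan)
      qed
      have evU: "\<forall>\<^sub>F t in at_right 0. \<forall>i\<in>{..<rA}. vnorm (col (U t) i) \<noteq> 0"
      proof (intro eventually_ball_finite ballI)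
        fix i assume "i \<in> {..<rA}"
        then show "\<forall>\<^sub>F t in at_right 0. vnorm (col (U t) i) \<noteq> 0"
          unfolding U_def by (intro tendsto_imp_eventually_ne[OF norm_lim[OF U0]]) auto
      qed simp
      have evV: "\<forall>\<^sub>F t in at_right 0. \<forall>j\<in>{..<rB}. vnorm (col (V t) j) \<noteq> 0"
      proof (intro eventually_ball_finite ballI)
        fix j assume "j \<in> {..<rB}"
        then show "\<forall>\<^sub>F t in at_right 0. vnorm (col (V t) j) \<noteq> 0"
          unfolding V_def by (intro tendsto_imp_eventually_ne[OF norm_lim[OF V0]]) auto
      qed simp
      \<comment> \<open>Roots are counted on the line itself, where \<open>p\<close> is polynomial
        in t; scale invariance carries the result to the normalized curve, where it need not
        be.\<close>
      have "\<forall>\<^sub>F t in at_right 0. p (l t, m t, U t, V t) \<noteq> 0"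
        unfolding line[symmetric] using train_line_coords by (intro eventually_nonzero_on_line[OF p x1]) blast
      with evU evV have "\<forall>\<^sub>F t in at_right 0. \<gamma> t \<in> trains n rA rB unit_cols \<and> p (\<gamma> t) \<noteq> 0"
      proof eventually_elim
        case (elim t)
        then have nz: "\<And>i. i < rA \<Longrightarrow> vnorm (col (U t) i) \<noteq> 0" "\<And>j. j < rB \<Longrightarrow> vnorm (col (V t) j) \<noteq> 0"
          by auto
        have "unit_cols (unit_scaled (U t))" "unit_cols (unit_scaled (V t))"
          using nz car[of t] by (auto intro!: unit_cols_unit_scaled)
        moreover have "p (l t, m t, unit_scaled (U t), unit_scaled (V t)) \<noteq> 0"
          by (rule scale[OF car nz elim(3)])
        ultimately show ?case
          unfolding \<gamma>_def trains_def using car[of t] by (auto simp: l_def m_def)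
      qed
      moreover have "((\<lambda>t. c (\<gamma> t)) \<longlongrightarrow> c x0) (at_right 0)" if c: "c \<in> train_coords n rA rB" for c
      proof -
        have entry: "((\<lambda>t. unit_scaled (mat n r (\<lambda>ki. (1 - t) * M0 $$ ki + t * M1 $$ ki)) $$ (k, i))
            \<longlongrightarrow> M0 $$ (k, i)) (at_right 0)"
          if "M0 \<in> carrier_mat n r" "unit_cols M0" "k < n" "i < r" for M0 M1 r k i
        proof -
          have "((\<lambda>t. ((1 - t) * M0 $$ (k, i) + t * M1 $$ (k, i)) /
              vnorm (col (mat n r (\<lambda>ki. (1 - t) * M0 $$ ki + t * M1 $$ ki)) i)) \<longlongrightarrow> M0 $$ (k, i) / 1) (at_right 0)"
            using that by (intro tendsto_divide lim norm_lim) auto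
          then show ?thesis using that by (simp add: unit_scaled_def)
        qed
        show ?thesis
          using c unfolding train_coords_def \<gamma>_def x0
          by (auto simp: l_def m_def U_def V_def intro!: lim entry U0 V0)
      qed
      ultimately show "\<exists>\<gamma>. (\<forall>\<^sub>F t in at_right (0::real). \<gamma> t \<in> trains n rA rB unit_cols \<and> p (\<gamma> t) \<noteq> 0) \<and>
          (\<forall>c\<in>train_coords n rA rB. ((\<lambda>t. c (\<gamma> t)) \<longlongrightarrow> c x0) (at_right 0))"
        by (intro exI[of _ \<gamma>] conjI ballI)
    qed
  qed
qed

lemma train_ip_unit_scaled:
  assumes "U \<in> carrier_mat n rA" "V \<in> carrier_mat n rB" "i < rA" "j < rB"
  shows "train_ip n i j (l, m, unit_scaled U, unit_scaled V) =
    train_ip n i j (l, m, U, V) / (vnorm (col U i) * vnorm (col V j))"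
proof -
  have "col U i \<in> carrier_vec n" "col V j \<in> carrier_vec n" using assms by auto
  then show ?thesis
    using assms by (simp add: train_ip_eq[of _ n rA _ rB] col_unit_scaled
        scalar_prod_normalize_vec[of "col U i" n "col V j"])
qed

text \<open>A finite conjunction of nonvanishing polynomials, each insensitive to scaling of the
  columns. The minors say that no two rows and no two columns of inner products are parallel, as
  long as both ranks are at least 2.\<close>

definition nondegenerate :: "nat \<Rightarrow> nat \<Rightarrow> nat \<Rightarrow> train \<Rightarrow> bool" where
  "nondegenerate n rA rB x \<longleftrightarrow>
     (\<forall>i\<in>{..<rA}. fst x $ i \<noteq> 0) \<and> (\<forall>j\<in>{..<rB}. fst (snd x) $ j \<noteq> 0) \<and>
     (\<forall>(i, j)\<in>{..<rA} \<times> {..<rB}. train_ip n i j x \<noteq> 0) \<and>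
     (\<forall>(i, i', j, j')\<in>{(i, i', j, j'). i < rA \<and> i' < rA \<and> j < rB \<and> j' < rB \<and> i \<noteq> i' \<and> j \<noteq> j'}.
        train_ip n i j x * train_ip n i' j' x - train_ip n i j' x * train_ip n i' j x \<noteq> 0) \<and>
     gram_det n rA (fst (snd (snd x))) \<noteq> 0 \<and> gram_det n rB (snd (snd (snd x))) \<noteq> 0"

lemma generically_nondegenerate:
  assumes n: "1 \<le> rA" "rA \<le> n" "rB \<le> n" and F: "F \<in> {unit_cols, \<lambda>_. True}"
  shows "generically (train_coords n rA rB) (trains n rA rB F) (nondegenerate n rA rB)"
  unfolding nondegenerate_def
proof (intro generically_conj generically_ball)
  let ?C = "train_coords n rA rB"
  fix i assume "i \<in> {..<rA}"
  \<comment> \<open>The end point is specified only in the component on which the condition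
    depends.\<close>
  then show "generically ?C (trains n rA rB F) (\<lambda>x. fst x $ i \<noteq> 0)"
    using poly_funs_train(1)[of i rA n rB]
    by (intro generically_trains_if_scale_invariant[where ?x1.0 = "(vec rA (\<lambda>_. 1), undefined)", OF _ _ _ F])
       (auto simp: case_prod_beta')
next
  let ?C = "train_coords n rA rB"
  fix j assume "j \<in> {..<rB}"
  then show "generically ?C (trains n rA rB F) (\<lambda>x. fst (snd x) $ j \<noteq> 0)"
    using poly_funs_train(2)[of j rB n rA]
    by (intro generically_trains_if_scale_invariant[where ?x1.0 = "(undefined, vec rB (\<lambda>_. 1), undefined)", OF _ _ _ F])
       (auto simp: case_prod_beta')
next
  fix ij assume "ij \<in> {..<rA} \<times> {..<rB}"
  then obtain i j where ij: "ij = (i, j)" "i < rA" "j < rB" by auto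
  \<comment> \<open>All columns equal the first unit vector, so all inner products are 1.\<close>
  let ?x = "(undefined, undefined, mat n rA (\<lambda>(k, _). if k = 0 then 1 else 0), mat n rB (\<lambda>(k, _). if k = 0 then 1 else 0)) :: train"
  have "train_ip n i j ?x = (\<Sum>k<n. if k = 0 then 1 else 0)"
    using ij unfolding train_ip_def prod.case by (intro sum.cong) auto
  then have "train_ip n i j ?x \<noteq> 0" using n by simp
  then have "generically (train_coords n rA rB) (trains n rA rB F) (\<lambda>x. train_ip n i j x \<noteq> 0)"
    using ij(2,3)
    by (intro generically_trains_if_scale_invariant[where ?x1.0 = ?x, OF _ _ _ F] poly_funs_train_ip)
       (simp_all add: train_ip_unit_scaled[of _ n rA _ rB])
  then show "generically (train_coords n rA rB) (trains n rA rB F) (\<lambda>x. case ij of (i, j) \<Rightarrow> train_ip n i j x \<noteq> 0)"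
    by (simp add: ij)
next
  show "finite {(i, i', j, j'). i < rA \<and> i' < rA \<and> j < rB \<and> j' < rB \<and> i \<noteq> i' \<and> j \<noteq> j'}"
    by (rule finite_subset[of _ "{..<rA} \<times> {..<rA} \<times> {..<rB} \<times> {..<rB}"]) auto
  fix q assume "q \<in> {(i, i', j, j'). i < rA \<and> i' < rA \<and> j < rB \<and> j' < rB \<and> i \<noteq> i' \<and> j \<noteq> j'}"
  then obtain i i' j j' where q: "q = (i, i', j, j')" "i < rA" "i' < rA" "j < rB" "j' < rB" "i \<noteq> i'" "j \<noteq> j'"
    by auto
  let ?D = "\<lambda>x. train_ip n i j x * train_ip n i' j' x - train_ip n i j' x * train_ip n i' j x"
  \<comment> \<open>The two chosen columns of each factor are the first two unit vectors, so the
    minor is that of the identity. Two distinct indices below \<open>rA\<close> guarantee that the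
    space has dimension at least 2.\<close>
  let ?e = "\<lambda>c c'. \<lambda>(k :: nat, d :: nat). if d = c \<and> k = 0 \<or> d = c' \<and> k = 1 then 1 else 0 :: real"
  let ?x = "(undefined, undefined, mat n rA (?e i i'), mat n rB (?e j j')) :: train"
  have n2: "1 < n" using q(2,3,6) n by linarith
  have "train_ip n i j ?x = (\<Sum>k<n. if k = 0 then 1 else 0)" "train_ip n i' j' ?x = (\<Sum>k<n. if k = 1 then 1 else 0)"
    "train_ip n i j' ?x = (\<Sum>k<n. 0)" "train_ip n i' j ?x = (\<Sum>k<n. 0)"
    using q unfolding train_ip_def prod.case by (intro sum.cong; auto)+
  then have D1: "?D ?x \<noteq> 0" using n2 by simp
  have "generically (train_coords n rA rB) (trains n rA rB F) (\<lambda>x. ?D x \<noteq> 0)"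
  proof (rule generically_trains_if_scale_invariant[where p = ?D, OF _ D1 _ F])
    show "?D \<in> poly_funs (train_coords n rA rB)"
      using q by (intro poly_funs_diff poly_funs.mult poly_funs_train_ip) auto
    fix l m and U V :: "real mat"
    assume U: "U \<in> carrier_mat n rA" and V: "V \<in> carrier_mat n rB"
      and nz: "\<And>i. i < rA \<Longrightarrow> vnorm (col U i) \<noteq> 0" "\<And>j. j < rB \<Longrightarrow> vnorm (col V j) \<noteq> 0"
      and D: "?D (l, m, U, V) \<noteq> 0"
    have "?D (l, m, unit_scaled U, unit_scaled V) = ?D (l, m, U, V) /
        (vnorm (col U i) * vnorm (col U i') * vnorm (col V j) * vnorm (col V j'))"
      unfolding train_ip_unit_scaled[OF U V q(2,4)] train_ip_unit_scaled[OF U V q(3,5)]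
        train_ip_unit_scaled[OF U V q(2,5)] train_ip_unit_scaled[OF U V q(3,4)]
      by (simp add: diff_divide_distrib ac_simps)
    then show "?D (l, m, unit_scaled U, unit_scaled V) \<noteq> 0" using D nz q by simp
  qed
  then show "generically (train_coords n rA rB) (trains n rA rB F) (\<lambda>x. case q of (i, i', j, j') \<Rightarrow>
      train_ip n i j x * train_ip n i' j' x - train_ip n i j' x * train_ip n i' j x \<noteq> 0)"
    by (simp add: q(1))
next
  \<comment> \<open>The first \<open>r\<close> unit vectors serve as witness; there are that many
    because \<open>r\<close> is at most \<open>n\<close>.\<close>
  have one: "gram_det n r (mat n r (\<lambda>(k, i). if k = i then 1 else 0)) = 1" if "r \<le> n" for r
  proof -
    have "(\<Sum>k<n. mat n r (\<lambda>(k, i). if k = i then 1 else 0 :: real) $$ (k, i) *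
        mat n r (\<lambda>(k, i). if k = i then 1 else 0) $$ (k, j)) = (if i = j then 1 else 0)"
      if ij: "i < r" "j < r" for i j
    proof -
      have "(\<Sum>k<n. mat n r (\<lambda>(k, i). if k = i then 1 else 0 :: real) $$ (k, i) *
        mat n r (\<lambda>(k, i). if k = i then 1 else 0) $$ (k, j)) = (\<Sum>k<n. if k = i then (if i = j then 1 else 0) else 0)"
        using ij by (intro sum.cong) auto
      then show ?thesis using ij \<open>r \<le> n\<close> by simp
    qed
    then have "mat r r (\<lambda>(i, j). \<Sum>k<n. mat n r (\<lambda>(k, i). if k = i then 1 else 0 :: real) $$ (k, i) *
        mat n r (\<lambda>(k, i). if k = i then 1 else 0) $$ (k, j)) = 1\<^sub>m r"
      by (intro eq_matI) auto
    then show ?thesis unfolding gram_det_def by simp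
  qed
  let ?I = "\<lambda>r. mat n r (\<lambda>(k, i). if k = i then 1 else 0) :: real mat"
  show "generically (train_coords n rA rB) (trains n rA rB F) (\<lambda>x. gram_det n rA (fst (snd (snd x))) \<noteq> 0)"
    using one[OF n(2)] poly_funs_train(3)[of _ n _ rA rB]
    by (intro poly_funs_gram_det generically_trains_if_scale_invariant[where ?x1.0 = "(undefined, undefined, ?I rA, undefined)", OF _ _ _ F])
       (auto simp: case_prod_beta' gram_det_unit_scaled)
  show "generically (train_coords n rA rB) (trains n rA rB F) (\<lambda>x. gram_det n rB (snd (snd (snd x))) \<noteq> 0)"
    using one[OF n(3)] poly_funs_train(4)[of _ n _ rB rA]
    by (intro poly_funs_gram_det generically_trains_if_scale_invariant[where ?x1.0 = "(undefined, undefined, undefined, ?I rB)", OF _ _ _ F])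
       (auto simp: case_prod_beta' gram_det_unit_scaled)
qed simp_all

section \<open>Genericity for orthonormal vectors\<close>

text \<open>With the vectors held fixed, the coefficients range over a linear space and can move
  along lines on any of the varieties. What is already known generically about the vectors comes in
  through \<open>D\<close>.\<close>

lemma generically_trains_coefficients:
  assumes p: "p \<in> poly_funs (train_coords n rA rB)"
    and D: "generically (train_coords n rA rB) (trains n rA rB F) D"
    and ex: "\<And>l m U V. (l, m, U, V) \<in> trains n rA rB F \<Longrightarrow> D (l, m, U, V) \<Longrightarrow> \<exists>l1 m1. p (l1, m1, U, V) \<noteq> 0"
  shows "generically (train_coords n rA rB) (trains n rA rB F) (\<lambda>x. p x \<noteq> 0)"
proof (rule generically_nonzero_if_lines[OF p D])
  fix x :: train assume x: "x \<in> trains n rA rB F" and Dx: "D x"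
  obtain l0 m0 U V where xeq: "x = (l0, m0, U, V)" by (cases x)
  obtain l1 m1 where p1: "p (l1, m1, U, V) \<noteq> 0" using ex x Dx unfolding xeq by blast
  define \<gamma> where "\<gamma> = (\<lambda>t::real. (vec rA (\<lambda>i. (1 - t) * l0 $ i + t * l1 $ i), vec rB (\<lambda>j. (1 - t) * m0 $ j + t * m1 $ j), U, V))"
  have "\<gamma> t \<in> trains n rA rB F" for t
    using x unfolding \<gamma>_def trains_def xeq by simp
  moreover have "c (\<gamma> t) = (1 - t) * c x + t * c (l1, m1, U, V)" if "c \<in> train_coords n rA rB" for c t
    using that unfolding train_coords_def \<gamma>_def xeq by (auto simp: algebra_simps)
  ultimately show "\<exists>x1 \<gamma>. p x1 \<noteq> 0 \<and> (\<forall>t. \<gamma> t \<in> trains n rA rB F) \<and>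
      (\<forall>c\<in>train_coords n rA rB. \<forall>t::real. c (\<gamma> t) = (1 - t) * c x + t * c x1)"
    using p1 by (intro exI[of _ "(l1, m1, U, V)"] exI[of _ \<gamma>] conjI ballI allI)
qed

text \<open>For the rotation below: the inner product of two columns after each has been shifted
  within the plane of \<open>w\<close> and \<open>z\<close>.\<close>

lemma sum_mult_plane_shift:
  fixes f g w z :: "'i \<Rightarrow> real"
  shows "(\<Sum>k\<in>K. (f k + a * w k + b * z k) * (g k + a' * w k + b' * z k)) =
    (\<Sum>k\<in>K. f k * g k) + a' * (\<Sum>k\<in>K. w k * f k) + b' * (\<Sum>k\<in>K. z k * f k)
    + a * (\<Sum>k\<in>K. w k * g k) + b * (\<Sum>k\<in>K. z k * g k)
    + a * a' * (\<Sum>k\<in>K. w k * w k) + b * b' * (\<Sum>k\<in>K. z k * z k) + (a * b' + b * a') * (\<Sum>k\<in>K. w k * z k)"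
  unfolding sum_distrib_left sum.distrib[symmetric] by (intro sum.cong refl) (simp add: algebra_simps)

text \<open>A rotation in the plane spanned by \<open>u\<^sub>i\<close> and \<open>v\<^sub>j\<close> makes these vectors non-orthogonal.\<close>

lemma generically_train_ip_orthonormal:
  assumes ij: "i < rA" "j < rB"
  shows "generically (train_coords n rA rB) (trains n rA rB orthonormal_cols) (\<lambda>x. train_ip n i j x \<noteq> 0)"
proof (rule generically_nonzero_if_curves[OF poly_funs_train_ip[OF ij] generically_True])
  fix x :: train assume x: "x \<in> trains n rA rB orthonormal_cols"
  obtain l m U V where xeq: "x = (l, m, U, V)" by (cases x)
  have lm: "l \<in> carrier_vec rA" "m \<in> carrier_vec rB" and U: "U \<in> carrier_mat n rA" "orthonormal_cols U"
    and V: "V \<in> carrier_mat n rB" "orthonormal_cols V"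
    using x unfolding trains_def xeq by auto
  show "\<exists>\<gamma>. (\<forall>\<^sub>F t in at_right (0::real). \<gamma> t \<in> trains n rA rB orthonormal_cols \<and> train_ip n i j (\<gamma> t) \<noteq> 0) \<and>
      (\<forall>c\<in>train_coords n rA rB. ((\<lambda>t. c (\<gamma> t)) \<longlongrightarrow> c x) (at_right 0))"
  proof (cases "train_ip n i j x = 0")
    case False
    then show ?thesis using x by (intro exI[of _ "\<lambda>_. x"]) auto
  next
    case True
    \<comment> \<open>In this case \<open>u\<^sub>i\<close> and \<open>v\<^sub>j\<close> are
      orthonormal, and \<open>a c\<close>, \<open>b c\<close> are the components of column c of
      \<open>U\<close> along them. \<open>p\<close> and \<open>q\<close> are the changes of these
      components under the rotation by t in their plane. All columns of \<open>U\<close> are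
      rotated, which keeps them orthonormal, while \<open>V\<close> stays fixed.\<close>
    define a where "a = (\<lambda>c. \<Sum>k<n. U $$ (k, i) * U $$ (k, c))"
    define b where "b = (\<lambda>c. \<Sum>k<n. V $$ (k, j) * U $$ (k, c))"
    define p where "p = (\<lambda>t c. (cos t - 1) * a c - sin t * b c)"
    define q where "q = (\<lambda>t c. (cos t - 1) * b c + sin t * a c)"
    define R where "R = (\<lambda>t. mat n rA (\<lambda>(k, c). U $$ (k, c) + p t c * U $$ (k, i) + q t c * V $$ (k, j)))"
    define \<gamma> where "\<gamma> = (\<lambda>t. (l, m, R t, V))"
    have UU: "(\<Sum>k<n. U $$ (k, c) * U $$ (k, d)) = (if c = d then 1 else 0)" if "c < rA" "d < rA" for c d
      using U that unfolding orthonormal_cols_iff[OF U(1)] by (simp add: scalar_prod_lessThan)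
    have VV: "(\<Sum>k<n. V $$ (k, j) * V $$ (k, j)) = 1"
      using V ij unfolding orthonormal_cols_iff[OF V(1)] by (simp add: scalar_prod_lessThan)
    have UV: "(\<Sum>k<n. U $$ (k, i) * V $$ (k, j)) = 0"
      using True unfolding xeq train_ip_def by simp
    have ai: "a i = 1" using UU ij by (simp add: a_def)
    have bi: "b i = 0" using UV by (simp add: b_def mult.commute)
    have R: "R t \<in> carrier_mat n rA" for t by (simp add: R_def)
    \<comment> \<open>The left side is the change of the inner product of two columns; it vanishes
      when \<open>C\<close> and \<open>S\<close> are cosine and sine of the same angle.\<close>
    have rotation: "((C - 1) * A' - S * B') * A + ((C - 1) * B' + S * A') * B +
        ((C - 1) * A - S * B) * A' + ((C - 1) * B + S * A) * B' +
        ((C - 1) * A - S * B) * ((C - 1) * A' - S * B') +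
        ((C - 1) * B + S * A) * ((C - 1) * B' + S * A') = (C\<^sup>2 + S\<^sup>2 - 1) * (A * A' + B * B')"
      for C S A A' B B' :: real
      by (simp add: algebra_simps power2_eq_square)
    have "orthonormal_cols (R t)" for t
      unfolding orthonormal_cols_iff[OF R]
    proof (intro allI impI)
      fix c d assume cd: "c < rA" "d < rA"
      have "col (R t) c \<bullet> col (R t) d = (\<Sum>k<n. (U $$ (k, c) + p t c * U $$ (k, i) + q t c * V $$ (k, j)) *
          (U $$ (k, d) + p t d * U $$ (k, i) + q t d * V $$ (k, j)))"
        using cd by (simp add: R_def scalar_prod_lessThan)
      also have "\<dots> = (\<Sum>k<n. U $$ (k, c) * U $$ (k, d)) + (p t d * a c + q t d * b c + p t c * a d + q t c * b d
          + p t c * p t d + q t c * q t d)"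
        unfolding sum_mult_plane_shift UV VV using UU[OF ij(1) ij(1)] by (simp add: a_def b_def)
      also have "p t d * a c + q t d * b c + p t c * a d + q t c * b d + p t c * p t d + q t c * q t d =
          ((cos t)\<^sup>2 + (sin t)\<^sup>2 - 1) * (a c * a d + b c * b d)"
        unfolding p_def q_def by (rule rotation)
      finally show "col (R t) c \<bullet> col (R t) d = (if c = d then 1 else 0)"
        using UU[OF cd] by simp
    qed
    then have "\<gamma> t \<in> trains n rA rB orthonormal_cols" for t
      unfolding \<gamma>_def trains_def using lm V R by simp
    \<comment> \<open>The rotation sends \<open>u\<^sub>i\<close> to cos t times
      \<open>u\<^sub>i\<close> plus sin t times \<open>v\<^sub>j\<close>.\<close>
    moreover have "train_ip n i j (\<gamma> t) = sin t" for t
    proof -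
      have "train_ip n i j (\<gamma> t) = (\<Sum>k<n. cos t * (U $$ (k, i) * V $$ (k, j)) + sin t * (V $$ (k, j) * V $$ (k, j)))"
        unfolding train_ip_def \<gamma>_def prod.case using ij ai bi
        by (intro sum.cong) (auto simp: R_def p_def q_def algebra_simps)
      also have "\<dots> = sin t"
        unfolding sum.distrib sum_distrib_left[symmetric] UV VV by simp
      finally show ?thesis .
    qed
    moreover have "\<forall>\<^sub>F t in at_right (0::real). sin t \<noteq> 0"
    proof -
      have "\<forall>\<^sub>F t in at_right (0::real). t \<in> {0<..<pi}"
        by (rule eventually_at_right_real) simp
      then show ?thesis by eventually_elim (use sin_gt_zero in force)
    qed
    moreover have "((\<lambda>t. c (\<gamma> t)) \<longlongrightarrow> c x) (at_right 0)" if c: "c \<in> train_coords n rA rB" for c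
    proof -
      have "((\<lambda>t. R t $$ (k, d)) \<longlongrightarrow> U $$ (k, d)) (at_right 0)" if "k < n" "d < rA" for k d
      proof -
        have "((\<lambda>t. U $$ (k, d) + p t d * U $$ (k, i) + q t d * V $$ (k, j)) \<longlongrightarrow>
            U $$ (k, d) + ((cos 0 - 1) * a d - sin 0 * b d) * U $$ (k, i) + ((cos 0 - 1) * b d + sin 0 * a d) * V $$ (k, j)) (at_right (0::real))"
          unfolding p_def q_def by (intro tendsto_intros)
        then show ?thesis using that by (simp add: R_def)
      qed
      then show ?thesis using c unfolding train_coords_def \<gamma>_def xeq by auto
    qed
    ultimately show ?thesis
      by (intro exI[of _ \<gamma>]) (simp add: eventually_conj_iff)
  qed
qed

text \<open>In the non-orthogonal case generic vectors may be read as arbitrary vectors or as unit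
  vectors; the two values of \<open>F\<close> cover both readings.\<close>

theorem theorem1:
  fixes n rA rB :: nat
  assumes "1 \<le> rA" "rA \<le> n" "1 \<le> rB" "rB \<le> n"
  shows "generically (train_coords n rA rB) (trains n rA rB orthonormal_cols) (\<lambda>(l, m, U, V).
           slice_plain n (train_tensor l m U V) (recovers l m U V))
       \<and> ((rA = 1 \<longleftrightarrow> rB = 1) \<longrightarrow> (\<forall>F\<in>{unit_cols, \<lambda>_. True}.
           generically (train_coords n rA rB) (trains n rA rB F) (\<lambda>(l, m, U, V).
             slice_whitened n (train_tensor l m U V) (recovers l m U V))))"
proof (intro conjI impI ballI)
  let ?C = "train_coords n rA rB" and ?X = "trains n rA rB orthonormal_cols"
  let ?ip = "train_ip n"
  have ip: "generically ?C ?X (\<lambda>x. \<forall>(i, j)\<in>{..<rA} \<times> {..<rB}. ?ip i j x \<noteq> 0)"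
    using generically_train_ip_orthonormal by (intro generically_ball) auto
  have l: "generically ?C ?X (\<lambda>x. \<forall>i\<in>{..<rA}. fst x $ i \<noteq> 0)"
  proof (intro generically_ball)
    fix i assume "i \<in> {..<rA}"
    then show "generically ?C ?X (\<lambda>x. fst x $ i \<noteq> 0)"
      using poly_funs_train(1)[of i rA n rB]
      by (intro generically_trains_coefficients[OF _ generically_True] exI[of _ "vec rA (\<lambda>_. 1)"])
        (auto simp: case_prod_beta')
  qed simp
  have m: "generically ?C ?X (\<lambda>x. \<forall>j\<in>{..<rB}. fst (snd x) $ j \<noteq> 0)"
  proof (intro generically_ball)
    fix j assume "j \<in> {..<rB}"
    then show "generically ?C ?X (\<lambda>x. fst (snd x) $ j \<noteq> 0)"
      using poly_funs_train(2)[of j rB n rA]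
      by (intro generically_trains_coefficients[OF _ generically_True] exI[of _ "vec rB (\<lambda>_. 1)"])
        (auto simp: case_prod_beta')
  qed simp
  have rows: "generically ?C ?X (\<lambda>x. \<forall>(i, i')\<in>{(i, i'). i < rA \<and> i' < rA \<and> i \<noteq> i'}.
      fst x $ i * ?ip i 0 x - fst x $ i' * ?ip i' 0 x \<noteq> 0)"
  proof (intro generically_ball)
    show "finite {(i, i'). i < rA \<and> i' < rA \<and> i \<noteq> i'}"
      by (rule finite_subset[of _ "{..<rA} \<times> {..<rA}"]) auto
    fix z assume "z \<in> {(i, i'). i < rA \<and> i' < rA \<and> i \<noteq> i'}"
    then obtain i i' where z: "z = (i, i')" "i < rA" "i' < rA" "i \<noteq> i'" by auto
    let ?p = "\<lambda>x. fst x $ i * ?ip i 0 x - fst x $ i' * ?ip i' 0 x"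
    have "generically ?C ?X (\<lambda>x. ?p x \<noteq> 0)"
    proof (rule generically_trains_coefficients[where p = ?p, OF _ ip])
      show "?p \<in> poly_funs ?C"
        using z assms poly_funs_train(1)[of _ rA n rB, unfolded case_prod_beta']
        by (intro poly_funs_diff poly_funs.mult poly_funs_train_ip) auto
      fix l m U V assume "\<forall>(i, j)\<in>{..<rA} \<times> {..<rB}. ?ip i j (l, m, U, V) \<noteq> 0"
      then have "?ip i 0 (l, m, U, V) \<noteq> 0" using z assms by auto
      \<comment> \<open>Concentrating the coefficients at \<open>i\<close> removes the second term
        and leaves the inner product with index \<open>i\<close>, which is nonzero by
        \<open>ip\<close>.\<close>
      then have "?p (vec rA (\<lambda>k. if k = i then 1 else 0), m, U, V) \<noteq> 0"
        using z by (simp add: train_ip_def)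
      then show "\<exists>l1 m1. ?p (l1, m1, U, V) \<noteq> 0" by (intro exI)
    qed
    then show "generically ?C ?X (\<lambda>x. case z of (i, i') \<Rightarrow> fst x $ i * ?ip i 0 x - fst x $ i' * ?ip i' 0 x \<noteq> 0)"
      by (simp add: z(1))
  qed
  have cols: "generically ?C ?X (\<lambda>x. \<forall>(j, j')\<in>{(j, j'). j < rB \<and> j' < rB \<and> j \<noteq> j'}.
      fst (snd x) $ j * ?ip 0 j x - fst (snd x) $ j' * ?ip 0 j' x \<noteq> 0)"
  proof (intro generically_ball)
    show "finite {(j, j'). j < rB \<and> j' < rB \<and> j \<noteq> j'}"
      by (rule finite_subset[of _ "{..<rB} \<times> {..<rB}"]) auto
    fix z assume "z \<in> {(j, j'). j < rB \<and> j' < rB \<and> j \<noteq> j'}"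
    then obtain j j' where z: "z = (j, j')" "j < rB" "j' < rB" "j \<noteq> j'" by auto
    let ?p = "\<lambda>x. fst (snd x) $ j * ?ip 0 j x - fst (snd x) $ j' * ?ip 0 j' x"
    have "generically ?C ?X (\<lambda>x. ?p x \<noteq> 0)"
    proof (rule generically_trains_coefficients[where p = ?p, OF _ ip])
      show "?p \<in> poly_funs ?C"
        using z assms poly_funs_train(2)[of _ rB n rA, unfolded case_prod_beta']
        by (intro poly_funs_diff poly_funs.mult poly_funs_train_ip) auto
      fix l m U V assume "\<forall>(i, j)\<in>{..<rA} \<times> {..<rB}. ?ip i j (l, m, U, V) \<noteq> 0"
      then have "?ip 0 j (l, m, U, V) \<noteq> 0" using z assms by auto
      then have "?p (l, vec rB (\<lambda>k. if k = j then 1 else 0), U, V) \<noteq> 0"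
        using z by (simp add: train_ip_def)
      then show "\<exists>l1 m1. ?p (l1, m1, U, V) \<noteq> 0" by (intro exI)
    qed
    then show "generically ?C ?X (\<lambda>x. case z of (j, j') \<Rightarrow> fst (snd x) $ j * ?ip 0 j x - fst (snd x) $ j' * ?ip 0 j' x \<noteq> 0)"
      by (simp add: z(1))
  qed
  show "generically ?C ?X (\<lambda>(l, m, U, V). slice_plain n (train_tensor l m U V) (recovers l m U V))"
    using generically_conj[OF generically_conj[OF generically_conj[OF l m] ip] generically_conj[OF rows cols]]
  proof (rule generically_mono)
    fix x :: train
    obtain l m U V where x: "x = (l, m, U, V)" by (cases x)
    assume "x \<in> ?X"
    then have U: "U \<in> carrier_mat n rA" "orthonormal_cols U" and V: "V \<in> carrier_mat n rB" "orthonormal_cols V"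
      unfolding trains_def x by auto
    have e: "?ip i j x = col U i \<bullet> col V j" if "i < rA" "j < rB" for i j
      unfolding x by (rule train_ip_eq[OF U(1) V(1) that])
    assume gen: "(((\<forall>i\<in>{..<rA}. fst x $ i \<noteq> 0) \<and> (\<forall>j\<in>{..<rB}. fst (snd x) $ j \<noteq> 0)) \<and>
        (\<forall>(i, j)\<in>{..<rA} \<times> {..<rB}. ?ip i j x \<noteq> 0)) \<and>
      (\<forall>(i, i')\<in>{(i, i'). i < rA \<and> i' < rA \<and> i \<noteq> i'}.
        fst x $ i * ?ip i 0 x - fst x $ i' * ?ip i' 0 x \<noteq> 0) \<and>
      (\<forall>(j, j')\<in>{(j, j'). j < rB \<and> j' < rB \<and> j \<noteq> j'}.
        fst (snd x) $ j * ?ip 0 j x - fst (snd x) $ j' * ?ip 0 j' x \<noteq> 0)"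
    have l: "l $ i \<noteq> 0" if "i < rA" for i using gen that by (simp add: x)
    have m: "m $ j \<noteq> 0" if "j < rB" for j using gen that by (simp add: x)
    have uv: "col U i \<bullet> col V j \<noteq> 0" if "i < rA" "j < rB" for i j
      using gen that e[OF that] by auto
    have row: "l $ i * (col U i \<bullet> col V 0) \<noteq> l $ i' * (col U i' \<bullet> col V 0)"
      if "i < rA" "i' < rA" "i \<noteq> i'" for i i'
    proof -
      have "fst x $ i * ?ip i 0 x - fst x $ i' * ?ip i' 0 x \<noteq> 0" using gen that by auto
      then show ?thesis using that assms by (simp add: e) (simp add: x)
    qed
    have col: "m $ j * (col U 0 \<bullet> col V j) \<noteq> m $ j' * (col U 0 \<bullet> col V j')"
      if "j < rB" "j' < rB" "j \<noteq> j'" for j j'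
    proof -
      have "fst (snd x) $ j * ?ip 0 j x - fst (snd x) $ j' * ?ip 0 j' x \<noteq> 0" using gen that by auto
      then show ?thesis using that assms by (simp add: e) (simp add: x)
    qed
    have pos: "0 < rA" "0 < rB" using assms by auto
    have "slice_plain n (train_tensor l m U V) (recovers l m U V)"
      by (rule slice_plain_correct[OF U V pos]) (fact l m uv row col)+
    then show "case x of (l, m, U, V) \<Rightarrow> slice_plain n (train_tensor l m U V) (recovers l m U V)"
      by (simp add: x)
  qed
next
  fix F :: "real mat \<Rightarrow> bool"
  assume r1: "rA = 1 \<longleftrightarrow> rB = 1" and F: "F \<in> {unit_cols, \<lambda>_. True}"
  show "generically (train_coords n rA rB) (trains n rA rB F)
      (\<lambda>(l, m, U, V). slice_whitened n (train_tensor l m U V) (recovers l m U V))"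
    using generically_nondegenerate[OF assms(1,2,4) F]
  proof (rule generically_mono)
    fix x :: train
    obtain l m U V where x: "x = (l, m, U, V)" by (cases x)
    assume "x \<in> trains n rA rB F"
    then have U: "U \<in> carrier_mat n rA" and V: "V \<in> carrier_mat n rB"
      unfolding trains_def x by auto
    have e: "train_ip n i j x = col U i \<bullet> col V j" if "i < rA" "j < rB" for i j
      unfolding x by (rule train_ip_eq[OF U V that])
    assume nd: "nondegenerate n rA rB x"
    have l: "l $ i \<noteq> 0" if "i < rA" for i using nd that by (simp add: nondegenerate_def x)
    have m: "m $ j \<noteq> 0" if "j < rB" for j using nd that by (simp add: nondegenerate_def x)
    have uv: "col U i \<bullet> col V j \<noteq> 0" if "i < rA" "j < rB" for i j
      using nd that e[OF that] by (auto simp: nondegenerate_def)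
    have minor: "(col U i \<bullet> col V j) * (col U i' \<bullet> col V j') \<noteq> (col U i \<bullet> col V j') * (col U i' \<bullet> col V j)"
      if "i < rA" "i' < rA" "j < rB" "j' < rB" "i \<noteq> i'" "j \<noteq> j'" for i i' j j'
    proof -
      have "train_ip n i j x * train_ip n i' j' x - train_ip n i j' x * train_ip n i' j x \<noteq> 0"
        using nd that unfolding nondegenerate_def by blast
      then show ?thesis using that by (simp add: e)
    qed
    \<comment> \<open>Two distinct indices exclude \<open>rA = 1\<close>; the hypothesis on the
      ranks then excludes \<open>rB = 1\<close>, so columns 0 and 1 exist and give the
      minor.\<close>
    have row: "\<exists>j<rB. \<exists>j'<rB. (col U i \<bullet> col V j) * (col U i' \<bullet> col V j') \<noteq> (col U i \<bullet> col V j') * (col U i' \<bullet> col V j)"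
      if "i < rA" "i' < rA" "i \<noteq> i'" for i i'
      using minor[of i i' 0 1] that r1 assms by (intro exI[of _ 0] exI[of _ 1] conjI) linarith+
    have col: "\<exists>i<rA. \<exists>i'<rA. (col U i \<bullet> col V j) * (col U i' \<bullet> col V j') \<noteq> (col U i \<bullet> col V j') * (col U i' \<bullet> col V j)"
      if "j < rB" "j' < rB" "j \<noteq> j'" for j j'
      using minor[of 0 1 j j'] that r1 assms by (intro exI[of _ 0] exI[of _ 1] conjI) linarith+
    obtain LU where LU: "LU \<in> carrier_mat rA n" "LU * U = 1\<^sub>m rA"
      using ex_left_inverse_if_gram_det[OF U] nd by (auto simp: nondegenerate_def x)
    obtain LV where LV: "LV \<in> carrier_mat rB n" "LV * V = 1\<^sub>m rB"
      using ex_left_inverse_if_gram_det[OF V] nd by (auto simp: nondegenerate_def x)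
    have pos: "0 < rA" "0 < rB" using assms by auto
    have "slice_whitened n (train_tensor l m U V) (recovers l m U V)"
      by (rule slice_whitened_correct[OF U LU V LV pos]) (fact l m uv row col)+
    then show "case x of (l, m, U, V) \<Rightarrow> slice_whitened n (train_tensor l m U V) (recovers l m U V)"
      by (simp add: x)
  qed
qed

end
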